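(* Let $S$ be a state space satisfying the following properties. 1. For any two pure states $s_1$ and $s_2$ there exists an isometry $\Phi$ of $S$ such that $\Phi(s_1)=s_2$. 2. For any three pure states $s_1,s_2,s_3$ such that $s_1\bot s_3$ and $s_2\bot s_3$ there exists an isometry $\Phi$ of $S$ such that $\Phi(s_1)=s_2$ and $\Phi(s_3)=s_3$. 3. $S$ has at least three (mutually) orthogonal pure states. 4. Any state can be written as a mixture (convex combination) of (mutually) orthogonal pure states. If the regret $D_F$ satisfies the iso-sufficiency property, then $D_F$ is uniquely determined except for a multiplicative factor. That is, there is a function $D_0:S\times S\to[0,\infty]$ depending only on $S$ such that every regret $D_F$ on $S$ satisfying the iso-sufficiency property has the form $D_F=c\cdot D_0$ for some constant $c\ge 0$ (with $0\cdot\infty=0$).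
   Context: A state space $S$ is a finite-dimensional compact convex set; its elements are called states and its extreme points are called pure states. An isometry of $S$ is an affine bijection $S\to S$. Actions and regret. A closed set $\mathcal A$ of actions is given. Each action $a$ assigns to each state $s$ a random variable $a(s)$ with values in $\mathbb R\cup\{-\infty\}$, and $s\mapsto E[a(s)]$ is affine, because convex combinations of states represent probabilistic mixtures. Put $F(s)=\sup_{a\in\mathcal A}E[a(s)]$. It is assumed that $F$ is finite on $S$ and that for each $s$ the supremum is attained; an action attaining it is called optimal for $s$. The function $F$ is convex. The regret of an action is $D_F(s,a)=F(s)-E[a(s)]\in[0,\infty]$, and the regret of a pair of states is $D_F(s_1,s_2)=\inf_a D_F(s_1,a)$, where the infimum is over all actions $a$ optimal for $s_2$. If the optimal action for $s_2$ is unique, so that $F$ is differentiable there, this is the Bregman divergence $D_F(s_1,s_2)=F(s_1)-F(s_2)-\langle s_1-s_2,\nabla F(s_2)\rangle$. Sufficiency. An affine map $\Phi:S\to S$ is sufficient for a pair $(s_1,s_2)$ if there exists an affine map $\Psi:S\to S$ with $\Psi(\Phi(s_i))=s_i$ for $i=1,2$. An isomixture is a map $\Phi=\sum_{i=1}^k p_i\Phi_i$, where $(p_1,\dots,p_k)$ is a probability vector and each $\Phi_i$ is an isometry of $S$. The regret $D_F$ satisfies the iso-sufficiency property if $D_F(\Phi(s_1),\Phi(s_2))=D_F(s_1,s_2)$ for all states $s_1,s_2$ and every isomixture $\Phi:S\to S$ that is sufficient for $(s_1,s_2)$. Orthogonality. States $s_0,s_1$ are orthogonal, written $s_0\bot s_1$,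 if there is an affine function $\phi:S\to[0,1]$ with $\phi(s_0)=0$ and $\phi(s_1)=1$. *)

theory Defs
  imports "HOL-Probability.Probability"
begin

definition state_space :: "'a::euclidean_space set \<Rightarrow> bool" where
  "state_space S \<longleftrightarrow> compact S \<and> convex S"

definition pure_state :: "'a::euclidean_space set \<Rightarrow> 'a \<Rightarrow> bool" where
  "pure_state S s \<longleftrightarrow> s extreme_point_of S"

text \<open>Only the values on \<open>S\<close> matter for the maps below; their values elsewhere are arbitrary.\<close>

definition affine_map_on :: "'a::euclidean_space set \<Rightarrow> ('a \<Rightarrow> 'b::real_vector) \<Rightarrow> bool" where
  "affine_map_on S f \<longleftrightarrow>
     (\<forall>x\<in>S. \<forall>y\<in>S. \<forall>u\<in>{0..1::real}.
        f ((1 - u) *\<^sub>R x + u *\<^sub>R y) = (1 - u) *\<^sub>R f x + u *\<^sub>R f y)"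

definition isometry_of :: "'a::euclidean_space set \<Rightarrow> ('a \<Rightarrow> 'a) \<Rightarrow> bool" where
  "isometry_of S \<Phi> \<longleftrightarrow> affine_map_on S \<Phi> \<and> bij_betw \<Phi> S S"

definition orthogonal_states :: "'a::euclidean_space set \<Rightarrow> 'a \<Rightarrow> 'a \<Rightarrow> bool" where
  "orthogonal_states S s\<^sub>0 s\<^sub>1 \<longleftrightarrow> s\<^sub>0 \<in> S \<and> s\<^sub>1 \<in> S \<and>
     (\<exists>\<phi> :: 'a \<Rightarrow> real. affine_map_on S \<phi> \<and> \<phi> ` S \<subseteq> {0..1} \<and> \<phi> s\<^sub>0 = 0 \<and> \<phi> s\<^sub>1 = 1)"

definition sufficient_for :: "'a::euclidean_space set \<Rightarrow> ('a \<Rightarrow> 'a) \<Rightarrow> 'a \<Rightarrow> 'a \<Rightarrow> bool" where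
  "sufficient_for S \<Phi> s\<^sub>1 s\<^sub>2 \<longleftrightarrow> affine_map_on S \<Phi> \<and> \<Phi> ` S \<subseteq> S \<and>
     (\<exists>\<Psi>. affine_map_on S \<Psi> \<and> \<Psi> ` S \<subseteq> S \<and> \<Psi> (\<Phi> s\<^sub>1) = s\<^sub>1 \<and> \<Psi> (\<Phi> s\<^sub>2) = s\<^sub>2)"

definition isomixture :: "'a::euclidean_space set \<Rightarrow> ('a \<Rightarrow> 'a) \<Rightarrow> bool" where
  "isomixture S \<Phi> \<longleftrightarrow>
     (\<exists>(k::nat) (p :: nat \<Rightarrow> real) (\<Phi>s :: nat \<Rightarrow> 'a \<Rightarrow> 'a).
        (\<forall>i<k. 0 \<le> p i \<and> isometry_of S (\<Phi>s i)) \<and> (\<Sum>i<k. p i) = 1 \<and>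
        (\<forall>s\<in>S. \<Phi> s = (\<Sum>i<k. p i *\<^sub>R \<Phi>s i s)))"

text \<open>
  A random variable with values in \<open>\<real> \<union> {-\<infinity>}\<close> enters only through its law, so an action is a
  family of laws, i.e. of probability measures on the extended reals that do not charge \<open>\<infinity>\<close>.
  Since such a law has an expectation in \<open>[-\<infinity>, \<infinity>)\<close> exactly when its positive part is integrable,
  this is demanded of every action.
\<close>

type_synonym 'a action = "'a \<Rightarrow> ereal measure"

definition mean :: "ereal measure \<Rightarrow> ereal" where
  "mean M = enn2ereal (\<integral>\<^sup>+ x. e2ennreal x \<partial>M) - enn2ereal (\<integral>\<^sup>+ x. e2ennreal (- x) \<partial>M)"

definition is_payoff_law :: "ereal measure \<Rightarrow> bool" where
  "is_payoff_law M \<longleftrightarrow> prob_space M \<and> sets M = sets borel \<and> (AE x in M. x \<noteq> \<infinity>) \<and>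
     (\<integral>\<^sup>+ x. e2ennreal x \<partial>M) < \<infinity>"

text \<open>In the affinity condition \<open>0 * (-\<infinity>) = 0\<close>, and no mean is \<open>\<infinity>\<close>.\<close>

definition is_action :: "'a::euclidean_space set \<Rightarrow> 'a action \<Rightarrow> bool" where
  "is_action S a \<longleftrightarrow> (\<forall>s\<in>S. is_payoff_law (a s)) \<and>
     (\<forall>s\<in>S. \<forall>t\<in>S. \<forall>u\<in>{0..1::real}.
        mean (a ((1 - u) *\<^sub>R s + u *\<^sub>R t)) = ereal (1 - u) * mean (a s) + ereal u * mean (a t))"

definition payoff :: "'a action set \<Rightarrow> 'a \<Rightarrow> ereal" where
  "payoff A s = (SUP a\<in>A. mean (a s))"

definition optimal_for :: "'a action set \<Rightarrow> 'a \<Rightarrow> 'a action \<Rightarrow> bool" where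
  "optimal_for A s a \<longleftrightarrow> a \<in> A \<and> mean (a s) = payoff A s"

text \<open>
  Closedness of the set of actions refers to pointwise convergence of the expected payoffs
  \<open>s \<mapsto> mean (a s)\<close> on \<open>S\<close>. As the supremum \<open>F\<close> is finite and pointwise limits of affine
  functions bounded by \<open>F\<close> are affine with values in \<open>[-\<infinity>, \<infinity>)\<close>, it is immaterial that the
  closure is taken among all extended-real functions.
\<close>

definition closed_actions :: "'a::euclidean_space set \<Rightarrow> 'a action set \<Rightarrow> bool" where
  "closed_actions S A \<longleftrightarrow>
     closedin (product_topology (\<lambda>_. euclidean) S) ((\<lambda>a. restrict (\<lambda>s. mean (a s)) S) ` A)"

definition decision_problem :: "'a::euclidean_space set \<Rightarrow> 'a action set \<Rightarrow> bool" where
  "decision_problem S A \<longleftrightarrow> (\<forall>a\<in>A. is_action S a) \<and> closed_actions S A \<and>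
     (\<forall>s\<in>S. \<bar>payoff A s\<bar> \<noteq> \<infinity> \<and> (\<exists>a. optimal_for A s a))"

definition action_regret :: "'a action set \<Rightarrow> 'a \<Rightarrow> 'a action \<Rightarrow> ereal" where
  "action_regret A s a = payoff A s - mean (a s)"

definition regret :: "'a action set \<Rightarrow> 'a \<Rightarrow> 'a \<Rightarrow> ereal" where
  "regret A s\<^sub>1 s\<^sub>2 = (INF a\<in>{a. optimal_for A s\<^sub>2 a}. action_regret A s\<^sub>1 a)"

definition iso_sufficiency :: "'a::euclidean_space set \<Rightarrow> 'a action set \<Rightarrow> bool" where
  "iso_sufficiency S A \<longleftrightarrow>
     (\<forall>s\<^sub>1\<in>S. \<forall>s\<^sub>2\<in>S. \<forall>\<Phi>. isomixture S \<Phi> \<and> sufficient_for S \<Phi> s\<^sub>1 s\<^sub>2 \<longrightarrow>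
        regret A (\<Phi> s\<^sub>1) (\<Phi> s\<^sub>2) = regret A s\<^sub>1 s\<^sub>2)"

end

(*
A compact group of affine bijections has a fixed point c in S and preserves an inner product b.
For a pure state s the functional b (s - c) attains its maximum over S at s and its minimum at some
pure state t, so t is orthogonal to s; by transitivity the minimum is attained at all pure states
orthogonal to s. After rescaling this gives a symmetric "transition probability" \<phi> on S with
\<phi> s s = 1 and \<phi> s t = 0 exactly for orthogonal pure states. As \<phi> s vanishes on all mixtures m of
pure states orthogonal to s, it recovers the segment from s to u from its image, the segment from s
to m, under a mixture of isometries fixing s. So regret along such segments does not depend on m, and
three orthogonal states yield the fundamental equation of information theory. Its convex solutions are
multiples C of the binary entropy, whence F (\<Sum> p_i t_i) = \<Sum> p_i F t_i + C \<Sum> p_i ln p_i for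
orthogonal families. Comparing with an action optimal at c shows that F is affine on the pure states.
A chi-square bound on the relative entropy then determines every optimal action inside the face of a
state, and the infinite slope of the entropy forces the value -\<infinity> outside of it.
*)

theory Submission
  imports Defs
begin

text \<open>Isometries here are merely affine bijections, so nothing given relates pure states
  quantitatively. The kernel supplies this from \<open>S\<close> alone, which is why
  \<open>D0\<close> can be fixed before any set of actions. The invariant point and form come from
  minimising an orbit supremum, not from averaging.

  Regret is an infimum over possibly many optimal actions, these may take the value -\<infinity>,
  and \<open>F\<close> is not assumed differentiable. So equal regrets on two segments determine
  \<open>F\<close> only up to affine terms. This loss is harmless: adding one affine function to all
  payoffs does not change the regret, so the affine part of \<open>F\<close> has to be shown affine
  but never computed.

  Spectral decompositions are not unique and need not vary continuously with the state, so the
  entropy is not differentiated through its weights. Instead, the overlaps \<phi> t u of two frames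
  form a doubly stochastic matrix. This bounds the deviation of \<open>F\<close> from its tangent by
  a term quadratic in the step, which is all that a first-order comparison with an optimal action
  requires.\<close>

section \<open>Invariants of the isometry group\<close>

text \<open>
  The supremum of \<open>q\<close> over the orbit of \<open>x\<close> is a uniformly convex function of \<open>x\<close>, because no map
  shrinks distances by more than the factor \<open>d\<close>. So it has a unique minimiser, which is invariant.
\<close>

lemma common_fixed_point:
  fixes K :: "'v::{real_normed_vector,heine_borel} set" and \<Gamma> :: "('v \<Rightarrow> 'v) set"
    and q :: "'v \<Rightarrow> real"
  assumes K: "compact K" "convex K" "K \<noteq> {}"
    and q: "continuous_on UNIV q" "\<And>x y. q ((1/2) *\<^sub>R (x + y)) = q x / 2 + q y / 2 - q (x - y) / 4"
    and e: "0 < e" "\<And>x. e * (norm x)\<^sup>2 \<le> q x"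
    and \<Gamma>: "\<Gamma> \<noteq> {}" "\<And>f g. f \<in> \<Gamma> \<Longrightarrow> g \<in> \<Gamma> \<Longrightarrow> \<exists>h\<in>\<Gamma>. \<forall>x\<in>K. h x = f (g x)"
    and self: "\<And>f x. f \<in> \<Gamma> \<Longrightarrow> x \<in> K \<Longrightarrow> f x \<in> K"
    and cont: "\<And>f. f \<in> \<Gamma> \<Longrightarrow> continuous_on K f"
    and mid: "\<And>f x y. f \<in> \<Gamma> \<Longrightarrow> x \<in> K \<Longrightarrow> y \<in> K \<Longrightarrow>
                f ((1/2) *\<^sub>R (x + y)) = (1/2) *\<^sub>R (f x + f y)"
    and d: "0 < d" "\<And>f x y. f \<in> \<Gamma> \<Longrightarrow> x \<in> K \<Longrightarrow> y \<in> K \<Longrightarrow> d * norm (x - y) \<le> norm (f x - f y)"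
  shows "\<exists>x\<in>K. \<forall>f\<in>\<Gamma>. f x = x"
proof -
  have "compact (q ` K)"
    by (intro compact_continuous_image K continuous_on_subset[OF q(1)]) auto
  then obtain M where M: "\<And>x. x \<in> K \<Longrightarrow> q x \<le> M"
    using compact_imp_bounded bounded_real by (metis abs_le_D1 image_eqI)
  define E where "E x = (SUP f\<in>\<Gamma>. q (f x))" for x
  have bdd: "bdd_above ((\<lambda>f. q (f x)) ` \<Gamma>)" if "x \<in> K" for x
    using M self that by (auto intro!: bdd_aboveI2[where M=M])
  have E_ge: "q (f x) \<le> E x" if "x \<in> K" "f \<in> \<Gamma>" for f x
    unfolding E_def by (rule cSUP_upper[OF that(2) bdd[OF that(1)]])
  have E_le: "E x \<le> b" if "\<And>f. f \<in> \<Gamma> \<Longrightarrow> q (f x) \<le> b" for x b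
    unfolding E_def by (rule cSUP_least[OF \<Gamma>(1) that])
  have q0: "0 \<le> q x" for x
    using e by (meson order_trans mult_nonneg_nonneg less_imp_le zero_le_power2)
  have E0: "0 \<le> E x" if "x \<in> K" for x
    using \<Gamma>(1) E_ge[OF that] q0 by (meson all_not_in_conv order_trans)
  define I where "I = Inf (E ` K)"
  have bddE: "bdd_below (E ` K)" using E0 by (auto intro!: bdd_belowI2[where m=0])
  have I_le: "I \<le> E x" if "x \<in> K" for x
    unfolding I_def by (rule cINF_lower[OF bddE that])
  \<comment> \<open>As a supremum of continuous functions \<open>E\<close> need not be continuous;
    lower semicontinuity along a minimising sequence suffices.\<close>
  have "\<exists>x\<in>K. E x < I + 1 / Suc k" for k
  proof -
    have "I < I + 1 / Suc k" by simp
    then show ?thesis unfolding I_def by (subst (asm) cINF_less_iff[OF K(3) bddE]) auto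
  qed
  then obtain X where X: "\<And>k. X k \<in> K" "\<And>k::nat. E (X k) < I + 1 / Suc k" by metis
  obtain x r where x: "x \<in> K" "strict_mono r" "(X \<circ> r) \<longlonglongrightarrow> x"
    using K(1) X(1) unfolding compact_def by metis
  have Ex: "E x \<le> I"
  proof (rule E_le)
    fix f assume f: "f \<in> \<Gamma>"
    have "(\<lambda>k. f ((X \<circ> r) k)) \<longlonglongrightarrow> f x"
      by (rule continuous_on_tendsto_compose[OF cont[OF f] x(3) x(1)]) (auto simp: X)
    then have 1: "(\<lambda>k. q (f ((X \<circ> r) k))) \<longlonglongrightarrow> q (f x)"
      by (rule continuous_on_tendsto_compose[OF q(1)]) auto
    have "(\<lambda>k. I + 1 / Suc (r k)) \<longlonglongrightarrow> I + 0"
      using LIMSEQ_subseq_LIMSEQ[OF LIMSEQ_inverse_real_of_nat x(2)]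
      by (intro tendsto_intros) (simp add: o_def inverse_eq_divide)
    then have 2: "(\<lambda>k. I + 1 / Suc (r k)) \<longlonglongrightarrow> I" by simp
    have "q (f ((X \<circ> r) k)) \<le> I + 1 / Suc (r k)" for k
      using E_ge[OF X(1) f, of "r k"] X(2)[of "r k"] by simp
    then show "q (f x) \<le> I" using LIMSEQ_le[OF 1 2] by blast
  qed
  have "f x = x" if f: "f \<in> \<Gamma>" for f
  proof (rule ccontr)
    assume ne: "f x \<noteq> x"
    define y where "y = f x"
    have y: "y \<in> K" using self f x(1) by (simp add: y_def)
    \<comment> \<open>By closure under composition, the values of \<open>q\<close> on the orbit of
      \<open>f x\<close> are among those on the orbit of \<open>x\<close>, so \<open>y\<close> is a
      second minimiser.\<close>
    have Ey: "E y \<le> I"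
    proof (rule E_le)
      fix g assume "g \<in> \<Gamma>"
      then obtain h where h: "h \<in> \<Gamma>" "h x = g y" using \<Gamma>(2)[OF _ f] x(1) y_def by metis
      then show "q (g y) \<le> I" using E_ge[OF x(1) h(1)] Ex by simp
    qed
    define z where "z = (1/2) *\<^sub>R (x + y)"
    have z: "z \<in> K" using convexD[OF K(2) x(1) y, of "1/2" "1/2"] by (simp add: z_def scaleR_add_right)
    \<comment> \<open>The midpoint identity gains q (g x - g y) / 4 for each \<open>g\<close>; the
      expansion bound \<open>d\<close> makes the gain independent of \<open>g\<close>, so it
      survives the supremum.\<close>
    define \<rho> where "\<rho> = e * (d * norm (x - y))\<^sup>2 / 4"
    have \<rho>: "0 < \<rho>" using e d ne by (auto simp: \<rho>_def y_def)
    have "E z \<le> I - \<rho>"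
    proof (rule E_le)
      fix g assume g: "g \<in> \<Gamma>"
      have "(d * norm (x - y))\<^sup>2 \<le> (norm (g x - g y))\<^sup>2"
        using d g x y by (intro power_mono) auto
      then have "e * (d * norm (x - y))\<^sup>2 \<le> e * (norm (g x - g y))\<^sup>2"
        using e by simp
      also have "\<dots> \<le> q (g x - g y)" by (rule e)
      finally have "4 * \<rho> \<le> q (g x - g y)" by (simp add: \<rho>_def)
      moreover have "q (g x) \<le> I" "q (g y) \<le> I"
        using E_ge[OF x(1) g] E_ge[OF y g] Ex Ey by auto
      moreover have "q (g z) = q (g x) / 2 + q (g y) / 2 - q (g x - g y) / 4"
        unfolding z_def by (simp add: mid[OF g x(1) y] q)
      ultimately show "q (g z) \<le> I - \<rho>" by simp
    qed
    then show False using I_le[OF z] \<rho> by simp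
  qed
  then show ?thesis using x(1) by blast
qed

section \<open>Affine maps on a convex set\<close>

lemma affine_map_onD:
  assumes "affine_map_on S f" "x \<in> S" "y \<in> S" "0 \<le> u" "u \<le> 1"
  shows "f ((1 - u) *\<^sub>R x + u *\<^sub>R y) = (1 - u) *\<^sub>R f x + u *\<^sub>R f y"
  using assms unfolding affine_map_on_def by auto

text \<open>\<open>f\<close> is constrained only on \<open>S\<close>, which may have empty interior.
  \<open>L\<close> interpolates it on a basis of differences based at a relatively interior point
  \<open>c0\<close>; the defect \<open>\<psi>\<close> then vanishes near \<open>c0\<close> along a
  subspace of directions containing that basis, hence on all of \<open>S\<close>.\<close>

lemma affine_map_on_diff_linear:
  fixes S :: "'a::euclidean_space set" and f :: "'a \<Rightarrow> 'b::real_vector"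
  assumes S: "convex S" and f: "affine_map_on S f"
  shows "\<exists>L. linear L \<and> (\<forall>x\<in>S. \<forall>y\<in>S. f x - f y = L (x - y))"
proof (cases "S = {}")
  case True
  have "linear (\<lambda>x. 0)" by (rule linear_zero)
  then show ?thesis using True by blast
next
  case False
  then obtain c0 where c0: "c0 \<in> rel_interior S" using rel_interior_eq_empty[OF S] by blast
  then have c0S: "c0 \<in> S" using rel_interior_subset by blast
  \<comment> \<open>Relative interiority lets the ray from \<open>x\<close> through
    \<open>c0\<close> continue past \<open>c0\<close>; the cap at 1 makes \<open>\<sigma>\<close>
    usable as a mixing weight.\<close>
  have ext: "\<exists>\<sigma>>0. \<sigma> \<le> 1 \<and> c0 - \<sigma> *\<^sub>R (x - c0) \<in> S" if x: "x \<in> S" for x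
  proof -
    obtain e where e: "e > 1" "(1 - e) *\<^sub>R x + e *\<^sub>R c0 \<in> S"
      using c0 x convex_rel_interior_iff[OF S False] by blast
    define \<sigma> where "\<sigma> = min 1 (e - 1)"
    have \<sigma>: "0 < \<sigma>" "\<sigma> \<le> 1" "\<sigma> \<le> e - 1" using e by (auto simp: \<sigma>_def)
    define w where "w = \<sigma> / (e - 1)"
    have w: "0 \<le> w" "w \<le> 1" using \<sigma> by (auto simp: w_def)
    have "(1 - w) *\<^sub>R c0 + w *\<^sub>R ((1 - e) *\<^sub>R x + e *\<^sub>R c0) \<in> S"
      using convexD[OF S c0S e(2), of "1 - w" w] w by simp
    moreover have "(1 - w) *\<^sub>R c0 + w *\<^sub>R ((1 - e) *\<^sub>R x + e *\<^sub>R c0) = c0 - (w * (e - 1)) *\<^sub>R (x - c0)"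
      by (simp add: algebra_simps)
    moreover have "w * (e - 1) = \<sigma>" using e by (simp add: w_def)
    ultimately show ?thesis using \<sigma> by auto
  qed
  obtain B where B: "B \<subseteq> (\<lambda>x. x - c0) ` S" "independent B" "(\<lambda>x. x - c0) ` S \<subseteq> span B"
    using maximal_independent_subset by blast
  obtain L where L: "linear L" "\<And>b. b \<in> B \<Longrightarrow> L b = f (c0 + b) - f c0"
    using linear_independent_extend[OF B(2), of "\<lambda>b. f (c0 + b) - f c0"] by blast
  define \<psi> where "\<psi> x = f x - f c0 - L (x - c0)" for x
  have \<psi>: "affine_map_on S \<psi>"
    unfolding affine_map_on_def \<psi>_def
  proof (intro ballI)
    fix x y u assume H: "x \<in> S" "y \<in> S" "u \<in> {0..1::real}"
    have "(1 - u) *\<^sub>R x + u *\<^sub>R y - c0 = (1 - u) *\<^sub>R (x - c0) + u *\<^sub>R (y - c0)"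
      by (simp add: algebra_simps)
    then have "L ((1 - u) *\<^sub>R x + u *\<^sub>R y - c0) = (1 - u) *\<^sub>R L (x - c0) + u *\<^sub>R L (y - c0)"
      using L(1) by (simp add: linear_add linear_scale)
    then show "f ((1 - u) *\<^sub>R x + u *\<^sub>R y) - f c0 - L ((1 - u) *\<^sub>R x + u *\<^sub>R y - c0) =
       (1 - u) *\<^sub>R (f x - f c0 - L (x - c0)) + u *\<^sub>R (f y - f c0 - L (y - c0))"
      using affine_map_onD[OF f, of x y u] H by (simp add: algebra_simps)
  qed
  have \<psi>0: "\<psi> c0 = 0" using L(1) by (simp add: \<psi>_def linear_0)
  \<comment> \<open>Asking only for short symmetric segments around \<open>c0\<close> makes
    \<open>Z\<close> a subspace: a sum of directions is realised by the midpoint of two short steps,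
    which stays in \<open>S\<close>.\<close>
  define Z where "Z = {v. \<exists>\<sigma>>0. \<forall>\<tau>. 0 \<le> \<tau> \<and> \<tau> \<le> \<sigma> \<longrightarrow>
      c0 + \<tau> *\<^sub>R v \<in> S \<and> c0 - \<tau> *\<^sub>R v \<in> S \<and> \<psi> (c0 + \<tau> *\<^sub>R v) = 0 \<and> \<psi> (c0 - \<tau> *\<^sub>R v) = 0}"
  have Zneg: "- v \<in> Z" if "v \<in> Z" for v
  proof -
    obtain \<sigma> where \<sigma>: "\<sigma> > 0" "\<And>\<tau>. 0 \<le> \<tau> \<Longrightarrow> \<tau> \<le> \<sigma> \<Longrightarrow> 
       c0 + \<tau> *\<^sub>R v \<in> S \<and> c0 - \<tau> *\<^sub>R v \<in> S \<and> \<psi> (c0 + \<tau> *\<^sub>R v) = 0 \<and> \<psi> (c0 - \<tau> *\<^sub>R v) = 0"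
      using \<open>v \<in> Z\<close> by (auto simp: Z_def)
    then show ?thesis by (auto simp: Z_def intro!: exI[of _ \<sigma>])
  qed
  have Zpos: "\<sigma> *\<^sub>R v \<in> Z" if "v \<in> Z" "\<sigma> > 0" for v \<sigma>
  proof -
    obtain s where s: "s > 0" "\<And>\<tau>. 0 \<le> \<tau> \<Longrightarrow> \<tau> \<le> s \<Longrightarrow>
       c0 + \<tau> *\<^sub>R v \<in> S \<and> c0 - \<tau> *\<^sub>R v \<in> S \<and> \<psi> (c0 + \<tau> *\<^sub>R v) = 0 \<and> \<psi> (c0 - \<tau> *\<^sub>R v) = 0"
      using \<open>v \<in> Z\<close> by (auto simp: Z_def)
    show ?thesis unfolding Z_def
    proof (intro CollectI exI[of _ "s / \<sigma>"] conjI allI impI)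
      show "s / \<sigma> > 0" using s that by simp
    next
      fix \<tau> assume t: "0 \<le> \<tau> \<and> \<tau> \<le> s / \<sigma>"
      then have "0 \<le> \<tau> * \<sigma>" "\<tau> * \<sigma> \<le> s" using that by (auto simp: field_simps)
      from s(2)[OF this] show "c0 + \<tau> *\<^sub>R \<sigma> *\<^sub>R v \<in> S" "c0 - \<tau> *\<^sub>R \<sigma> *\<^sub>R v \<in> S"
        "\<psi> (c0 + \<tau> *\<^sub>R \<sigma> *\<^sub>R v) = 0" "\<psi> (c0 - \<tau> *\<^sub>R \<sigma> *\<^sub>R v) = 0" by auto
    qed
  qed
  \<comment> \<open>One zero suffices: \<open>c0\<close> is the midpoint of the two ends, so
    \<open>\<psi>\<close> vanishes at the opposite end and, by affinity, in between.\<close>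
  have ZI: "v \<in> Z" if "\<sigma> > 0" "c0 + \<sigma> *\<^sub>R v \<in> S" "c0 - \<sigma> *\<^sub>R v \<in> S" "\<psi> (c0 + \<sigma> *\<^sub>R v) = 0" for v \<sigma>
  proof -
    have c0eq: "c0 = (1 - 1/2) *\<^sub>R (c0 + \<sigma> *\<^sub>R v) + (1/2) *\<^sub>R (c0 - \<sigma> *\<^sub>R v)"
    proof -
      have "(1 - 1/2) *\<^sub>R (c0 + \<sigma> *\<^sub>R v) + (1/2) *\<^sub>R (c0 - \<sigma> *\<^sub>R v) = (1/2) *\<^sub>R (c0 + c0)"
        by (simp add: algebra_simps)
      then show ?thesis by simp
    qed
    then have "\<psi> c0 = (1 - 1/2) *\<^sub>R \<psi> (c0 + \<sigma> *\<^sub>R v) + (1/2) *\<^sub>R \<psi> (c0 - \<sigma> *\<^sub>R v)"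
      using affine_map_onD[OF \<psi> that(2) that(3), of "1/2"] by simp
    then have z: "\<psi> (c0 - \<sigma> *\<^sub>R v) = 0" using \<psi>0 that(4) by simp
    show ?thesis unfolding Z_def
    proof (intro CollectI exI[of _ \<sigma>] conjI allI impI)
      fix \<tau> assume t: "0 \<le> \<tau> \<and> \<tau> \<le> \<sigma>"
      define w where "w = \<tau> / \<sigma>"
      have w: "0 \<le> w" "w \<le> 1" "w * \<sigma> = \<tau>" using t that by (auto simp: w_def field_simps)
      have e1: "(1 - w) *\<^sub>R c0 + w *\<^sub>R (c0 + \<sigma> *\<^sub>R v) = c0 + \<tau> *\<^sub>R v"
        and e2: "(1 - w) *\<^sub>R c0 + w *\<^sub>R (c0 - \<sigma> *\<^sub>R v) = c0 - \<tau> *\<^sub>R v"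
        unfolding w(3)[symmetric] by (simp_all add: algebra_simps)
      show "c0 + \<tau> *\<^sub>R v \<in> S" "c0 - \<tau> *\<^sub>R v \<in> S"
        using convexD[OF S c0S that(2), of "1 - w" w] convexD[OF S c0S that(3), of "1 - w" w] w e1 e2 by auto
      show "\<psi> (c0 + \<tau> *\<^sub>R v) = 0" "\<psi> (c0 - \<tau> *\<^sub>R v) = 0"
        using affine_map_onD[OF \<psi> c0S that(2), of w] affine_map_onD[OF \<psi> c0S that(3), of w] w e1 e2 z \<psi>0 that(4)
        by auto
    qed (use that in auto)
  qed
  have "subspace Z"
  proof (rule subspaceI)
    show "0 \<in> Z" using ZI[of 1 0] c0S \<psi>0 by simp
  next
    fix v w assume "v \<in> Z" "w \<in> Z"
    then obtain a b where a: "a > 0" "\<And>\<tau>. 0 \<le> \<tau> \<Longrightarrow> \<tau> \<le> a \<Longrightarrow>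
       c0 + \<tau> *\<^sub>R v \<in> S \<and> c0 - \<tau> *\<^sub>R v \<in> S \<and> \<psi> (c0 + \<tau> *\<^sub>R v) = 0 \<and> \<psi> (c0 - \<tau> *\<^sub>R v) = 0"
      and b: "b > 0" "\<And>\<tau>. 0 \<le> \<tau> \<Longrightarrow> \<tau> \<le> b \<Longrightarrow>
       c0 + \<tau> *\<^sub>R w \<in> S \<and> c0 - \<tau> *\<^sub>R w \<in> S \<and> \<psi> (c0 + \<tau> *\<^sub>R w) = 0 \<and> \<psi> (c0 - \<tau> *\<^sub>R w) = 0"
      unfolding Z_def by blast
    define m where "m = min a b"
    have m: "m > 0" "m \<le> a" "m \<le> b" using a b by (auto simp: m_def)
    note A = a(2)[of m] b(2)[of m]
    have half: "(1/2) *\<^sub>R c0 + (1/2) *\<^sub>R c0 = c0" by (simp add: scaleR_add_left[symmetric])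
    have e1: "(1 - 1/2) *\<^sub>R (c0 + m *\<^sub>R v) + (1/2) *\<^sub>R (c0 + m *\<^sub>R w) = c0 + (m/2) *\<^sub>R (v + w)"
      and e2: "(1 - 1/2) *\<^sub>R (c0 - m *\<^sub>R v) + (1/2) *\<^sub>R (c0 - m *\<^sub>R w) = c0 - (m/2) *\<^sub>R (v + w)"
      using half by (simp_all add: algebra_simps)
    show "v + w \<in> Z"
    proof (rule ZI[of "m/2"])
      show "c0 + (m/2) *\<^sub>R (v + w) \<in> S" unfolding e1[symmetric] by (rule convexD[OF S]) (use A m in auto)
      show "c0 - (m/2) *\<^sub>R (v + w) \<in> S" unfolding e2[symmetric] by (rule convexD[OF S]) (use A m in auto)
      show "\<psi> (c0 + (m/2) *\<^sub>R (v + w)) = 0"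
        unfolding e1[symmetric] using affine_map_onD[OF \<psi>, of "c0 + m *\<^sub>R v" "c0 + m *\<^sub>R w" "1/2"] A m by simp
    qed (use m in auto)
  next
    fix r :: real and v assume v: "v \<in> Z"
    consider "r > 0" | "r = 0" | "r < 0" by linarith
    then show "r *\<^sub>R v \<in> Z"
    proof cases
      case 1 then show ?thesis by (rule Zpos[OF v])
    next
      case 2 then show ?thesis using ZI[of 1 0] c0S \<psi>0 by simp
    next
      case 3 then show ?thesis using Zpos[OF Zneg[OF v], of "- r"] by simp
    qed
  qed
  moreover have "B \<subseteq> Z"
  proof
    fix b assume b: "b \<in> B"
    then obtain x where x: "x \<in> S" "b = x - c0" using B(1) by auto
    obtain \<sigma> where \<sigma>: "\<sigma> > 0" "\<sigma> \<le> 1" "c0 - \<sigma> *\<^sub>R b \<in> S" using ext[OF x(1)] x(2) by auto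
    have e1: "(1 - \<sigma>) *\<^sub>R c0 + \<sigma> *\<^sub>R x = c0 + \<sigma> *\<^sub>R b" by (simp add: x(2) algebra_simps)
    have "\<psi> x = 0" using L(2)[OF b] x(2) by (simp add: \<psi>_def)
    then have "\<psi> (c0 + \<sigma> *\<^sub>R b) = 0"
      using affine_map_onD[OF \<psi> c0S x(1), of \<sigma>] \<sigma> e1 \<psi>0 by simp
    moreover have "c0 + \<sigma> *\<^sub>R b \<in> S"
      using convexD[OF S c0S x(1), of "1 - \<sigma>" \<sigma>] \<sigma> e1 by simp
    ultimately show "b \<in> Z" using ZI \<sigma> by blast
  qed
  ultimately have "span B \<subseteq> Z" by (rule span_minimal[rotated])
  have "\<psi> x = 0" if x: "x \<in> S" for x
  proof -
    have "x - c0 \<in> Z" using B(3) x \<open>span B \<subseteq> Z\<close> by blast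
    then obtain s where s: "s > 0" "\<And>\<tau>. 0 \<le> \<tau> \<Longrightarrow> \<tau> \<le> s \<Longrightarrow> \<psi> (c0 + \<tau> *\<^sub>R (x - c0)) = 0"
      unfolding Z_def by blast
    define \<tau> where "\<tau> = min 1 s"
    have t: "\<tau> > 0" "\<tau> \<le> 1" "\<tau> \<le> s" using s by (auto simp: \<tau>_def)
    have "(1 - \<tau>) *\<^sub>R c0 + \<tau> *\<^sub>R x = c0 + \<tau> *\<^sub>R (x - c0)" by (simp add: algebra_simps)
    then have "\<tau> *\<^sub>R \<psi> x = 0"
      using affine_map_onD[OF \<psi> c0S x, of \<tau>] s(2)[of \<tau>] t \<psi>0 by simp
    then show ?thesis using t by simp
  qed
  then have eq: "f x - f c0 = L (x - c0)" if "x \<in> S" for x using that by (auto simp: \<psi>_def)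
  have "f x - f y = L (x - y)" if "x \<in> S" "y \<in> S" for x y
  proof -
    have "f x - f y = (f x - f c0) - (f y - f c0)" by simp
    also have "\<dots> = L (x - c0) - L (y - c0)" using eq that by simp
    also have "\<dots> = L (x - y)" using L(1) by (simp add: linear_diff[symmetric])
    finally show ?thesis .
  qed
  then show ?thesis using L(1) by blast
qed

text \<open>The linear part of \<open>f\<close> is applied to the deviations from the barycentre,
  whose weighted sum is zero. Terms of weight 0 are removed first, since their points may lie
  outside \<open>S\<close>.\<close>

lemma affine_map_on_sum:
  fixes f :: "'a::euclidean_space \<Rightarrow> 'b::real_vector"
  assumes "convex S" "affine_map_on S f" "finite I" "\<And>i. i \<in> I \<Longrightarrow> 0 \<le> p i"
    "\<And>i. i \<in> I \<Longrightarrow> p i \<noteq> 0 \<Longrightarrow> t i \<in> S" "sum p I = 1"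
  shows "f (\<Sum>i\<in>I. p i *\<^sub>R t i) = (\<Sum>i\<in>I. p i *\<^sub>R f (t i))"
proof -
  obtain L where L: "linear L" "\<And>x y. x \<in> S \<Longrightarrow> y \<in> S \<Longrightarrow> f x - f y = L (x - y)"
    using affine_map_on_diff_linear[OF assms(1,2)] by blast
  define J where "J = {i\<in>I. p i \<noteq> 0}"
  have J: "finite J" "sum p J = 1" "\<And>i. i \<in> J \<Longrightarrow> t i \<in> S" "\<And>i. i \<in> J \<Longrightarrow> 0 \<le> p i"
  proof -
    show "finite J" using assms(3) by (simp add: J_def)
    have "sum p I = sum p J" by (rule sum.mono_neutral_right) (use assms(3) in \<open>auto simp: J_def\<close>)
    then show "sum p J = 1" using assms(6) by simp
    show "t i \<in> S" "0 \<le> p i" if "i \<in> J" for i using that assms(4,5) by (auto simp: J_def)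
  qed
  have eq1: "(\<Sum>i\<in>I. p i *\<^sub>R t i) = (\<Sum>i\<in>J. p i *\<^sub>R t i)"
    and eq2: "(\<Sum>i\<in>I. p i *\<^sub>R f (t i)) = (\<Sum>i\<in>J. p i *\<^sub>R f (t i))"
    by (rule sum.mono_neutral_right; use assms(3) in \<open>auto simp: J_def\<close>)+
  define z where "z = (\<Sum>i\<in>J. p i *\<^sub>R t i)"
  have z: "z \<in> S" unfolding z_def by (rule convex_sum[OF J(1) assms(1) J(2)]) (use J in auto)
  have "(\<Sum>i\<in>J. p i *\<^sub>R f (t i)) - f z = (\<Sum>i\<in>J. p i *\<^sub>R (f (t i) - f z))"
    using J(2) by (simp add: scaleR_diff_right sum_subtractf scaleR_left.sum[symmetric])
  also have "\<dots> = (\<Sum>i\<in>J. L (p i *\<^sub>R (t i - z)))"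
    using J z L by (intro sum.cong) (simp_all add: linear_scale)
  also have "\<dots> = L (\<Sum>i\<in>J. p i *\<^sub>R (t i - z))" using L(1) by (simp add: linear_sum)
  also have "(\<Sum>i\<in>J. p i *\<^sub>R (t i - z)) = 0"
    using J(2) by (simp add: scaleR_diff_right sum_subtractf scaleR_left.sum[symmetric] z_def)
  finally show ?thesis using eq1 eq2 L(1) by (simp add: z_def linear_0)
qed

section \<open>The group of isometries and its uniform distortion bounds\<close>

lemma isometry_of_comp:
  assumes "isometry_of S g" "isometry_of S h" shows "isometry_of S (\<lambda>x. g (h x))"
proof -
  have "\<And>x. x \<in> S \<Longrightarrow> h x \<in> S" using assms(2) by (auto simp: isometry_of_def bij_betw_def)
  moreover have "bij_betw (g \<circ> h) S S"
    using assms by (auto simp: isometry_of_def intro: bij_betw_trans)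
  ultimately show ?thesis
    using assms by (auto simp: isometry_of_def affine_map_on_def comp_def)
qed

lemma isometry_of_mem: "isometry_of S g \<Longrightarrow> x \<in> S \<Longrightarrow> g x \<in> S"
  by (auto simp: isometry_of_def bij_betw_def)

lemma isometry_of_id: "isometry_of S (\<lambda>x. x)"
  by (auto simp: isometry_of_def affine_map_on_def bij_betw_def)

lemma isometry_of_inverse:
  assumes "convex S" "isometry_of S g"
  shows "\<exists>h. isometry_of S h \<and> (\<forall>x\<in>S. h (g x) = x \<and> g (h x) = x)"
proof -
  define h where "h = inv_into S g"
  have bij: "bij_betw g S S" and aff: "affine_map_on S g" using assms(2) by (auto simp: isometry_of_def)
  have hg: "h (g x) = x" and gh: "g (h x) = x" and hS: "h x \<in> S" if "x \<in> S" for x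
    using bij that unfolding h_def
    by (auto simp: bij_betw_inv_into_left bij_betw_inv_into_right bij_betw_def inv_into_into)
  have "affine_map_on S h"
    unfolding affine_map_on_def
  proof (intro ballI)
    fix x y u assume H: "x \<in> S" "y \<in> S" "u \<in> {0..1::real}"
    have "g ((1 - u) *\<^sub>R h x + u *\<^sub>R h y) = (1 - u) *\<^sub>R x + u *\<^sub>R y"
      using affine_map_onD[OF aff hS hS, of x y u] H gh by simp
    moreover have "(1 - u) *\<^sub>R h x + u *\<^sub>R h y \<in> S"
      using convexD[OF assms(1) hS hS, of x y "1 - u" u] H by simp
    ultimately show "h ((1 - u) *\<^sub>R x + u *\<^sub>R y) = (1 - u) *\<^sub>R h x + u *\<^sub>R h y"
      using hg by metis
  qed
  moreover have "bij_betw h S S" unfolding h_def by (rule bij_betw_inv_into[OF bij])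
  ultimately show ?thesis using hg gh by (auto simp: isometry_of_def)
qed

text \<open>\<open>M\<close> depends on \<open>S\<close> only. A ball of radius \<open>e\<close> in
  the affine hull around a relatively interior point lies in \<open>S\<close>, so a vector of length
  \<open>e\<close> is a difference of points of \<open>S\<close>, and so is its image; if
  \<open>R\<close> bounds the norm on \<open>S\<close>, this gives 2 * R / e.\<close>

lemma affine_self_map_linear_bound:
  fixes S :: "'a::euclidean_space set"
  assumes S: "compact S" "convex S" "S \<noteq> {}"
  shows "\<exists>M>0. \<forall>g L. linear L \<longrightarrow> g ` S \<subseteq> S \<longrightarrow> (\<forall>x\<in>S. \<forall>y\<in>S. g x - g y = L (x - y)) \<longrightarrow>
           (\<forall>v\<in>span {x - y | x y. x \<in> S \<and> y \<in> S}. norm (L v) \<le> M * norm v)"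
proof -
  obtain c0 where c0: "c0 \<in> rel_interior S" using rel_interior_eq_empty[OF S(2)] S(3) by blast
  then obtain e where e: "c0 \<in> S" "e > 0" "cball c0 e \<inter> affine hull S \<subseteq> S"
    using mem_rel_interior_cball by blast
  obtain R where R: "\<And>x. x \<in> S \<Longrightarrow> norm x \<le> R" "R > 0"
    using compact_imp_bounded[OF S(1)] bounded_pos by metis
  let ?V = "span {x - y | x y. x \<in> S \<and> y \<in> S}"
  have V: "?V \<subseteq> span ((\<lambda>x. - c0 + x) ` S)"
  proof (rule span_minimal)
    show "{x - y | x y. x \<in> S \<and> y \<in> S} \<subseteq> span ((\<lambda>x. - c0 + x) ` S)"
    proof safe
      fix x y assume "x \<in> S" "y \<in> S"
      then have "(- c0 + x) - (- c0 + y) \<in> span ((\<lambda>x. - c0 + x) ` S)"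
        by (intro span_diff span_base) auto
      then show "x - y \<in> span ((\<lambda>x. - c0 + x) ` S)" by simp
    qed
  qed simp
  have hull: "affine hull S = (\<lambda>x. c0 + x) ` span ((\<lambda>x. - c0 + x) ` S)"
    by (rule affine_hull_span_gen) (use e in \<open>simp add: hull_inc\<close>)
  have "norm (L v) \<le> (2 * R / e) * norm v"
    if L: "linear L" "g ` S \<subseteq> S" "\<forall>x\<in>S. \<forall>y\<in>S. g x - g y = L (x - y)" and v: "v \<in> ?V" for g L v
  proof (cases "v = 0")
    case True then show ?thesis using L by (simp add: linear_0)
  next
    case False
    define w where "w = (e / norm v) *\<^sub>R v"
    have nw: "norm w = e" using False e by (simp add: w_def)
    have "w \<in> span ((\<lambda>x. - c0 + x) ` S)" using v V unfolding w_def by (intro span_scale) auto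
    then have "c0 + w \<in> affine hull S" using hull by blast
    then have cw: "c0 + w \<in> S" using e nw by (auto simp: dist_norm)
    have "L w = g (c0 + w) - g c0" using L(3) cw e(1) by force
    then have "norm (L w) \<le> norm (g (c0 + w)) + norm (g c0)" by (simp add: norm_triangle_ineq4)
    also have "\<dots> \<le> 2 * R" using R(1)[of "g (c0 + w)"] R(1)[of "g c0"] L(2) cw e(1)
      by (smt (verit) image_subset_iff)
    finally have "norm (L w) \<le> 2 * R" .
    moreover have "L w = (e / norm v) *\<^sub>R L v" using L(1) by (simp add: w_def linear_scale)
    ultimately have "(e / norm v) * norm (L v) \<le> 2 * R" using e by simp
    then show ?thesis using e False by (simp add: field_simps)
  qed
  then show ?thesis using e R by (intro exI[of _ "2 * R / e"]) auto
qed

text \<open>Affine bijections need not preserve the norm; the uniform lower bound is the upper bound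
  for the inverse isometry.\<close>

lemma isometry_of_expansive:
  fixes S :: "'a::euclidean_space set"
  assumes S: "compact S" "convex S" "S \<noteq> {}"
  shows "\<exists>d>0. \<forall>g. isometry_of S g \<longrightarrow> (\<forall>x\<in>S. \<forall>y\<in>S. d * norm (x - y) \<le> norm (g x - g y))"
proof -
  obtain M where M: "M > 0" "\<And>g L v. linear L \<Longrightarrow> g ` S \<subseteq> S \<Longrightarrow> (\<forall>x\<in>S. \<forall>y\<in>S. g x - g y = L (x - y)) \<Longrightarrow>
      v \<in> span {x - y | x y. x \<in> S \<and> y \<in> S} \<Longrightarrow> norm (L v) \<le> M * norm v"
    using affine_self_map_linear_bound[OF S] by blast
  have "(1 / M) * norm (x - y) \<le> norm (g x - g y)" if g: "isometry_of S g" and xy: "x \<in> S" "y \<in> S" for g x y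
  proof -
    obtain h where h: "isometry_of S h" "\<And>x. x \<in> S \<Longrightarrow> h (g x) = x"
      using isometry_of_inverse[OF S(2) g] by blast
    obtain L where L: "linear L" "\<forall>x\<in>S. \<forall>y\<in>S. h x - h y = L (x - y)"
      using affine_map_on_diff_linear[OF S(2), of h] h(1) by (auto simp: isometry_of_def)
    have gS: "g x \<in> S" "g y \<in> S" using isometry_of_mem[OF g] xy by auto
    have "x - y = L (g x - g y)" using L(2) gS h(2) xy by metis
    moreover have "norm (L (g x - g y)) \<le> M * norm (g x - g y)"
    proof (rule M(2)[OF L(1) _ L(2)])
      show "h ` S \<subseteq> S" using isometry_of_mem[OF h(1)] by blast
      show "g x - g y \<in> span {x - y | x y. x \<in> S \<and> y \<in> S}" using gS by (intro span_base) blast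
    qed
    ultimately have "norm (x - y) \<le> M * norm (g x - g y)" by simp
    then show ?thesis using M(1) by (simp add: field_simps)
  qed
  then show ?thesis using M(1) by (intro exI[of _ "1 / M"]) auto
qed

section \<open>Invariant point and invariant inner product\<close>

lemma norm_sq_midpoint:
  fixes x y :: "'a::real_inner"
  shows "(norm ((1/2) *\<^sub>R (x + y)))\<^sup>2 = (norm x)\<^sup>2 / 2 + (norm y)\<^sup>2 / 2 - (norm (x - y))\<^sup>2 / 4"
  by (simp add: power2_norm_eq_inner inner_simps inner_commute field_simps)

lemma isometry_center:
  fixes S :: "'a::euclidean_space set"
  assumes S: "compact S" "convex S" "S \<noteq> {}"
  shows "\<exists>c\<in>S. \<forall>g. isometry_of S g \<longrightarrow> g c = c"
proof -
  obtain d where d: "d > 0" "\<And>g x y. isometry_of S g \<Longrightarrow> x \<in> S \<Longrightarrow> y \<in> S \<Longrightarrow> d * norm (x - y) \<le> norm (g x - g y)"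
    using isometry_of_expansive[OF S] by blast
  have "\<exists>x\<in>S. \<forall>f\<in>Collect (isometry_of S). f x = x"
  proof (rule common_fixed_point[where q="\<lambda>x. (norm x)\<^sup>2" and e=1 and d=d, OF S])
    show "continuous_on UNIV (\<lambda>x::'a. (norm x)\<^sup>2)" by (intro continuous_intros)
    show "Collect (isometry_of S) \<noteq> {}" using isometry_of_id by blast
    show "\<exists>h\<in>Collect (isometry_of S). \<forall>x\<in>S. h x = f (g x)"
      if "f \<in> Collect (isometry_of S)" "g \<in> Collect (isometry_of S)" for f g
      using isometry_of_comp[of S f g] that by auto
    show "continuous_on S f" if f: "f \<in> Collect (isometry_of S)" for f
    proof -
      obtain L where L: "linear L" "\<forall>x\<in>S. \<forall>y\<in>S. f x - f y = L (x - y)"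
        using affine_map_on_diff_linear[OF S(2), of f] f by (auto simp: isometry_of_def)
      obtain s where s: "s \<in> S" using S(3) by blast
      have "continuous_on S (\<lambda>x. f s + L (x - s))"
        by (intro continuous_intros linear_continuous_on_compose[OF _ L(1)])
      then show ?thesis
        by (rule continuous_on_eq) (metis L(2) s add_diff_cancel_left' add.commute diff_add_cancel)
    qed
    show "f ((1/2) *\<^sub>R (x + y)) = (1/2) *\<^sub>R (f x + f y)"
      if "f \<in> Collect (isometry_of S)" "x \<in> S" "y \<in> S" for f x y
      using affine_map_onD[of S f x y "1/2"] that by (auto simp: isometry_of_def scaleR_add_right)
    show "(norm ((1/2) *\<^sub>R (x + y)))\<^sup>2 = (norm x)\<^sup>2 / 2 + (norm y)\<^sup>2 / 2 - (norm (x - y))\<^sup>2 / 4"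
      for x y :: 'a by (rule norm_sq_midpoint)
  qed (use d isometry_of_mem in auto)
  then show ?thesis by auto
qed

text \<open>The invariant form is a fixed point of the action of \<open>\<Gamma>\<close> on symmetric operators.\<close>

lemma invariant_form:
  fixes \<Gamma> :: "('a::euclidean_space \<Rightarrow>\<^sub>L 'a) set"
  assumes id: "id_blinfun \<in> \<Gamma>"
    and comp: "\<And>A B. A \<in> \<Gamma> \<Longrightarrow> B \<in> \<Gamma> \<Longrightarrow> A o\<^sub>L B \<in> \<Gamma>"
    and inverse: "\<And>A. A \<in> \<Gamma> \<Longrightarrow> \<exists>B\<in>\<Gamma>. B o\<^sub>L A = id_blinfun \<and> A o\<^sub>L B = id_blinfun"
    and M: "1 \<le> M" "\<And>A v. A \<in> \<Gamma> \<Longrightarrow> norm (blinfun_apply A v) \<le> M * norm v"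
  shows "\<exists>b :: 'a \<Rightarrow> 'a \<Rightarrow> real. bilinear b \<and> (\<forall>u v. b u v = b v u) \<and> (\<forall>v. v \<noteq> 0 \<longrightarrow> 0 < b v v) \<and>
           (\<forall>A\<in>\<Gamma>. \<forall>u v. b (blinfun_apply A u) (blinfun_apply A v) = b u v)"
proof -
  \<comment> \<open>Testing the bounds at all \<open>A u\<close> makes \<open>K\<close> invariant
    under the action; the lower bound keeps every form in \<open>K\<close> positive definite, the
    upper one keeps \<open>K\<close> bounded.\<close>
  define K where "K = {P :: 'a \<Rightarrow>\<^sub>L 'a. (\<forall>u v. u \<bullet> P v = v \<bullet> P u) \<and>
      (\<forall>A\<in>\<Gamma>. \<forall>u. (norm u)\<^sup>2 / M\<^sup>2 \<le> A u \<bullet> P (A u) \<and> A u \<bullet> P (A u) \<le> M\<^sup>2 * (norm u)\<^sup>2)}"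
  have below: "norm v / M \<le> norm (A v)" if A: "A \<in> \<Gamma>" for A v
  proof -
    obtain B where B: "B \<in> \<Gamma>" "B o\<^sub>L A = id_blinfun" using inverse[OF A] by blast
    have "v = B (A v)" using B(2) by (metis blinfun_apply_blinfun_compose blinfun_apply_id_blinfun)
    then have "norm v \<le> M * norm (A v)" using M(2)[OF B(1), of "A v"] by simp
    then show ?thesis using M(1) by (simp add: field_simps)
  qed
  have idK: "id_blinfun \<in> K"
    unfolding K_def
  proof (intro CollectI conjI allI ballI)
    fix A u assume A: "A \<in> \<Gamma>"
    have "(norm u / M)\<^sup>2 \<le> (norm (A u))\<^sup>2" using below[OF A, of u] M(1) by (intro power_mono) auto
    then show "(norm u)\<^sup>2 / M\<^sup>2 \<le> A u \<bullet> id_blinfun (A u)"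
      by (simp add: power_divide power2_norm_eq_inner)
    have "(norm (A u))\<^sup>2 \<le> (M * norm u)\<^sup>2" using M(2)[OF A, of u] by (intro power_mono) auto
    then show "A u \<bullet> id_blinfun (A u) \<le> M\<^sup>2 * (norm u)\<^sup>2"
      by (simp add: power_mult_distrib power2_norm_eq_inner)
  qed (simp add: inner_commute)
  have conv: "convex K"
  proof (rule convexI)
    fix P Q :: "'a \<Rightarrow>\<^sub>L 'a" and s t :: real
    assume P: "P \<in> K" and Q: "Q \<in> K" and st: "0 \<le> s" "0 \<le> t" "s + t = 1"
    have ap: "w \<bullet> (s *\<^sub>R P + t *\<^sub>R Q) v = s * (w \<bullet> P v) + t * (w \<bullet> Q v)" for v w
      by (simp add: blinfun.add_left blinfun.scaleR_left inner_add_right)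
    show "s *\<^sub>R P + t *\<^sub>R Q \<in> K"
      unfolding K_def
    proof (intro CollectI conjI allI ballI)
      fix u v show "u \<bullet> (s *\<^sub>R P + t *\<^sub>R Q) v = v \<bullet> (s *\<^sub>R P + t *\<^sub>R Q) u"
        using P Q unfolding ap K_def by auto
    next
      fix A u assume A: "A \<in> \<Gamma>"
      have p: "(norm u)\<^sup>2 / M\<^sup>2 \<le> A u \<bullet> P (A u)" "A u \<bullet> P (A u) \<le> M\<^sup>2 * (norm u)\<^sup>2"
        and q: "(norm u)\<^sup>2 / M\<^sup>2 \<le> A u \<bullet> Q (A u)" "A u \<bullet> Q (A u) \<le> M\<^sup>2 * (norm u)\<^sup>2"
        using P Q A unfolding K_def by auto
      have s1: "s = 1 - t" using st by simp
      show "(norm u)\<^sup>2 / M\<^sup>2 \<le> A u \<bullet> (s *\<^sub>R P + t *\<^sub>R Q) (A u)"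
        using convex_bound_le[of "- (A u \<bullet> P (A u))" "- ((norm u)\<^sup>2 / M\<^sup>2)" "- (A u \<bullet> Q (A u))" s t] p q st
        unfolding ap by simp
      show "A u \<bullet> (s *\<^sub>R P + t *\<^sub>R Q) (A u) \<le> M\<^sup>2 * (norm u)\<^sup>2"
        unfolding ap by (rule convex_bound_le) (use p q st in auto)
    qed
  qed
  have sym: "u \<bullet> P v = v \<bullet> P u" if "P \<in> K" for P u v using that unfolding K_def by blast
  have K1: "(norm u)\<^sup>2 / M\<^sup>2 \<le> u \<bullet> P u" "u \<bullet> P u \<le> M\<^sup>2 * (norm u)\<^sup>2" if "P \<in> K" for P u
    using that id unfolding K_def by (auto dest!: bspec[where x="id_blinfun"])
  \<comment> \<open>\<open>K\<close> controls the quadratic form only; polarisation at the unit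
    vectors in the directions of \<open>P v\<close> and \<open>v\<close> turns this into a bound on
    the operator norm.\<close>
  have "norm P \<le> 2 * M\<^sup>2" if P: "P \<in> K" for P
  proof (rule norm_blinfun_bound)
    fix v :: 'a
    define w where "w = P v"
    have nonneg: "0 \<le> u \<bullet> P u" for u
      using K1(1)[OF P, of u] by (meson divide_nonneg_nonneg order_trans zero_le_power2)
    have pol: "4 * (u \<bullet> P y) \<le> (u + y) \<bullet> P (u + y)" for u y
    proof -
      have "(u + y) \<bullet> P (u + y) - (u - y) \<bullet> P (u - y) = 4 * (u \<bullet> P y)"
        using sym[OF P, of u y] by (simp add: blinfun.add_right blinfun.diff_right inner_simps)
      then show ?thesis using nonneg[of "u - y"] by simp
    qed
    show "norm (P v) \<le> 2 * M\<^sup>2 * norm v"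
    proof (cases "w = 0 \<or> v = 0")
      case True then show ?thesis by (auto simp: w_def)
    next
      case False
      define u where "u = (1 / norm w) *\<^sub>R w"
      define y where "y = (1 / norm v) *\<^sub>R v"
      have uy: "norm u = 1" "norm y = 1" using False by (auto simp: u_def y_def)
      have "u \<bullet> P y = norm w / norm v"
      proof -
        have "P y = (1 / norm v) *\<^sub>R w" by (simp add: y_def w_def blinfun.scaleR_right)
        moreover have "u \<bullet> w = norm w" using False by (simp add: u_def dot_square_norm power2_eq_square)
        ultimately show ?thesis by simp
      qed
      moreover have "(u + y) \<bullet> P (u + y) \<le> M\<^sup>2 * 4"
      proof -
        have n2: "norm (u + y) \<le> 2" using norm_triangle_ineq[of u y] uy by linarith
        have "(norm (u + y))\<^sup>2 \<le> 2\<^sup>2" by (rule power_mono[OF n2 norm_ge_zero])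
        then have "M\<^sup>2 * (norm (u + y))\<^sup>2 \<le> M\<^sup>2 * 2\<^sup>2" by (rule mult_left_mono) simp
        then show ?thesis using K1(2)[OF P, of "u + y"] by simp
      qed
      ultimately have "norm w / norm v \<le> M\<^sup>2" using pol[of u y] by simp
      then have "norm w \<le> M\<^sup>2 * norm v" using False by (simp add: field_simps)
      also have "\<dots> \<le> 2 * M\<^sup>2 * norm v" by simp
      finally show ?thesis by (simp add: w_def)
    qed
  qed simp
  then have "bounded K" unfolding bounded_iff by blast
  moreover have "closed K"
  proof -
    have "K = (\<Inter>u. \<Inter>v. {P. u \<bullet> blinfun_apply P v = v \<bullet> blinfun_apply P u}) \<inter> (\<Inter>A\<in>\<Gamma>. \<Inter>u.
         {P. (norm u)\<^sup>2 / M\<^sup>2 \<le> blinfun_apply A u \<bullet> blinfun_apply P (A u)} \<inter>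
         {P. blinfun_apply A u \<bullet> blinfun_apply P (A u) \<le> M\<^sup>2 * (norm u)\<^sup>2})"
      unfolding K_def by auto
    moreover have "closed \<dots>"
      by (intro closed_Int closed_INT ballI closed_Collect_eq closed_Collect_le continuous_intros)
    ultimately show ?thesis by simp
  qed
  ultimately have compK: "compact K" by (simp add: compact_eq_bounded_closed)
  define adj where "adj A = Blinfun (adjoint (blinfun_apply A))" for A :: "'a \<Rightarrow>\<^sub>L 'a"
  have adj: "u \<bullet> blinfun_apply (adj A) v = A u \<bullet> v" for A :: "'a \<Rightarrow>\<^sub>L 'a" and u v
  proof -
    have l: "linear (blinfun_apply A)" by (simp add: blinfun.bounded_linear_right bounded_linear.linear)
    then have "blinfun_apply (adj A) = adjoint A"
      unfolding adj_def by (intro bounded_linear_Blinfun_apply) (simp add: adjoint_linear linear_conv_bounded_linear[symmetric])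
    then show ?thesis using adjoint_works[OF l] by simp
  qed
  \<comment> \<open>The pullback of the form of \<open>P\<close> along \<open>A\<close>. It reverses
    composition, which is harmless because \<open>\<Gamma>\<close> is closed under products in
    either order.\<close>
  define act where "act A P = adj A o\<^sub>L P o\<^sub>L A" for A P :: "'a \<Rightarrow>\<^sub>L 'a"
  have act: "u \<bullet> blinfun_apply (act A P) v = A u \<bullet> P (A v)" for A P :: "'a \<Rightarrow>\<^sub>L 'a" and u v
    by (simp add: act_def adj)
  have ext: "P = Q" if "\<And>u v. u \<bullet> blinfun_apply P v = u \<bullet> Q v" for P Q :: "'a \<Rightarrow>\<^sub>L 'a"
    by (rule blinfun_eqI) (use that in \<open>metis vector_eq_ldot\<close>)
  have act_comp: "act B (act A P) = act (A o\<^sub>L B) P" for A B P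
    by (rule ext) (simp add: act)
  have act_add: "act A (P + Q) = act A P + act A Q" for A P Q
    by (rule ext) (simp add: act blinfun.add_left inner_add_right)
  have act_diff: "act A (P - Q) = act A P - act A Q" for A P Q
    by (rule ext) (simp add: act blinfun.diff_left inner_diff_right)
  have act_scale: "act A (r *\<^sub>R P) = r *\<^sub>R act A P" for A P r
    by (rule ext) (simp add: act blinfun.scaleR_left)
  have actbound: "norm (act A P) \<le> M\<^sup>2 * norm P" if "A \<in> \<Gamma>" for A P
  proof (rule norm_blinfun_bound)
    fix v :: 'a
    define w where "w = act A P v"
    have "w \<bullet> w = A w \<bullet> P (A v)" by (simp add: w_def act)
    also have "\<dots> \<le> norm (A w) * norm (P (A v))" by (rule norm_cauchy_schwarz)
    also have "\<dots> \<le> (M * norm w) * (norm P * (M * norm v))"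
    proof (rule mult_mono)
      show "norm (A w) \<le> M * norm w" by (rule M(2)[OF that])
      have "norm (P (A v)) \<le> norm P * norm (A v)" by (rule norm_blinfun)
      also have "\<dots> \<le> norm P * (M * norm v)" by (intro mult_left_mono M(2)[OF that]) simp
      finally show "norm (P (A v)) \<le> norm P * (M * norm v)" .
    qed (use M(1) in auto)
    finally have "norm w * norm w \<le> norm w * (M\<^sup>2 * norm P * norm v)"
      by (simp add: dot_square_norm power2_eq_square mult_ac)
    then have "norm w \<le> M\<^sup>2 * norm P * norm v"
      by (cases "norm w = 0") (auto simp: mult_le_cancel_left)
    then show "norm (act A P v) \<le> M\<^sup>2 * norm P * norm v" by (simp add: w_def)
  qed simp
  \<comment> \<open>The squared Frobenius norm, which satisfies the midpoint identity as the
    operator norm in general does not. The constant \<open>e\<close> below compares the two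
    norms.\<close>
  define q where "q P = (\<Sum>i\<in>Basis. (norm (blinfun_apply P i))\<^sup>2)" for P :: "'a \<Rightarrow>\<^sub>L 'a"
  have "\<exists>P\<in>K. \<forall>f\<in>act ` \<Gamma>. f P = P"
  proof (rule common_fixed_point[OF compK conv, where q=q and e="1 / (real DIM('a) * real DIM('a))" and d="1 / M\<^sup>2"])
    show "K \<noteq> {}" using idK by blast
    show "continuous_on UNIV q" unfolding q_def by (intro continuous_intros)
    show "q ((1/2) *\<^sub>R (P + Q)) = q P / 2 + q Q / 2 - q (P - Q) / 4" for P Q
    proof -
      have "(norm (blinfun_apply ((1/2) *\<^sub>R (P + Q)) i))\<^sup>2 =
          (norm (P i))\<^sup>2 / 2 + (norm (Q i))\<^sup>2 / 2 - (norm (blinfun_apply (P - Q) i))\<^sup>2 / 4" for i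
        unfolding blinfun.scaleR_left blinfun.add_left blinfun.diff_left by (rule norm_sq_midpoint)
      then show ?thesis
        unfolding q_def by (simp add: sum.distrib sum_subtractf sum_divide_distrib)
    qed
    show "1 / (real DIM('a) * real DIM('a)) * (norm P)\<^sup>2 \<le> q P" for P
    proof -
      have 1: "norm (P i) \<le> sqrt (q P)" if "i \<in> Basis" for i
        unfolding q_def by (rule real_le_rsqrt, rule member_le_sum[of _ _ "\<lambda>i. (norm (P i))\<^sup>2"]) (use that in auto)
      have q0: "0 \<le> q P" unfolding q_def by (intro sum_nonneg) auto
      have "norm P \<le> (\<Sum>i\<in>Basis. norm (P i))" by (rule norm_blinfun_euclidean_le)
      also have "\<dots> \<le> real DIM('a) * sqrt (q P)" using sum_mono[OF 1] by simp
      finally have "(norm P)\<^sup>2 \<le> (real DIM('a) * sqrt (q P))\<^sup>2" by (intro power_mono) auto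
      then show ?thesis using q0 by (simp add: power_mult_distrib field_simps power2_eq_square)
    qed
    show "act ` \<Gamma> \<noteq> {}" using id by blast
    show "\<exists>h\<in>act ` \<Gamma>. \<forall>x\<in>K. h x = f (g x)" if "f \<in> act ` \<Gamma>" "g \<in> act ` \<Gamma>" for f g
      using that comp by (auto simp: act_comp)
    show "f P \<in> K" if f: "f \<in> act ` \<Gamma>" and P: "P \<in> K" for f P
    proof -
      obtain A where A: "A \<in> \<Gamma>" "f = act A" using f by blast
      show ?thesis unfolding K_def A(2)
      proof (intro CollectI conjI allI ballI)
        fix u v show "u \<bullet> act A P v = v \<bullet> act A P u" using sym[OF P] by (simp add: act)
      next
        fix B u assume B: "B \<in> \<Gamma>"
        have "A o\<^sub>L B \<in> \<Gamma>" using comp A B by blast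
        then show "(norm u)\<^sup>2 / M\<^sup>2 \<le> B u \<bullet> act A P (B u)" "B u \<bullet> act A P (B u) \<le> M\<^sup>2 * (norm u)\<^sup>2"
          using P unfolding K_def act by (auto dest!: bspec[where x="A o\<^sub>L B"])
      qed
    qed
    show "continuous_on K f" if "f \<in> act ` \<Gamma>" for f
      using that by (auto simp: act_def intro!: continuous_intros)
    show "f ((1/2) *\<^sub>R (P + Q)) = (1/2) *\<^sub>R (f P + f Q)" if "f \<in> act ` \<Gamma>" for f P Q
      using that by (auto simp: act_scale act_add)
    show "1 / M\<^sup>2 * norm (P - Q) \<le> norm (f P - f Q)" if f: "f \<in> act ` \<Gamma>" for f P Q
    proof -
      obtain A where A: "A \<in> \<Gamma>" "f = act A" using f by blast
      obtain B where B: "B \<in> \<Gamma>" "A o\<^sub>L B = id_blinfun" using inverse[OF A(1)] by blast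
      have "act id_blinfun R = R" for R by (rule ext) (simp add: act)
      then have "P - Q = act B (act A (P - Q))" by (simp add: act_comp B(2))
      then have "norm (P - Q) \<le> M\<^sup>2 * norm (act A (P - Q))" using actbound[OF B(1)] by metis
      then show ?thesis using M(1) by (simp add: A(2) act_diff field_simps)
    qed
    show "0 < 1 / (real DIM('a) * real DIM('a))" "0 < 1 / M\<^sup>2" using M(1) by auto
  qed
  then obtain P where P: "P \<in> K" "\<And>A. A \<in> \<Gamma> \<Longrightarrow> act A P = P" by auto
  show ?thesis
  proof (intro exI[of _ "\<lambda>u v. u \<bullet> P v"] conjI allI impI ballI)
    show "bilinear (\<lambda>u v. u \<bullet> P v)"
      unfolding bilinear_def
      by (auto intro!: linearI simp: inner_simps blinfun.add_right blinfun.scaleR_right)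
    show "u \<bullet> P v = v \<bullet> P u" for u v by (rule sym[OF P(1)])
    show "0 < v \<bullet> P v" if "v \<noteq> 0" for v
      using K1(1)[OF P(1), of v] that M(1) by (smt (verit) divide_pos_pos zero_less_norm_iff zero_less_power)
    show "A u \<bullet> P (A v) = u \<bullet> P v" if "A \<in> \<Gamma>" for A u v
      using act[of u A P v] P(2)[OF that] by simp
  qed
qed

text \<open>The linear part of an isometry is determined only on the span of the differences of
  \<open>S\<close>. Extended by the identity on the kernel of a projection onto that span, the
  isometries become a bounded group of operators on the whole space, to which
  \<open>invariant_form\<close> applies.\<close>

lemma invariant_kernel:
  fixes S :: "'a::euclidean_space set"
  assumes S: "compact S" "convex S" "S \<noteq> {}"
  shows "\<exists>c b. c \<in> S \<and> bilinear b \<and> (\<forall>u v. b u v = b v u) \<and> (\<forall>v. v \<noteq> 0 \<longrightarrow> 0 < b v v) \<and>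
     (\<forall>g. isometry_of S g \<longrightarrow> g c = c \<and> (\<forall>x\<in>S. \<forall>y\<in>S. b (g x - c) (g y - c) = (b (x - c) (y - c) :: real)))"
proof -
  obtain c where c: "c \<in> S" "\<And>g. isometry_of S g \<Longrightarrow> g c = c" using isometry_center[OF S] by blast
  let ?D = "{x - y | x y. x \<in> S \<and> y \<in> S}"
  let ?V = "span ?D"
  obtain \<pi> where \<pi>: "linear \<pi>" "range \<pi> \<subseteq> ?V" "\<And>v. v \<in> ?V \<Longrightarrow> \<pi> v = v"
    using linear_exists_left_inverse_on[of "\<lambda>x. x" ?V] linear_id
    by (auto simp: id_def)
  obtain M where M: "M > 0" "\<And>g L v. linear L \<Longrightarrow> g ` S \<subseteq> S \<Longrightarrow> (\<forall>x\<in>S. \<forall>y\<in>S. g x - g y = L (x - y)) \<Longrightarrow>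
      v \<in> ?V \<Longrightarrow> norm (L v) \<le> M * norm v"
    using affine_self_map_linear_bound[OF S] by blast
  obtain B where B: "B > 0" "\<And>v. norm (\<pi> v) \<le> B * norm v"
    using linear_bounded_pos[OF \<pi>(1)] by blast
  \<comment> \<open>\<open>rep g A\<close>: \<open>A\<close> is the linear part of \<open>g\<close>, extended by the identity on the kernel of \<open>\<pi>\<close>\<close>
  define rep where "rep g A \<longleftrightarrow> isometry_of S g \<and> (\<forall>x\<in>S. \<forall>y\<in>S. g x - g y = blinfun_apply A (x - y)) \<and>
      (\<forall>v. blinfun_apply A v = A (\<pi> v) + (v - \<pi> v))" for g and A :: "'a \<Rightarrow>\<^sub>L 'a"
  define \<Gamma> where "\<Gamma> = {A. \<exists>g. rep g A}"
  have VS: "x - y \<in> ?V" if "x \<in> S" "y \<in> S" for x y using that by (intro span_base) blast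
  have exrep: "\<exists>A. rep g A" if g: "isometry_of S g" for g
  proof -
    obtain L where L: "linear L" "\<forall>x\<in>S. \<forall>y\<in>S. g x - g y = L (x - y)"
      using affine_map_on_diff_linear[OF S(2), of g] g by (auto simp: isometry_of_def)
    have "linear (\<lambda>v. L (\<pi> v) + (v - \<pi> v))"
      using linear_compose[OF \<pi>(1) L(1)] \<pi>(1)
      by (intro linear_compose_add linear_compose_sub linear_ident) (simp_all add: o_def)
    then have ap: "blinfun_apply (Blinfun (\<lambda>v. L (\<pi> v) + (v - \<pi> v))) = (\<lambda>v. L (\<pi> v) + (v - \<pi> v))"
      by (intro bounded_linear_Blinfun_apply) (simp add: linear_conv_bounded_linear[symmetric])
    have "\<pi> (\<pi> v) = \<pi> v" for v using \<pi> by blast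
    then show ?thesis unfolding rep_def
      by (intro exI[of _ "Blinfun (\<lambda>v. L (\<pi> v) + (v - \<pi> v))"]) (use g L(2) \<pi>(3) VS ap in simp)
  qed
  have kernel: "blinfun_apply A (v - \<pi> v) = v - \<pi> v" if "rep g A" for g A v
  proof -
    have "\<pi> (\<pi> v) = \<pi> v" using \<pi>(2,3) by blast
    then have "\<pi> (v - \<pi> v) = 0" using linear_diff[OF \<pi>(1), of v "\<pi> v"] by simp
    moreover have "A (v - \<pi> v) = A (\<pi> (v - \<pi> v)) + ((v - \<pi> v) - \<pi> (v - \<pi> v))"
      using that unfolding rep_def by blast
    ultimately show ?thesis by (simp add: blinfun.zero_right)
  qed
  have rep_comp: "rep (\<lambda>x. g (h x)) (A o\<^sub>L A')" if "rep g A" "rep h A'" for g h A A'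
    unfolding rep_def
  proof (intro conjI ballI allI)
    show "isometry_of S (\<lambda>x. g (h x))" using that isometry_of_comp unfolding rep_def by blast
    fix x y assume xy: "x \<in> S" "y \<in> S"
    have "isometry_of S h" using that(2) unfolding rep_def by blast
    then have hxy: "h x \<in> S" "h y \<in> S" using xy by (simp_all add: isometry_of_mem)
    have "h x - h y = A' (x - y)" using that(2) xy unfolding rep_def by blast
    moreover have "g (h x) - g (h y) = A (h x - h y)" using that(1) hxy unfolding rep_def by blast
    ultimately show "g (h x) - g (h y) = (A o\<^sub>L A') (x - y)" by simp
  next
    fix v
    have "A' v = A' (\<pi> v) + (v - \<pi> v)" using that unfolding rep_def by blast
    then have "A (A' v) = A (A' (\<pi> v)) + A (v - \<pi> v)" by (metis blinfun.add_right)
    then show "(A o\<^sub>L A') v = (A o\<^sub>L A') (\<pi> v) + (v - \<pi> v)" using kernel[OF that(1)] by simp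
  qed
  have rep_id: "A = id_blinfun" if A: "rep g A" and g: "\<forall>x\<in>S. g x = x" for g A
  proof -
    have D: "A (x - y) = x - y" if "x \<in> S" "y \<in> S" for x y
      using A g that unfolding rep_def by metis
    have V: "A v = v" if "v \<in> ?V" for v
    proof -
      have "?V \<subseteq> {v. A v = v}"
      proof (rule span_minimal)
        show "subspace {v. A v = v}"
          by (rule subspaceI) (auto simp: blinfun.zero_right blinfun.add_right blinfun.scaleR_right)
      qed (use D in auto)
      then show ?thesis using that by blast
    qed
    have "A v = v" for v
    proof -
      have "A v = A (\<pi> v) + (v - \<pi> v)" using A unfolding rep_def by blast
      moreover have "A (\<pi> v) = \<pi> v" using V \<pi>(2) by blast
      ultimately show ?thesis by simp
    qed
    then show ?thesis by (intro blinfun_eqI) simp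
  qed
  have "\<exists>b :: 'a \<Rightarrow> 'a \<Rightarrow> real. bilinear b \<and> (\<forall>u v. b u v = b v u) \<and> (\<forall>v. v \<noteq> 0 \<longrightarrow> 0 < b v v) \<and>
           (\<forall>A\<in>\<Gamma>. \<forall>u v. b (blinfun_apply A u) (blinfun_apply A v) = b u v)"
  \<comment> \<open>\<open>M * B\<close> bounds the linear part after the projection,
    \<open>1 + B\<close> the remainder v - \<pi> v.\<close>
  proof (rule invariant_form[where M="M * B + 1 + B"])
    show "id_blinfun \<in> \<Gamma>"
      using isometry_of_id[of S] by (auto simp: \<Gamma>_def rep_def intro!: exI[of _ "\<lambda>x. x"])
    show "A o\<^sub>L A' \<in> \<Gamma>" if "A \<in> \<Gamma>" "A' \<in> \<Gamma>" for A A' using that rep_comp unfolding \<Gamma>_def by blast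
    show "\<exists>A'\<in>\<Gamma>. A' o\<^sub>L A = id_blinfun \<and> A o\<^sub>L A' = id_blinfun" if A: "A \<in> \<Gamma>" for A
    proof -
      obtain g where g: "rep g A" using A \<Gamma>_def by blast
      then obtain h where h: "isometry_of S h" "\<forall>x\<in>S. h (g x) = x \<and> g (h x) = x"
        using isometry_of_inverse[OF S(2), of g] unfolding rep_def by blast
      obtain A' where A': "rep h A'" using exrep[OF h(1)] by blast
      show ?thesis
        using rep_id[OF rep_comp[OF A' g]] rep_id[OF rep_comp[OF g A']] h(2) A' unfolding \<Gamma>_def by blast
    qed
    show "1 \<le> M * B + 1 + B" using M B by simp
    show "norm (A v) \<le> (M * B + 1 + B) * norm v" if A: "A \<in> \<Gamma>" for A v
    proof -
      obtain g where g: "rep g A" using A \<Gamma>_def by blast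
      have "norm (A (\<pi> v)) \<le> M * norm (\<pi> v)"
      proof (rule M(2))
        show "linear (blinfun_apply A)" by (simp add: blinfun.bounded_linear_right bounded_linear.linear)
        show "g ` S \<subseteq> S" using g isometry_of_mem unfolding rep_def by blast
        show "\<forall>x\<in>S. \<forall>y\<in>S. g x - g y = A (x - y)" using g unfolding rep_def by blast
        show "\<pi> v \<in> ?V" using \<pi>(2) by blast
      qed
      also have "\<dots> \<le> M * (B * norm v)" using B M by (intro mult_left_mono) auto
      finally have 1: "norm (A (\<pi> v)) \<le> M * B * norm v" by (simp add: mult_ac)
      have "A v = A (\<pi> v) + (v - \<pi> v)" using g unfolding rep_def by blast
      then have "norm (A v) \<le> norm (A (\<pi> v)) + (norm v + norm (\<pi> v))"
        by (metis norm_triangle_ineq norm_triangle_ineq4 add_left_mono order_trans)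
      then show ?thesis using 1 B(2)[of v] by (simp add: algebra_simps)
    qed
  qed
  then obtain b :: "'a \<Rightarrow> 'a \<Rightarrow> real" where b: "bilinear b" "\<forall>u v. b u v = b v u" "\<forall>v. v \<noteq> 0 \<longrightarrow> 0 < b v v"
     "\<forall>A\<in>\<Gamma>. \<forall>u v. b (blinfun_apply A u) (blinfun_apply A v) = b u v" by blast
  have "b (g x - c) (g y - c) = b (x - c) (y - c)" if g: "isometry_of S g" and xy: "x \<in> S" "y \<in> S" for g x y
  proof -
    obtain A where A: "rep g A" using exrep[OF g] by blast
    have "g x - c = A (x - c)" if "x \<in> S" for x
      using A c(1) c(2)[OF g] that unfolding rep_def by metis
    then show ?thesis using b(4) A xy unfolding \<Gamma>_def by auto
  qed
  then show ?thesis using b(1-3) c by blast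
qed

section \<open>The transition kernel\<close>

lemma orthogonal_states_sym: "orthogonal_states S s t \<Longrightarrow> orthogonal_states S t s"
proof -
  assume "orthogonal_states S s t"
  then obtain f :: "'a \<Rightarrow> real" where f: "s \<in> S" "t \<in> S" "affine_map_on S f" "f ` S \<subseteq> {0..1}" "f s = 0" "f t = 1"
    unfolding orthogonal_states_def by blast
  have "affine_map_on S (\<lambda>x. 1 - f x)"
    using f(3) by (simp add: affine_map_on_def algebra_simps)
  moreover have "(\<lambda>x. 1 - f x) ` S \<subseteq> {0..1}" using f(4) by auto
  ultimately show ?thesis unfolding orthogonal_states_def
    using f by (intro conjI exI[of _ "\<lambda>x. 1 - f x"]) auto
qed

lemma orthogonal_states_isometry:
  assumes S: "convex S" and g: "isometry_of S g" and o: "orthogonal_states S s t"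
  shows "orthogonal_states S (g s) (g t)"
proof -
  obtain f :: "'a \<Rightarrow> real" where f: "s \<in> S" "t \<in> S" "affine_map_on S f" "f ` S \<subseteq> {0..1}" "f s = 0" "f t = 1"
    using o unfolding orthogonal_states_def by blast
  obtain h where h: "isometry_of S h" "\<And>x. x \<in> S \<Longrightarrow> h (g x) = x"
    using isometry_of_inverse[OF S g] by blast
  have hS: "h x \<in> S" if "x \<in> S" for x using isometry_of_mem[OF h(1) that] .
  have "affine_map_on S (\<lambda>x. f (h x))"
    using f(3) h(1) hS by (simp add: affine_map_on_def isometry_of_def)
  moreover have "(\<lambda>x. f (h x)) ` S \<subseteq> {0..1}" using f(4) hS by auto
  moreover have "f (h (g s)) = 0" "f (h (g t)) = 1" using f h by simp_all
  ultimately show ?thesis unfolding orthogonal_states_def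
    using isometry_of_mem[OF g] f(1,2) by blast
qed

lemma pure_state_isometry:
  assumes S: "convex S" and g: "isometry_of S g" and s: "pure_state S s"
  shows "pure_state S (g s)"
proof -
  obtain h where h: "isometry_of S h" "\<And>x. x \<in> S \<Longrightarrow> h (g x) = x" "\<And>x. x \<in> S \<Longrightarrow> g (h x) = x"
    using isometry_of_inverse[OF S g] by blast
  have sS: "s \<in> S" using s by (simp add: pure_state_def extreme_point_of_def)
  have "g s \<notin> open_segment x y" if xy: "x \<in> S" "y \<in> S" for x y
  proof
    assume "g s \<in> open_segment x y"
    then obtain u where u: "x \<noteq> y" "0 < u" "u < 1" "g s = (1 - u) *\<^sub>R x + u *\<^sub>R y"
      by (auto simp: in_segment)
    have "s = h ((1 - u) *\<^sub>R x + u *\<^sub>R y)" using h(2)[OF sS] u(4) by simp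
    also have "\<dots> = (1 - u) *\<^sub>R h x + u *\<^sub>R h y"
      using affine_map_onD[of S h x y u] h(1) xy u by (simp add: isometry_of_def)
    finally have "s \<in> open_segment (h x) (h y)"
      using u h(3) xy by (auto simp: in_segment) metis
    then show False
      using s isometry_of_mem[OF h(1)] xy unfolding pure_state_def extreme_point_of_def by blast
  qed
  then show ?thesis
    using isometry_of_mem[OF g sS] unfolding pure_state_def extreme_point_of_def by blast
qed

text \<open>Bundles the hypotheses on \<open>S\<close> with a bi-affine analogue of the transition
  probability: the sum of x_i * y_i on a simplex, tr(xy) on density matrices. \<open>N\<close> will
  be the size of a frame, 1 / N the value of the kernel at the centre.\<close>

locale state_kernel =
  fixes S :: "'a::euclidean_space set" and c :: 'a and b :: "'a \<Rightarrow> 'a \<Rightarrow> real" and N :: nat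
    and \<phi> :: "'a \<Rightarrow> 'a \<Rightarrow> real"
  assumes convex_S: "convex S" and center: "c \<in> S" and N_pos: "0 < N"
    and bilinear_b: "bilinear b" and b_sym: "b u v = b v u" and b_pos: "v \<noteq> 0 \<Longrightarrow> 0 < b v v"
    and kernel: "\<phi> x y = 1 / real N + b (x - c) (y - c)"
    and kernel_pure: "pure_state S s \<Longrightarrow> \<phi> s s = 1"
    and kernel_range: "pure_state S s \<Longrightarrow> x \<in> S \<Longrightarrow> 0 \<le> \<phi> s x \<and> \<phi> s x \<le> 1"
    and kernel_orthogonal: "pure_state S s \<Longrightarrow> pure_state S t \<Longrightarrow> orthogonal_states S s t \<Longrightarrow> \<phi> s t = 0"
    and transitive_pure: "pure_state S s \<Longrightarrow> pure_state S t \<Longrightarrow> \<exists>\<Phi>. isometry_of S \<Phi> \<and> \<Phi> s = t"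
    and transitive_orthogonal: "pure_state S s \<Longrightarrow> pure_state S t \<Longrightarrow> pure_state S r \<Longrightarrow>
          orthogonal_states S s r \<Longrightarrow> orthogonal_states S t r \<Longrightarrow>
          \<exists>\<Phi>. isometry_of S \<Phi> \<and> \<Phi> s = t \<and> \<Phi> r = r"
    and three_orthogonal: "\<exists>s\<^sub>1 s\<^sub>2 s\<^sub>3. pure_state S s\<^sub>1 \<and> pure_state S s\<^sub>2 \<and> pure_state S s\<^sub>3 \<and>
          orthogonal_states S s\<^sub>1 s\<^sub>2 \<and> orthogonal_states S s\<^sub>1 s\<^sub>3 \<and> orthogonal_states S s\<^sub>2 s\<^sub>3"
    and spectral: "x \<in> S \<Longrightarrow>
          \<exists>(k::nat) (p :: nat \<Rightarrow> real) (t :: nat \<Rightarrow> 'a).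
            (\<forall>i<k. 0 \<le> p i \<and> pure_state S (t i)) \<and> (\<Sum>i<k. p i) = 1 \<and>
            (\<forall>i<k. \<forall>j<k. i \<noteq> j \<longrightarrow> orthogonal_states S (t i) (t j)) \<and>
            x = (\<Sum>i<k. p i *\<^sub>R t i)"

lemma state_kernel_exists:
  fixes S :: "'a::euclidean_space set"
  assumes "state_space S"
    and transitive_pure: "\<And>s\<^sub>1 s\<^sub>2. pure_state S s\<^sub>1 \<Longrightarrow> pure_state S s\<^sub>2 \<Longrightarrow>
          \<exists>\<Phi>. isometry_of S \<Phi> \<and> \<Phi> s\<^sub>1 = s\<^sub>2"
    and transitive_orthogonal: "\<And>s\<^sub>1 s\<^sub>2 s\<^sub>3. pure_state S s\<^sub>1 \<Longrightarrow> pure_state S s\<^sub>2 \<Longrightarrow> pure_state S s\<^sub>3 \<Longrightarrow>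
          orthogonal_states S s\<^sub>1 s\<^sub>3 \<Longrightarrow> orthogonal_states S s\<^sub>2 s\<^sub>3 \<Longrightarrow>
          \<exists>\<Phi>. isometry_of S \<Phi> \<and> \<Phi> s\<^sub>1 = s\<^sub>2 \<and> \<Phi> s\<^sub>3 = s\<^sub>3"
    and three_orthogonal: "\<exists>s\<^sub>1 s\<^sub>2 s\<^sub>3. pure_state S s\<^sub>1 \<and> pure_state S s\<^sub>2 \<and> pure_state S s\<^sub>3 \<and>
          orthogonal_states S s\<^sub>1 s\<^sub>2 \<and> orthogonal_states S s\<^sub>1 s\<^sub>3 \<and> orthogonal_states S s\<^sub>2 s\<^sub>3"
    and spectral: "\<And>s. s \<in> S \<Longrightarrow>
          \<exists>(k::nat) (p :: nat \<Rightarrow> real) (t :: nat \<Rightarrow> 'a).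
            (\<forall>i<k. 0 \<le> p i \<and> pure_state S (t i)) \<and> (\<Sum>i<k. p i) = 1 \<and>
            (\<forall>i<k. \<forall>j<k. i \<noteq> j \<longrightarrow> orthogonal_states S (t i) (t j)) \<and>
            s = (\<Sum>i<k. p i *\<^sub>R t i)"
  shows "\<exists>c b N \<phi>. state_kernel S c b N \<phi>"
proof -
  have comp: "compact S" and S: "convex S" using assms(1) by (auto simp: state_space_def)
  obtain s0 t0 where st0: "pure_state S s0" "pure_state S t0" "orthogonal_states S s0 t0"
    using three_orthogonal by blast
  have pS: "s \<in> S" if "pure_state S s" for s using that by (simp add: pure_state_def extreme_point_of_def)
  have ne: "S \<noteq> {}" using pS[OF st0(1)] by blast
  obtain c b where c: "c \<in> S" and b: "bilinear b" "\<And>u v. b u v = b v u" "\<And>v. v \<noteq> 0 \<Longrightarrow> 0 < b v v"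
    and inv: "\<And>g. isometry_of S g \<Longrightarrow> g c = c"
      "\<And>g x y. isometry_of S g \<Longrightarrow> x \<in> S \<Longrightarrow> y \<in> S \<Longrightarrow> b (g x - c) (g y - c) = (b (x - c) (y - c) :: real)"
    using invariant_kernel[OF comp S ne] by blast
  define k where "k x y = b (x - c) (y - c)" for x y
  have k_sym: "k x y = k y x" for x y using b(2) by (simp add: k_def)
  have k_inv: "k (g x) (g y) = k x y" if "isometry_of S g" "x \<in> S" "y \<in> S" for g x y
    using inv(2) that by (simp add: k_def)
  have k_sum: "k s (\<Sum>i<n. p i *\<^sub>R t i) = (\<Sum>i<n. p i * k s (t i))" if "(\<Sum>i<n. p i) = 1" for s n and p :: "nat \<Rightarrow> real" and t
  proof -
    have l: "linear (b (s - c))" using b(1) by (simp add: bilinear_def)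
    have "(\<Sum>i<n. p i *\<^sub>R t i) - c = (\<Sum>i<n. p i *\<^sub>R (t i - c))"
      using that by (simp add: scaleR_diff_right sum_subtractf scaleR_left.sum[symmetric])
    then show ?thesis using l by (simp add: k_def linear_sum linear_scale)
  qed
  have k_dist: "k x x + k y y - 2 * k x y = b (x - y) (x - y)" for x y
  proof -
    have "b (x - y) (x - y) = b ((x - c) - (y - c)) ((x - c) - (y - c))" by simp
    also have "\<dots> = k x x - k x y - (k y x - k y y)"
      unfolding k_def bilinear_lsub[OF b(1)] bilinear_rsub[OF b(1)] by simp
    finally show ?thesis using k_sym[of y x] by simp
  qed
  define \<rho> where "\<rho> = k s0 s0"
  have k_pure: "k s s = \<rho>" if "pure_state S s" for s
    using transitive_pure[OF st0(1) that] k_inv[of _ s0 s0] pS[OF st0(1)] by (auto simp: \<rho>_def)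
  define m where "m = k s0 t0"
  \<comment> \<open>Two applications of transitivity: one moves \<open>t0\<close> to
    \<open>t\<close>, the next moves the image of \<open>s0\<close> to \<open>s\<close> while fixing
    \<open>t\<close>. So all orthogonal pairs share the value \<open>m\<close>.\<close>
  have k_orth: "k s t = m" if st: "pure_state S s" "pure_state S t" "orthogonal_states S s t" for s t
  proof -
    obtain g where g: "isometry_of S g" "g t0 = t" using transitive_pure[OF st0(2) st(2)] by blast
    have "orthogonal_states S (g s0) t" using orthogonal_states_isometry[OF S g(1) st0(3)] g(2) by simp
    then obtain h where h: "isometry_of S h" "h (g s0) = s" "h t = t"
      using transitive_orthogonal[OF pure_state_isometry[OF S g(1) st0(1)] st(1,2) _ st(3)] by blast
    have "k s t = k (h (g s0)) (h (g t0))" using h g by simp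
    also have "\<dots> = m"
      using k_inv[OF h(1)] k_inv[OF g(1)] isometry_of_mem[OF g(1)] pS st0 by (simp add: m_def)
    finally show ?thesis .
  qed
  have k_lt: "k s t < \<rho>" if "pure_state S s" "pure_state S t" "s \<noteq> t" for s t
    using k_dist[of s t] b(3)[of "s - t"] k_pure that by simp
  have k_le: "k s x \<le> \<rho>" if s: "pure_state S s" and x: "x \<in> S" for s x
  proof -
    obtain n p t where d: "\<forall>i<n. 0 \<le> p i \<and> pure_state S (t i)" "(\<Sum>i<n. p i) = 1" "x = (\<Sum>i<n::nat. p i *\<^sub>R t i)"
      using spectral[OF x] by blast
    have "k s x = (\<Sum>i<n. p i * k s (t i))" using k_sum d by simp
    also have "\<dots> \<le> (\<Sum>i<n. p i * \<rho>)"
      using d(1) k_lt[OF s] k_pure[OF s] by (intro sum_mono mult_left_mono) (auto, metis less_imp_le order_refl)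
    finally show ?thesis using d(2) by (simp add: sum_distrib_right[symmetric])
  qed
  have "s0 \<noteq> t0" using st0(3) unfolding orthogonal_states_def by auto
  then have m_lt: "m < \<rho>" using k_lt[OF st0(1,2)] by (simp add: m_def)
  \<comment> \<open>The affine function \<open>k s\<close> has a pure minimiser \<open>u\<close>.
    Rescaled to [0,1] it witnesses that \<open>u\<close> is orthogonal to \<open>s\<close>, so its
    minimum is \<open>m\<close>.\<close>
  have k_ge: "m \<le> k s x" if s: "pure_state S s" and x: "x \<in> S" for s x
  proof -
    have l: "linear (b (s - c))" using b(1) by (simp add: bilinear_def)
    have "continuous_on S (k s)" unfolding k_def
      by (intro linear_continuous_on_compose[OF _ l] continuous_intros)
    then obtain y where y: "y \<in> S" "\<And>z. z \<in> S \<Longrightarrow> k s y \<le> k s z"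
      using continuous_attains_inf[OF comp ne] by blast
    obtain n p t where d: "\<forall>i<n. 0 \<le> p i \<and> pure_state S (t i)" "(\<Sum>i<n. p i) = 1" "y = (\<Sum>i<n::nat. p i *\<^sub>R t i)"
      using spectral[OF y(1)] by blast
    have "\<exists>i<n. k s (t i) \<le> k s y"
    proof (rule ccontr)
      assume "\<not> ?thesis"
      then have gt: "k s y < k s (t i)" if "i < n" for i using that by force
      obtain j where j: "j < n" "0 < p j" using d(1,2)
        by (metis lessThan_iff less_eq_real_def order.irrefl sum.neutral zero_neq_one)
      have "k s y = (\<Sum>i<n. p i * k s y)" using d(2) by (simp add: sum_distrib_right[symmetric])
      also have "\<dots> < (\<Sum>i<n. p i * k s (t i))"
      proof (rule sum_strict_mono_ex1)
        show "\<forall>i\<in>{..<n}. p i * k s y \<le> p i * k s (t i)"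
          using d(1) less_imp_le[OF gt] by (auto intro: mult_left_mono)
        show "\<exists>i\<in>{..<n}. p i * k s y < p i * k s (t i)"
          using gt[OF j(1)] j by (intro bexI[of _ j]) auto
      qed simp
      finally show False using k_sum[OF d(2)] d(3) by simp
    qed
    then obtain i where i: "i < n" "k s (t i) \<le> k s y" by blast
    define u where "u = t i"
    have u: "pure_state S u" "\<And>z. z \<in> S \<Longrightarrow> k s u \<le> k s z"
      using d(1) i y by (auto simp: u_def intro: order_trans)
    have lt: "k s u < \<rho>"
    proof (cases "s = s0")
      case True
      then show ?thesis using u(2)[OF pS[OF st0(2)]] k_lt[OF s st0(2)] \<open>s0 \<noteq> t0\<close> by simp
    next
      case False
      then show ?thesis using u(2)[OF pS[OF st0(1)]] k_lt[OF s st0(1)] by simp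
    qed
    define f where "f z = (k s z - k s u) / (\<rho> - k s u)" for z
    have "affine_map_on S f"
      unfolding affine_map_on_def
    proof (intro ballI)
      fix x y :: 'a and u' :: real
      have "(1 - u') *\<^sub>R x + u' *\<^sub>R y - c = (1 - u') *\<^sub>R (x - c) + u' *\<^sub>R (y - c)" by (simp add: algebra_simps)
      then have "k s ((1 - u') *\<^sub>R x + u' *\<^sub>R y) = (1 - u') * k s x + u' * k s y"
        using l by (simp add: k_def linear_add linear_scale)
      then have "k s ((1 - u') *\<^sub>R x + u' *\<^sub>R y) - k s u = (1 - u') * (k s x - k s u) + u' * (k s y - k s u)"
        by (simp add: algebra_simps)
      then show "f ((1 - u') *\<^sub>R x + u' *\<^sub>R y) = (1 - u') *\<^sub>R f x + u' *\<^sub>R f y"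
        using lt by (simp add: f_def add_divide_distrib)
    qed
    moreover have "f ` S \<subseteq> {0..1}" using u(2) k_le[OF s] lt by (auto simp: f_def field_simps)
    moreover have "f u = 0" "f s = 1" using lt k_pure[OF s] by (auto simp: f_def)
    ultimately have "orthogonal_states S u s"
      unfolding orthogonal_states_def using pS u(1) s by blast
    then have "k s u = m" using k_orth[OF u(1) s] k_sym by simp
    then show ?thesis using u(2)[OF x] by simp
  qed
  obtain n p t where d: "\<forall>i<n. 0 \<le> p i \<and> pure_state S (t i)" "(\<Sum>i<n. p i) = 1"
      "\<forall>i<n. \<forall>j<n. i \<noteq> j \<longrightarrow> orthogonal_states S (t i) (t j)" "c = (\<Sum>i<n::nat. p i *\<^sub>R t i)"
    using spectral[OF c] by blast
  have kc: "k s c = 0" for s using b(1) by (simp add: k_def bilinear_rzero)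
  \<comment> \<open>As k (t j) c = 0, the weights of \<open>c\<close> all solve the same linear
    equation. Their sum then forces 1 / n = - m / (\<rho> - m), which makes 1 / n the constant term
    of the rescaled form (k - m) / (\<rho> - m).\<close>
  have p: "p j = - m / (\<rho> - m)" if j: "j < n" for j
  proof -
    have "0 = k (t j) (\<Sum>i<n. p i *\<^sub>R t i)" using kc d(4) by simp
    also have "\<dots> = (\<Sum>i<n. p i * k (t j) (t i))" by (rule k_sum[OF d(2)])
    also have "\<dots> = (\<Sum>i<n. p i * m + (if i = j then p i * (\<rho> - m) else 0))"
      using d j by (intro sum.cong) (auto simp: k_pure k_orth algebra_simps)
    also have "\<dots> = m + p j * (\<rho> - m)"
      using d(2) j by (simp add: sum.distrib sum_distrib_right[symmetric])
    finally show ?thesis using m_lt by (simp add: field_simps)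
  qed
  have "real n * (- m / (\<rho> - m)) = 1" using d(2) p by simp
  moreover from this have n: "0 < n" by (cases n) auto
  ultimately have al: "1 / real n = - m / (\<rho> - m)" by (simp add: field_simps)
  define b' where "b' u v = b u v / (\<rho> - m)" for u v
  define \<phi> where "\<phi> x y = 1 / real n + b' (x - c) (y - c)" for x y
  have \<phi>k: "\<phi> x y = (k x y - m) / (\<rho> - m)" for x y
    unfolding \<phi>_def b'_def al k_def by (simp add: diff_divide_distrib)
  have "state_kernel S c b' n \<phi>"
  proof
    show "bilinear b'" using b(1) unfolding bilinear_def b'_def
      by (auto intro!: linear_compose_scale_right simp: divide_inverse mult.commute
            linear_iff distrib_left algebra_simps)
    show "b' u v = b' v u" for u v using b(2) by (simp add: b'_def)
    show "0 < b' v v" if "v \<noteq> 0" for v using b(3)[OF that] m_lt by (simp add: b'_def)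
    show "\<phi> x y = 1 / real n + b' (x - c) (y - c)" for x y by (simp add: \<phi>_def)
    show "\<phi> s s = 1" if "pure_state S s" for s using k_pure[OF that] m_lt by (simp add: \<phi>k)
    show "0 \<le> \<phi> s x \<and> \<phi> s x \<le> 1" if "pure_state S s" "x \<in> S" for s x
      using k_ge[OF that] k_le[OF that] m_lt by (simp add: \<phi>k)
    show "\<phi> s t = 0" if "pure_state S s" "pure_state S t" "orthogonal_states S s t" for s t
      using k_orth[OF that] by (simp add: \<phi>k)
  qed (fact S c n transitive_pure transitive_orthogonal three_orthogonal spectral)+
  then show ?thesis by blast
qed

section \<open>Orthogonal families, frames and faces\<close>

context state_kernel
begin

lemma pure_in: "pure_state S s \<Longrightarrow> s \<in> S"
  by (simp add: pure_state_def extreme_point_of_def)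

lemma kernel_sym: "\<phi> x y = \<phi> y x"
  using b_sym by (simp add: kernel)

lemma kernel_sum:
  assumes "sum w I = 1"
  shows "\<phi> x (\<Sum>i\<in>I. w i *\<^sub>R f i) = (\<Sum>i\<in>I. w i * \<phi> x (f i))"
proof -
  have l: "linear (b (x - c))" using bilinear_b by (simp add: bilinear_def)
  have fin: "finite I" using assms by (metis sum.infinite zero_neq_one)
  have "(\<Sum>i\<in>I. w i *\<^sub>R f i) - c = (\<Sum>i\<in>I. w i *\<^sub>R (f i - c))"
    using assms by (simp add: scaleR_diff_right sum_subtractf scaleR_left.sum[symmetric])
  then have "b (x - c) ((\<Sum>i\<in>I. w i *\<^sub>R f i) - c) = (\<Sum>i\<in>I. w i * b (x - c) (f i - c))"
    using l by (simp add: linear_sum linear_scale)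
  moreover have "(\<Sum>i\<in>I. w i * (1 / real N)) = 1 / real N"
    using assms by (simp only: sum_distrib_right[symmetric])
  ultimately show ?thesis by (simp add: kernel distrib_left sum.distrib)
qed

lemma kernel_mix: "\<phi> x ((1 - u) *\<^sub>R y + u *\<^sub>R z) = (1 - u) * \<phi> x y + u * \<phi> x z"
  using kernel_sum[of "\<lambda>i. if i then u else 1 - u" UNIV x "\<lambda>i. if i then z else y"]
  by (simp add: UNIV_bool add.commute)

lemma kernel_affine: "affine_map_on S (\<phi> s)"
  unfolding affine_map_on_def using kernel_mix by simp

lemma kernel_center: "\<phi> x c = 1 / real N"
  using bilinear_b by (simp add: kernel bilinear_rzero)

lemma kernel_dist: "\<phi> x x + \<phi> y y - 2 * \<phi> x y = b (x - y) (x - y)"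
proof -
  have "b (x - y) (x - y) = b ((x - c) - (y - c)) ((x - c) - (y - c))" by simp
  also have "\<dots> = b (x - c) (x - c) - b (x - c) (y - c) - (b (y - c) (x - c) - b (y - c) (y - c))"
    unfolding bilinear_lsub[OF bilinear_b] bilinear_rsub[OF bilinear_b] by simp
  finally show ?thesis using b_sym[of "x - c" "y - c"] by (simp add: kernel)
qed

text \<open>By \<open>kernel_dist\<close> the premise says that the positive definite form
  \<open>b\<close> vanishes at x - y.\<close>

lemma kernel_eqI: "\<phi> x x + \<phi> y y = 2 * \<phi> x y \<Longrightarrow> x = y"
  using kernel_dist[of x y] b_pos[of "x - y"] by force

lemma orthogonal_iff:
  assumes "pure_state S s" "pure_state S t"
  shows "orthogonal_states S s t \<longleftrightarrow> \<phi> s t = 0"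
proof
  assume "\<phi> s t = 0"
  then have "orthogonal_states S t s"
    unfolding orthogonal_states_def
    using assms pure_in kernel_affine[of s] kernel_pure kernel_range[OF assms(1)]
    by (intro conjI exI[of _ "\<phi> s"]) auto
  then show "orthogonal_states S s t" by (rule orthogonal_states_sym)
qed (use assms kernel_orthogonal in blast)

definition orthoset :: "'a set \<Rightarrow> bool" where
  "orthoset T \<longleftrightarrow> finite T \<and> (\<forall>t\<in>T. pure_state S t) \<and> (\<forall>s\<in>T. \<forall>t\<in>T. s \<noteq> t \<longrightarrow> \<phi> s t = 0)"

lemma orthosetD:
  assumes "orthoset T"
  shows "finite T" "t \<in> T \<Longrightarrow> pure_state S t" "t \<in> T \<Longrightarrow> t \<in> S" "s \<in> T \<Longrightarrow> t \<in> T \<Longrightarrow> \<phi> s t = (if s = t then 1 else 0)"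
  using assms kernel_pure pure_in by (auto simp: orthoset_def)

lemma orthoset_kernel_sum:
  assumes "orthoset T" "t \<in> T" "sum w T = 1"
  shows "\<phi> t (\<Sum>s\<in>T. w s *\<^sub>R s) = w t"
proof -
  have "\<phi> t (\<Sum>s\<in>T. w s *\<^sub>R s) = (\<Sum>s\<in>T. w s * \<phi> t s)" by (rule kernel_sum[OF assms(3)])
  also have "\<dots> = (\<Sum>s\<in>T. if t = s then w s else 0)"
    using orthosetD(4)[OF assms(1,2)] by (intro sum.cong) auto
  finally show ?thesis using assms orthosetD(1)[OF assms(1)] by simp
qed

text \<open>Evaluating the kernel at the components recovers their weights, so a decomposition is
  determined by its set of components. Zero weights are dropped; distinct indices give distinct
  states, because overlaps are 0 off the diagonal and 1 on it.\<close>

lemma spectral_orthoset: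
  assumes "x \<in> S"
  shows "\<exists>T. orthoset T \<and> (\<forall>t\<in>T. 0 < \<phi> t x) \<and> (\<Sum>t\<in>T. \<phi> t x) = 1 \<and> x = (\<Sum>t\<in>T. \<phi> t x *\<^sub>R t)"
proof -
  obtain k p t where d: "\<forall>i<k. 0 \<le> p i \<and> pure_state S (t i)" "(\<Sum>i<k. p i) = 1"
      "\<forall>i<k. \<forall>j<k. i \<noteq> j \<longrightarrow> orthogonal_states S (t i) (t j)" "x = (\<Sum>i<k::nat. p i *\<^sub>R t i)"
    using spectral[OF assms] by blast
  define J where "J = {i. i < k \<and> p i \<noteq> 0}"
  have \<phi>t: "\<phi> (t i) (t j) = (if i = j then 1 else 0)" if "i < k" "j < k" for i j
    using d(1,3) that kernel_pure kernel_orthogonal by auto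
  have inj: "inj_on t J"
    using \<phi>t by (intro inj_onI) (metis (no_types, lifting) J_def mem_Collect_eq zero_neq_one)
  have p: "\<phi> (t j) x = p j" if "j < k" for j
  proof -
    have "\<phi> (t j) x = (\<Sum>i<k. p i * \<phi> (t j) (t i))" unfolding d(4) by (rule kernel_sum[OF d(2)])
    also have "\<dots> = (\<Sum>i<k. if j = i then p i else 0)" using \<phi>t that by (intro sum.cong) auto
    finally show ?thesis using that by simp
  qed
  have J: "finite J" "J \<subseteq> {..<k}" by (auto simp: J_def)
  show ?thesis
  proof (intro exI[of _ "t ` J"] conjI ballI)
    show "orthoset (t ` J)" unfolding orthoset_def
      using J d(1) \<phi>t by (auto simp: J_def)
    show "0 < \<phi> s x" if "s \<in> t ` J" for s
      using that p d(1) by (auto simp: J_def less_le)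
    have "(\<Sum>s\<in>t ` J. \<phi> s x) = (\<Sum>i\<in>J. p i)"
      unfolding sum.reindex[OF inj] o_def using p J by (intro sum.cong) auto
    also have "\<dots> = (\<Sum>i<k. p i)" by (rule sum.mono_neutral_left) (auto simp: J_def)
    finally show "(\<Sum>s\<in>t ` J. \<phi> s x) = 1" using d(2) by simp
    have "(\<Sum>s\<in>t ` J. \<phi> s x *\<^sub>R s) = (\<Sum>i\<in>J. p i *\<^sub>R t i)"
      unfolding sum.reindex[OF inj] o_def using p J by (intro sum.cong) auto
    also have "\<dots> = (\<Sum>i<k. p i *\<^sub>R t i)" by (rule sum.mono_neutral_left) (auto simp: J_def)
    finally show "x = (\<Sum>s\<in>t ` J. \<phi> s x *\<^sub>R s)" using d(4) by simp
  qed
qed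

text \<open>The analogue of an orthonormal basis. Decompositions over a frame admit zero weights, so
  that every state has one with exactly \<open>N\<close> components.\<close>

definition frame :: "'a set \<Rightarrow> bool" where
  "frame T \<longleftrightarrow> orthoset T \<and> card T = N"

lemma frameD: "frame T \<Longrightarrow> orthoset T" "frame T \<Longrightarrow> card T = N"
  by (auto simp: frame_def)

text \<open>The uniform mixture x satisfies \<phi> x x = \<phi> c c = \<phi> c x = 1 / N, which
  forces x = c by \<open>kernel_eqI\<close>.\<close>

lemma frame_average: 
  assumes "frame T" shows "c = (\<Sum>t\<in>T. (1 / real N) *\<^sub>R t)"
proof -
  define x where "x = (\<Sum>t\<in>T. (1 / real N) *\<^sub>R t)"
  have s: "(\<Sum>t\<in>T. 1 / real N) = 1" using assms N_pos by (simp add: frame_def)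
  have xt: "\<phi> t x = 1 / real N" if "t \<in> T" for t
    unfolding x_def by (rule orthoset_kernel_sum) (use assms that s in \<open>auto simp: frame_def\<close>)
  have "\<phi> x x = (\<Sum>t\<in>T. (1 / real N) * \<phi> x t)"
    using kernel_sum[OF s, of x "\<lambda>t. t"] by (simp add: x_def)
  also have "\<dots> = (\<Sum>t\<in>T. (1 / real N) * (1 / real N))"
    using xt kernel_sym by (intro sum.cong) auto
  also have "\<dots> = 1 / real N" using assms N_pos by (simp add: frame_def)
  finally have "\<phi> x x = 1 / real N" .
  then have "c = x" using kernel_center[of c] kernel_center[of x] kernel_sym[of c x] by (intro kernel_eqI) simp
  then show ?thesis by (simp add: x_def)
qed

lemma frame_sum: 
  assumes "frame T" shows "\<Sum>T = real N *\<^sub>R c"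
  using frame_average[OF assms] N_pos by (simp add: scaleR_right.sum[symmetric])

text \<open>The resolution of unity: the kernel is affine and has the value 1 / N at
  \<open>c\<close>, the average of the frame.\<close>

lemma frame_kernel_sum:
  assumes "frame T" shows "(\<Sum>t\<in>T. \<phi> t x) = 1"
proof -
  have s: "(\<Sum>t\<in>T. 1 / real N) = 1" using assms N_pos by (simp add: frame_def)
  have "1 / real N = \<phi> x (\<Sum>t\<in>T. (1 / real N) *\<^sub>R t)" using frame_average[OF assms] kernel_center by simp
  also have "\<dots> = (\<Sum>t\<in>T. (1 / real N) * \<phi> x t)" by (rule kernel_sum[OF s])
  also have "\<dots> = (1 / real N) * (\<Sum>t\<in>T. \<phi> t x)"
    by (simp add: sum_distrib_left kernel_sym)
  finally show ?thesis using N_pos by simp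
qed

lemma frame_exists: "\<exists>T. frame T"
proof -
  obtain T where T: "orthoset T" "(\<Sum>t\<in>T. \<phi> t c) = 1" using spectral_orthoset[OF center] by blast
  then have "real (card T) / real N = 1" by (simp add: kernel_center)
  then have "card T = N" using N_pos by (simp add: field_simps)
  then show ?thesis using T unfolding frame_def by blast
qed

text \<open>
  Near the barycentre of \<open>I\<close> the spectral weights are nearly \<open>1 / card I\<close>, so there are exactly
  \<open>card I\<close> of them.
\<close>

lemma face_frame:
  assumes T: "frame T" and I: "I \<subseteq> T" and x: "x \<in> S" and x0: "\<And>t. t \<in> T - I \<Longrightarrow> \<phi> t x = 0"
  shows "\<exists>V. orthoset V \<and> (\<forall>v\<in>V. \<forall>t\<in>T - I. \<phi> t v = 0) \<and> \<Sum>V = \<Sum>I \<and> card V = card I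
           \<and> x = (\<Sum>v\<in>V. \<phi> v x *\<^sub>R v)"
proof -
  note oT = frameD(1)[OF T]
  have fin: "finite T" "finite I" using orthosetD(1)[OF oT] I finite_subset by auto
  have "(\<Sum>t\<in>T. \<phi> t x) = (\<Sum>t\<in>I. \<phi> t x)"
    by (rule sum.mono_neutral_right) (use fin I x0 in auto)
  then have I1: "(\<Sum>t\<in>I. \<phi> t x) = 1" using frame_kernel_sum[OF T] by simp
  then have "I \<noteq> {}" by auto
  define m where "m = card I"
  have m: "0 < m" using \<open>I \<noteq> {}\<close> fin by (simp add: m_def card_gt_0_iff)
  have sI: "(\<Sum>t\<in>I. 1 / real m) = 1" using m by (simp add: m_def)
  define a where "a = (\<Sum>t\<in>I. (1 / real m) *\<^sub>R t)"
  have aS: "a \<in> S" unfolding a_def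
    by (rule convex_sum[OF fin(2) convex_S sI]) (use I orthosetD(3)[OF oT] in auto)
  \<comment> \<open>Small enough that e * (m + 1) < 1 excludes more than \<open>m\<close>
    components, and e * (m - 1)^2 < 1 excludes fewer.\<close>
  define e where "e = 1 / (real m * real m + 2)"
  have e: "0 < e" "e < 1" "e * (real m * real m + 2) = 1"
  proof -
    have "0 \<le> real m * real m" by simp
    then have "1 < real m * real m + 2" by linarith
    then show "0 < e" "e < 1" "e * (real m * real m + 2) = 1" unfolding e_def by auto
  qed
  define z where "z = (1 - e) *\<^sub>R a + e *\<^sub>R x"
  have zS: "z \<in> S" unfolding z_def by (rule convexD[OF convex_S aS x]) (use e in auto)
  obtain V where V: "orthoset V" "\<And>v. v \<in> V \<Longrightarrow> 0 < \<phi> v z" "(\<Sum>v\<in>V. \<phi> v z) = 1" "z = (\<Sum>v\<in>V. \<phi> v z *\<^sub>R v)"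
    using spectral_orthoset[OF zS] by blast
  \<comment> \<open>Components of positive weight stay in the face: a vanishing sum of nonnegative
    overlaps vanishes termwise.\<close>
  have Vz: "\<phi> t v = 0" if v: "v \<in> V" and t: "t \<in> T - I" for t v
  proof -
    have pt: "pure_state S t" using orthosetD(2)[OF oT] t by auto
    have "\<phi> t a = (\<Sum>s\<in>I. (1 / real m) * \<phi> t s)" unfolding a_def by (rule kernel_sum[OF sI])
    also have "\<dots> = 0" using orthosetD(4)[OF oT] t I by (intro sum.neutral) auto
    finally have "\<phi> t z = 0" using x0[OF t] by (simp add: z_def kernel_mix)
    moreover have "\<phi> t z = (\<Sum>w\<in>V. \<phi> w z * \<phi> t w)"
      using kernel_sum[OF V(3), of t "\<lambda>w. w"] V(4) by simp
    moreover have "0 \<le> \<phi> w z * \<phi> t w" if "w \<in> V" for w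
      using V(2)[OF that] kernel_range[OF pt orthosetD(3)[OF V(1) that]] by simp
    ultimately have "\<phi> v z * \<phi> t v = 0"
      using sum_nonneg_eq_0_iff[OF orthosetD(1)[OF V(1)], of "\<lambda>w. \<phi> w z * \<phi> t w"] v by auto
    then show ?thesis using V(2)[OF v] by simp
  qed
  have Va: "\<phi> v a = 1 / real m" if v: "v \<in> V" for v
  proof -
    have "(\<Sum>t\<in>T. \<phi> t v) = (\<Sum>t\<in>I. \<phi> t v)"
      by (rule sum.mono_neutral_right) (use fin I Vz[OF v] in auto)
    then have "(\<Sum>t\<in>I. \<phi> t v) = 1" using frame_kernel_sum[OF T] by simp
    moreover have "\<phi> v a = (\<Sum>s\<in>I. (1 / real m) * \<phi> v s)" unfolding a_def by (rule kernel_sum[OF sI])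
    ultimately show ?thesis by (simp add: sum_distrib_left[symmetric] kernel_sym sum_divide_distrib[symmetric])
  qed
  have Vw: "\<phi> v z = (1 - e) / real m + e * \<phi> v x" if "v \<in> V" for v
    using Va[OF that] by (simp add: z_def kernel_mix)
  have Vx: "0 \<le> \<phi> v x" "\<phi> v x \<le> 1" if "v \<in> V" for v
    using kernel_range[OF orthosetD(2)[OF V(1) that] x] by auto
  have card: "card V = m"
  proof -
    define k where "k = card V"
    have "real k * ((1 - e) / real m) \<le> (\<Sum>v\<in>V. \<phi> v z)"
      unfolding k_def by (rule sum_bounded_below) (use Vw Vx e in auto)
    then have "real k * (1 - e) \<le> real m" using V(3) m by (simp add: field_simps)
    moreover have "(\<Sum>v\<in>V. \<phi> v z) \<le> real k * ((1 - e) / real m + e)"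
      unfolding k_def by (rule sum_bounded_above) (use Vw Vx e in auto)
    then have 2: "real m \<le> real k * (1 - e + e * real m)" using V(3) m by (simp add: field_simps)
    have le: "k \<le> m"
    proof (rule ccontr)
      assume "\<not> k \<le> m"
      then have "(real m + 1) * (1 - e) \<le> real k * (1 - e)" using e by (intro mult_right_mono) auto
      then have "(real m + 1) * (1 - e) \<le> real m" using calculation by linarith
      then have "1 \<le> e * (real m + 1)" by (simp add: algebra_simps)
      then have "e * (real m * real m + 2) \<le> e * (real m + 1)" using e by simp
      then have "real m * real m + 2 \<le> real m + 1"
        using mult_le_cancel_left_pos[OF e(1)] by blast
      moreover have "real m \<le> real m * real m" using m by simp
      ultimately show False by linarith
    qed
    have ge: "m \<le> k"
    proof (rule ccontr)
      assume "\<not> m \<le> k"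
      then have km: "real k \<le> real m - 1" by linarith
      have "0 \<le> 1 - e + e * real m" using e by (simp add: add_nonneg_nonneg)
      then have "real m \<le> (real m - 1) * (1 - e + e * real m)"
        using 2 mult_right_mono[OF km, of "1 - e + e * real m"] by linarith
      then have "1 \<le> e * ((real m - 1) * (real m - 1))" by (simp add: algebra_simps)
      then have "e * (real m * real m + 2) \<le> e * ((real m - 1) * (real m - 1))" using e by simp
      then have "real m * real m + 2 \<le> (real m - 1) * (real m - 1)"
        using mult_le_cancel_left_pos[OF e(1)] by blast
      moreover have "(real m - 1) * (real m - 1) = real m * real m + 1 - 2 * real m" by (simp add: algebra_simps)
      ultimately show False using m by linarith
    qed
    show ?thesis using le ge k_def by simp
  qed
  have disj: "V \<inter> (T - I) = {}"
  proof (rule ccontr)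
    assume "V \<inter> (T - I) \<noteq> {}"
    then obtain v where "v \<in> V" "v \<in> T - I" by blast
    then show False using Vz[of v v] orthosetD(4)[OF V(1), of v v] by simp
  qed
  \<comment> \<open>Exchanging \<open>I\<close> for \<open>V\<close> inside \<open>T\<close> gives
    another frame; as all frames have the same sum, so do \<open>V\<close> and
    \<open>I\<close>.\<close>
  have "frame (V \<union> (T - I))"
    unfolding frame_def
  proof
    show "orthoset (V \<union> (T - I))"
      using V(1) oT Vz kernel_sym unfolding orthoset_def by (metis Diff_iff Un_iff finite_Diff finite_Un)
    show "card (V \<union> (T - I)) = N"
      using card_Un_disjoint[OF orthosetD(1)[OF V(1)] _ disj] fin I card card_mono[OF fin(1) I] frameD(2)[OF T]
      by (simp add: card_Diff_subset m_def)
  qed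
  then have "\<Sum>(V \<union> (T - I)) = \<Sum>T" using frame_sum T by simp
  moreover have "\<Sum>(V \<union> (T - I)) = \<Sum>V + \<Sum>(T - I)"
    by (rule sum.union_disjoint[OF orthosetD(1)[OF V(1)] _ disj]) (use fin in simp)
  moreover have "\<Sum>T = \<Sum>(T - I) + \<Sum>I" by (rule sum.subset_diff[OF I fin(1)])
  ultimately have VI: "\<Sum>V = \<Sum>I" by (metis add.commute add_left_imp_eq)
  \<comment> \<open>\<open>a\<close> is also the uniform mixture of \<open>V\<close>, so the
    decomposition of \<open>z\<close> over \<open>V\<close> can be solved for
    \<open>x\<close>.\<close>
  have "e *\<^sub>R x = z - (1 - e) *\<^sub>R a" by (simp add: z_def)
  also have "(1 - e) *\<^sub>R a = (\<Sum>v\<in>V. ((1 - e) / real m) *\<^sub>R v)"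
    unfolding a_def by (simp add: scaleR_right.sum[symmetric] VI)
  also have "z - \<dots> = (\<Sum>v\<in>V. \<phi> v z *\<^sub>R v - ((1 - e) / real m) *\<^sub>R v)"
    by (subst V(4)) (simp add: sum_subtractf)
  also have "\<dots> = (\<Sum>v\<in>V. (e * \<phi> v x) *\<^sub>R v)"
    using Vw by (intro sum.cong) (simp_all add: scaleR_diff_left[symmetric])
  also have "\<dots> = e *\<^sub>R (\<Sum>v\<in>V. \<phi> v x *\<^sub>R v)" by (simp add: scaleR_sum_right)
  finally have "x = (\<Sum>v\<in>V. \<phi> v x *\<^sub>R v)" using e by simp
  then show ?thesis using V(1) Vz VI card m_def by blast
qed

text \<open>\<open>spectral_orthoset\<close> lists only components of positive weight;
  \<open>face_frame\<close> with \<open>I = T\<close>, where its vanishing condition is void,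
  supplies all \<open>N\<close>.\<close>

lemma frame_decomposition:
  assumes "x \<in> S" shows "\<exists>T. frame T \<and> x = (\<Sum>t\<in>T. \<phi> t x *\<^sub>R t)"
proof -
  obtain T where T: "frame T" using frame_exists by blast
  obtain V where "orthoset V" "card V = card T" "x = (\<Sum>v\<in>V. \<phi> v x *\<^sub>R v)"
    using face_frame[OF T order_refl assms] by blast
  then show ?thesis using T by (auto simp: frame_def)
qed

end

section \<open>The fundamental equation of information theory\<close>

text \<open>At n * x monotonicity traps \<open>g\<close> between its values at neighbouring
  integers, where additivity makes it linear. The error is at most g 1 for every n, so dividing by n
  removes it.\<close>

lemma mono_additive_linear:
  fixes g :: "real \<Rightarrow> real"
  assumes mono: "mono g" and add: "\<And>x y. g (x + y) = g x + g y"
  shows "g x = g 1 * x"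
proof -
  have g0: "g 0 = 0" using add[of 0 0] by simp
  have gneg: "g (- y) = - g y" for y using add[of y "- y"] g0 by simp
  have gnat: "g (real n * y) = real n * g y" for n y
    by (induction n) (auto simp: g0 add distrib_right)
  have gint: "g (real_of_int k) = real_of_int k * g 1" for k
  proof (cases k rule: int_cases2)
    case (nonneg n) then show ?thesis using gnat[of n 1] by simp
  next
    case (nonpos n) then show ?thesis using gnat[of n 1] gneg[of "real n"] by simp
  qed
  have g1: "0 \<le> g 1" using monoD[OF mono, of 0 1] g0 by simp
  have bound: "real n * \<bar>g x - g 1 * x\<bar> \<le> g 1" for n
  proof -
    define y where "y = real n * x"
    have "g (real_of_int \<lfloor>y\<rfloor>) \<le> g y" "g y \<le> g (real_of_int (\<lfloor>y\<rfloor> + 1))"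
      by (rule monoD[OF mono], linarith)+
    then have "real_of_int \<lfloor>y\<rfloor> * g 1 \<le> g y" "g y \<le> (real_of_int \<lfloor>y\<rfloor> + 1) * g 1"
      unfolding gint by simp_all
    moreover have "real_of_int \<lfloor>y\<rfloor> * g 1 \<le> y * g 1" "y * g 1 \<le> (real_of_int \<lfloor>y\<rfloor> + 1) * g 1"
      using g1 by (intro mult_right_mono; linarith)+
    ultimately have "\<bar>g y - y * g 1\<bar> \<le> g 1" by (auto simp: algebra_simps)
    moreover have "g y - y * g 1 = real n * (g x - g 1 * x)" using gnat[of n x] by (simp add: y_def algebra_simps)
    ultimately show ?thesis by (simp add: abs_mult)
  qed
  show ?thesis
  proof (rule ccontr)
    assume "\<not> ?thesis"
    then have p: "0 < \<bar>g x - g 1 * x\<bar>" by simp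
    then obtain n where "g 1 < real n * \<bar>g x - g 1 * x\<bar>" using ex_less_of_nat_mult by blast
    then show False using bound[of n] by linarith
  qed
qed

text \<open>
  Taking right derivatives in \<open>y\<close> shows that the
  increment of the right derivative \<open>w\<close> between \<open>y\<close> and \<open>v\<close> depends only on the ratio of the odds
  of \<open>y\<close> and \<open>v\<close>, so that \<open>w\<close> is a monotone solution of Cauchy's equation in the log-odds.
\<close>

lemma fundamental_equation_of_information:
  fixes h :: "real \<Rightarrow> real"
  assumes conv: "convex_on {0<..<1} h"
    and sym: "\<And>p. 0 < p \<Longrightarrow> p < 1 \<Longrightarrow> h (1 - p) = h p"
    and eq: "\<And>x y. 0 < x \<Longrightarrow> 0 < y \<Longrightarrow> x + y < 1 \<Longrightarrow>
               h x + (1 - x) * h (y / (1 - x)) = h y + (1 - y) * h (x / (1 - y))"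
  shows "\<exists>C\<ge>0. \<forall>p. 0 < p \<longrightarrow> p < 1 \<longrightarrow> h p = C * (p * ln p + (1 - p) * ln (1 - p))"
proof -
  define sl where "sl q t = (h t - h q) / (t - q)" for q t
  have slope1: "sl x t \<le> sl x y" and slope2: "sl x y \<le> sl t y"
    if "0 < x" "x < t" "t < y" "y < 1" for x t y
  proof -
    have e: "(a - b) / (c - d) = (b - a) / (d - c)" for a b c d :: real
      by (metis minus_diff_eq minus_divide_divide)
    have "(h x - h t) / (x - t) \<le> (h x - h y) / (x - y)" "(h x - h y) / (x - y) \<le> (h t - h y) / (t - y)"
      by (rule convex_on_slope_le[OF conv]; use that in simp)+
    then show "sl x t \<le> sl x y" "sl x y \<le> sl t y"
      unfolding sl_def by (metis e)+
  qed
  have slope3: "sl x t \<le> sl t y" if "0 < x" "x < t" "t < y" "y < 1" for x t y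
    using slope1[OF that] slope2[OF that] by linarith
  \<comment> \<open>By convexity the slopes increase in \<open>t\<close>, so this infimum is the
    right derivative; two-sided differentiability is established only after \<open>w\<close> is
    known.\<close>
  define w where "w q = (INF t\<in>{q<..<1}. sl q t)" for q
  have bdd: "bdd_below (sl q ` {q<..<1})" if q: "0 < q" "q < 1" for q
    by (rule bdd_belowI2[where m="sl (q/2) q"]) (use slope3[of "q/2" q] q in auto)
  have w_le: "w q \<le> sl q t" if "0 < q" "q < t" "t < 1" for q t
    unfolding w_def by (rule cINF_lower[OF bdd]) (use that in auto)
  have le_w: "sl p q \<le> w q" if "0 < p" "p < q" "q < 1" for p q
    unfolding w_def by (rule cINF_greatest) (use slope3 that in auto)
  have w_mono: "w p \<le> w q" if "0 < p" "p < q" "q < 1" for p q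
    using w_le[of p q] le_w[of p q] that by linarith
  have deriv: "(h has_real_derivative w q) (at q within {q..})" if q: "0 < q" "q < 1" for q
  proof -
    have "(sl q \<longlongrightarrow> w q) (at_right q)"
    proof (rule order_tendstoI)
      fix a assume "a < w q"
      then have "a < sl q t" if "t \<in> {q<..<1}" for t using w_le[of q t] that q by auto
      then show "\<forall>\<^sub>F t in at_right q. a < sl q t" using q by (auto simp: eventually_at_right_field)
    next
      fix a assume "w q < a"
      then obtain t where t: "t \<in> {q<..<1}" "sl q t < a"
        unfolding w_def using cINF_less_iff[OF _ bdd[OF q]] q by auto
      then have "sl q s < a" if "q < s" "s < t" for s using slope1[of q s t] that q by auto
      then show "\<forall>\<^sub>F s in at_right q. sl q s < a" using t by (auto simp: eventually_at_right_field)
    qed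
    then have "(h has_real_derivative w q) (at q within {q<..})"
      by (simp add: has_field_derivative_iff sl_def[abs_def])
    moreover have "{q..} - {q} = {q<..} - {q}" by auto
    then have "at q within {q..} = at_right q" by (simp add: at_within_def)
    ultimately show ?thesis by simp
  qed
  have key: "w v - w y = (1 - r) * w (1 - r) - h (1 - r)"
    if y: "0 < y" "y < v" "v < 1" and r: "r = (y / (1 - y)) / (v / (1 - v))" for v y r
  proof -
    \<comment> \<open>Chosen so that y / (1 - x) = v; then x / (1 - y) = 1 - r depends only on the
      odds ratio \<open>r\<close>.\<close>
    define x where "x = 1 - y / v"
    have v0: "0 < v" using y by simp
    have x: "0 < x" "x < 1" "y / (1 - x) = v" using y v0 by (auto simp: x_def)
    have "y * v < y" using y v0 by simp
    then have xy: "x + y < 1" using v0 by (simp add: x_def field_simps)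
    have y1: "y < 1" using y by simp
    have u: "x / (1 - y) = 1 - r" using y v0 by (simp add: x_def r field_simps)
    have u01: "0 < x / (1 - y)" "x / (1 - y) < 1" using x xy y by auto
    \<comment> \<open>The equation holds for all \<open>s\<close> in [y, z]. Both inner arguments
      increase with \<open>s\<close>, so right derivatives pass through the chain rule.\<close>
    define z where "z = (y + (1 - x)) / 2"
    have z: "y < z" "x + z < 1" "z < 1" unfolding z_def using x xy y by argo+
    let ?A = "{y..z}"
    have D1: "((\<lambda>s. h x + (1 - x) * h (s / (1 - x))) has_real_derivative w v) (at y within ?A)"
    proof -
      have g: "((\<lambda>s. s / (1 - x)) has_real_derivative 1 / (1 - x)) (at y within ?A)"
        using x by (auto intro!: derivative_eq_intros)
      have "(h has_real_derivative w v) (at (y / (1 - x)) within (\<lambda>s. s / (1 - x)) ` ?A)"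
        unfolding x(3) by (rule has_field_derivative_subset[OF deriv]) (use y v0 x in \<open>auto simp: field_simps\<close>)
      from DERIV_image_chain[OF this g]
      have "((\<lambda>s. h (s / (1 - x))) has_real_derivative w v * (1 / (1 - x))) (at y within ?A)"
        by (simp add: o_def)
      then have "((\<lambda>s. h x + (1 - x) * h (s / (1 - x))) has_real_derivative
           0 + (1 - x) * (w v * (1 / (1 - x)))) (at y within ?A)"
        by (intro DERIV_add DERIV_const DERIV_cmult)
      then show ?thesis using x by simp
    qed
    have D2: "((\<lambda>s. h s + (1 - s) * h (x / (1 - s))) has_real_derivative
        w y - h (1 - r) + (1 - r) * w (1 - r)) (at y within ?A)"
    proof -
      have g: "((\<lambda>s. x / (1 - s)) has_real_derivative x / (1 - y)^2) (at y within ?A)"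
        using y1 by (auto intro!: derivative_eq_intros simp: power2_eq_square)
      have "(h has_real_derivative w (1 - r)) (at (x / (1 - y)) within (\<lambda>s. x / (1 - s)) ` ?A)"
        unfolding u
      proof (rule has_field_derivative_subset[OF deriv])
        show "(\<lambda>s. x / (1 - s)) ` ?A \<subseteq> {1 - r..}"
          unfolding u[symmetric] using x y1 z by (auto intro!: divide_left_mono mult_pos_pos)
      qed (use u01 u in auto)
      from DERIV_image_chain[OF this g]
      have c: "((\<lambda>s. h (x / (1 - s))) has_real_derivative w (1 - r) * (x / (1 - y)^2)) (at y within ?A)"
        by (simp add: o_def)
      have h: "(h has_real_derivative w y) (at y within ?A)"
        by (rule has_field_derivative_subset[OF deriv]) (use y y1 in auto)
      have l: "((\<lambda>s. 1 - s) has_real_derivative - 1) (at y within ?A)"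
        by (auto intro!: derivative_eq_intros)
      have "(1 - y) * (w (1 - r) * (x / (1 - y)^2)) = (x / (1 - y)) * w (1 - r)"
        using y1 by (simp add: power2_eq_square)
      also have "\<dots> = (1 - r) * w (1 - r)" by (simp only: u)
      finally have e: "(1 - y) * (w (1 - r) * (x / (1 - y)^2)) = (1 - r) * w (1 - r)" .
      show ?thesis
      proof -
        have e': "w (1 - r) * (x / (1 - y)^2) * (1 - y) = (1 - r) * w (1 - r)"
          using e by (metis mult.commute)
        have "w y + (- 1 * h (x / (1 - y)) + w (1 - r) * (x / (1 - y)^2) * (1 - y)) =
            w y - h (1 - r) + (1 - r) * w (1 - r)"
          unfolding e' u by linarith
        then show ?thesis by (rule DERIV_cong[OF DERIV_add[OF h DERIV_mult[OF l c]]])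
      qed
    qed
    have "((\<lambda>s. h x + (1 - x) * h (s / (1 - x))) has_real_derivative
        w y - h (1 - r) + (1 - r) * w (1 - r)) (at y within ?A)"
      by (rule has_field_derivative_transform_within[OF D2 zero_less_one]) (use eq x y z in auto)
    note D3 = this
    have "at y within ?A \<noteq> bot"
      using at_within_Icc_at_right[OF z(1)] by (simp add: trivial_limit_at_right_real)
    then have "w v = w y - h (1 - r) + (1 - r) * w (1 - r)"
      by (rule tendsto_unique[OF _ D1[unfolded has_field_derivative_iff] D3[unfolded has_field_derivative_iff]])
    then show ?thesis by simp
  qed
  \<comment> \<open>The logistic function, giving the probability with log-odds
    \<open>\<tau>\<close>.\<close>
  define L where "L \<tau> = exp \<tau> / (1 + exp \<tau>)" for \<tau> :: real
  have L: "0 < L \<tau>" "L \<tau> < 1" "L \<tau> / (1 - L \<tau>) = exp \<tau>" for \<tau>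
  proof -
    have "0 < 1 + exp \<tau>" by (simp add: add_pos_pos)
    then show "0 < L \<tau>" "L \<tau> < 1" "L \<tau> / (1 - L \<tau>) = exp \<tau>" by (auto simp: L_def field_simps)
  qed
  have L_less: "L \<sigma> < L \<tau>" if "\<sigma> < \<tau>" for \<sigma> \<tau>
  proof -
    have "0 < 1 + exp \<tau>" "0 < 1 + exp \<sigma>" by (simp_all add: add_pos_pos)
    then show ?thesis using that by (simp add: L_def field_simps)
  qed
  define W where "W \<tau> = w (L \<tau>)" for \<tau>
  define g where "g \<tau> = W \<tau> - W 0" for \<tau>
  \<comment> \<open>A shift of the log-odds by \<open>\<delta>\<close> has the odds ratio exp (-
    \<delta>) wherever it starts, so \<open>key\<close> gives the same increment at
    \<open>\<sigma>\<close> and at 0.\<close>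
  have inc: "W (\<sigma> + \<delta>) - W \<sigma> = W \<delta> - W 0" if "0 < \<delta>" for \<sigma> \<delta>
  proof -
    have "exp \<sigma> / exp (\<sigma> + \<delta>) = exp (- \<delta>)" for \<sigma> by (simp add: exp_diff[symmetric])
    then have "W (\<sigma> + \<delta>) - W \<sigma> = (1 - exp (- \<delta>)) * w (1 - exp (- \<delta>)) - h (1 - exp (- \<delta>))" for \<sigma>
      unfolding W_def using L L_less[of \<sigma> "\<sigma> + \<delta>"] that by (intro key) auto
    from this[of \<sigma>] this[of 0] show ?thesis by simp
  qed
  have "mono g" 
  proof (rule monoI)
    fix x y :: real assume "x \<le> y"
    then show "g x \<le> g y" using w_mono[OF L(1) L_less L(2), of x y] by (cases "x = y") (auto simp: g_def W_def)
  qed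
  moreover have "g (x + y) = g x + g y" for x y
  proof -
    have neg: "W (- y) - W 0 = - (W y - W 0)" if "0 < y" for y using inc[OF that, of "- y"] by simp
    consider "0 < y" | "y = 0" | "y < 0" by linarith
    then show ?thesis
    proof cases
      case 1 then show ?thesis using inc[of y x] by (simp add: g_def)
    next
      case 3 then show ?thesis using inc[of "- y" "x + y"] neg[of "- y"] by (simp add: g_def)
    qed (simp add: g_def)
  qed
  ultimately have g: "g x = g 1 * x" for x by (rule mono_additive_linear)
  define C where "C = g 1"
  have C: "0 \<le> C" using monoD[OF \<open>mono g\<close>, of 0 1] by (simp add: C_def g_def)
  define B where "B = W 0"
  have w: "w p = C * (ln p - ln (1 - p)) + B" if p: "0 < p" "p < 1" for p
  proof -
    define \<tau> where "\<tau> = ln (p / (1 - p))"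
    have "exp \<tau> = p / (1 - p)" using p by (simp add: \<tau>_def)
    moreover have "1 + p / (1 - p) = 1 / (1 - p)" using p by (simp add: field_simps)
    ultimately have "L \<tau> = p" using p by (simp add: L_def)
    then have "w p = C * \<tau> + B" using g[of \<tau>] by (simp add: g_def W_def C_def B_def)
    then show ?thesis using p by (simp add: \<tau>_def ln_div)
  qed
  \<comment> \<open>The right derivative is now an explicit continuous function; slopes are squeezed
    between its values at the two ends, so it is a genuine derivative.\<close>
  have hd: "(h has_real_derivative w p) (at p)" if p: "0 < p" "p < 1" for p
  proof -
    have "isCont (\<lambda>t. C * (ln t - ln (1 - t)) + B) p" using p by (intro continuous_intros) auto
    then have "((\<lambda>t. C * (ln t - ln (1 - t)) + B) \<longlongrightarrow> w p) (at p)" using w[OF p] by (simp add: isCont_def)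
    then have lim: "((\<lambda>t. \<bar>C * (ln t - ln (1 - t)) + B - w p\<bar>) \<longlongrightarrow> 0) (at p)"
      using tendsto_rabs_zero LIM_zero by blast
    have "((\<lambda>t. sl p t - w p) \<longlongrightarrow> 0) (at p)"
    proof (rule Lim_null_comparison[OF _ lim])
      have "\<forall>\<^sub>F t in at p. 0 < t \<and> t < 1 \<and> t \<noteq> p"
        using p by (intro eventually_conj order_tendstoD(1)[OF tendsto_ident_at]
            order_tendstoD(2)[OF tendsto_ident_at] eventually_neq_at_within) 
      then show "\<forall>\<^sub>F t in at p. norm (sl p t - w p) \<le> \<bar>C * (ln t - ln (1 - t)) + B - w p\<bar>"
      proof eventually_elim
        case (elim t)
        have s: "sl p t = sl t p" by (metis sl_def minus_diff_eq minus_divide_divide)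
        show ?case
        proof (cases "p < t")
          case True
          then show ?thesis using w_le[of p t] le_w[of p t] w[of t] elim p by auto
        next
          case False
          then show ?thesis using w_le[of t p] le_w[of t p] w[of t] s elim p by auto
        qed
      qed
    qed
    then show ?thesis unfolding has_field_derivative_iff using LIM_zero_cancel by (simp add: sl_def[abs_def])
  qed
  define E where "E p = C * (p * ln p + (1 - p) * ln (1 - p))" for p :: real
  have Ed: "(E has_real_derivative C * (ln p - ln (1 - p))) (at p)" if p: "0 < p" "p < 1" for p
  proof -
    have "((\<lambda>p. p * ln p) has_real_derivative ln p + 1) (at p)"
      using p by (auto intro!: derivative_eq_intros)
    moreover have "((\<lambda>p. (1 - p) * ln (1 - p)) has_real_derivative - ln (1 - p) - 1) (at p)"
      using p by (auto intro!: derivative_eq_intros)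
    ultimately have "(E has_real_derivative C * ((ln p + 1) + (- ln (1 - p) - 1))) (at p)"
      unfolding E_def by (intro DERIV_cmult DERIV_add)
    then show ?thesis by (simp add: algebra_simps)
  qed
  have "\<exists>k. \<forall>p\<in>{0<..<1}. h p - E p - B * p = k"
  proof (rule has_field_derivative_zero_constant)
    fix p :: real assume "p \<in> {0<..<1}"
    then have p: "0 < p" "p < 1" by auto
    have "((\<lambda>p. h p - E p - B * p) has_real_derivative w p - C * (ln p - ln (1 - p)) - B * 1) (at p)"
      using hd[OF p] Ed[OF p] by (intro DERIV_diff DERIV_cmult DERIV_ident)
    then show "((\<lambda>p. h p - E p - B * p) has_real_derivative 0) (at p within {0<..<1})"
      using w[OF p] by (simp add: has_field_derivative_at_within)
  qed simp
  then obtain k where k0: "\<And>p. p \<in> {0<..<1} \<Longrightarrow> h p - E p - B * p = k" by blast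
  have k: "h p = E p + B * p + k" if "0 < p" "p < 1" for p using k0[of p] that by simp
  \<comment> \<open>Both \<open>h\<close> and \<open>E\<close> are symmetric about 1/2, which
    excludes a linear term.\<close>
  have "E (3/4) = E (1/4)" by (simp add: E_def add.commute)
  then have "B = 0" using sym[of "1/4"] k[of "1/4"] k[of "3/4"] by simp
  moreover have "k = 0"
  proof -
    have l: "ln (1/2::real) = - ln 2" "ln (1/4::real) = - 2 * ln 2" "ln (3/4::real) = ln 3 - 2 * ln 2"
      "ln (2/3::real) = ln 2 - ln 3" "ln (1/3::real) = - ln 3"
    proof -
      have "ln (4::real) = ln (2 * 2)" by simp
      also have "\<dots> = 2 * ln 2" by (subst ln_mult) auto
      finally show "ln (1/2::real) = - ln 2" "ln (1/4::real) = - 2 * ln 2" "ln (3/4::real) = ln 3 - 2 * ln 2"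
        "ln (2/3::real) = ln 2 - ln 3" "ln (1/3::real) = - ln 3" by (simp_all add: ln_div)
    qed
    \<comment> \<open>The entropy terms cancel in this instance and leave (3/2) * k = (7/4) *
      k.\<close>
    have "h (1/2) + (1/2) * h (1/2) = h (1/4) + (3/4) * h (2/3)" using eq[of "1/2" "1/4"] by simp
    then show ?thesis using k[of "1/2"] k[of "1/4"] k[of "2/3"] \<open>B = 0\<close>
      by (simp add: E_def l algebra_simps)
  qed
  ultimately show ?thesis using k C by (auto simp: E_def)
qed

section \<open>Payoff and regret\<close>

text \<open>For \<open>x\<close> in \<open>S\<close> this says that \<open>x\<close> lies in the
  smallest face containing \<open>y\<close>; the generating point is the first of the two.\<close>

definition inface :: "'a::real_vector set \<Rightarrow> 'a \<Rightarrow> 'a \<Rightarrow> bool" where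
  "inface S y x \<longleftrightarrow> (\<exists>\<delta> z. 0 < \<delta> \<and> \<delta> < 1 \<and> z \<in> S \<and> y = (1 - \<delta>) *\<^sub>R z + \<delta> *\<^sub>R x)"

locale decision =
  fixes S :: "'a::euclidean_space set" and A :: "'a action set"
  assumes convex_S: "convex S" and problem: "decision_problem S A"
begin

definition F :: "'a \<Rightarrow> real" where "F x = real_of_ereal (payoff A x)"
text \<open>\<open>real_of_ereal\<close> sends -\<infinity> to 0, hence the finiteness premises in
  statements about \<open>val\<close>.\<close>

definition val :: "'a action \<Rightarrow> 'a \<Rightarrow> real" where "val a x = real_of_ereal (mean (a x))"

lemma mixture_in: "x \<in> S \<Longrightarrow> y \<in> S \<Longrightarrow> 0 \<le> u \<Longrightarrow> u \<le> 1 \<Longrightarrow> (1 - u) *\<^sub>R x + u *\<^sub>R y \<in> S"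
  using convexD[OF convex_S, of x y "1 - u" u] by simp

lemma payoff_eq: "x \<in> S \<Longrightarrow> payoff A x = ereal (F x)"
  using problem by (auto simp: decision_problem_def F_def ereal_real)

lemma mean_le: "a \<in> A \<Longrightarrow> x \<in> S \<Longrightarrow> mean (a x) \<le> ereal (F x)"
  using payoff_eq by (metis SUP_upper payoff_def)

lemma mean_mix:
  "a \<in> A \<Longrightarrow> x \<in> S \<Longrightarrow> y \<in> S \<Longrightarrow> 0 \<le> u \<Longrightarrow> u \<le> 1 \<Longrightarrow>
    mean (a ((1 - u) *\<^sub>R x + u *\<^sub>R y)) = ereal (1 - u) * mean (a x) + ereal u * mean (a y)"
  using problem by (auto simp: decision_problem_def is_action_def)

lemma optimal_exists: "y \<in> S \<Longrightarrow> \<exists>a. optimal_for A y a"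
  using problem by (auto simp: decision_problem_def)

lemma optimalD: "optimal_for A y a \<Longrightarrow> a \<in> A" "optimal_for A y a \<Longrightarrow> y \<in> S \<Longrightarrow> mean (a y) = ereal (F y)"
  using payoff_eq by (auto simp: optimal_for_def)

lemma optimal_val: "optimal_for A y a \<Longrightarrow> y \<in> S \<Longrightarrow> val a y = F y"
  by (simp add: val_def optimalD)

lemma mean_eq_val: "a \<in> A \<Longrightarrow> x \<in> S \<Longrightarrow> mean (a x) \<noteq> -\<infinity> \<Longrightarrow> mean (a x) = ereal (val a x)"
  using mean_le[of a x] by (cases "mean (a x)") (auto simp: val_def)

lemma val_le: "a \<in> A \<Longrightarrow> x \<in> S \<Longrightarrow> mean (a x) \<noteq> -\<infinity> \<Longrightarrow> val a x \<le> F x"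
  using mean_le[of a x] mean_eq_val[of a x] by simp

lemma mix_finite:
  assumes "a \<in> A" "x \<in> S" "y \<in> S" "0 < u" "u < 1" "mean (a ((1 - u) *\<^sub>R x + u *\<^sub>R y)) \<noteq> -\<infinity>"
  shows "mean (a x) \<noteq> -\<infinity>" "mean (a y) \<noteq> -\<infinity>"
  using mean_mix[of a x y u] mean_le[of a x] mean_le[of a y] assms
  by (cases "mean (a x)"; cases "mean (a y)"; auto)+

lemma val_mix:
  assumes "a \<in> A" "x \<in> S" "y \<in> S" "0 \<le> u" "u \<le> 1" "mean (a x) \<noteq> -\<infinity>" "mean (a y) \<noteq> -\<infinity>"
  shows "mean (a ((1 - u) *\<^sub>R x + u *\<^sub>R y)) = ereal ((1 - u) * val a x + u * val a y)"
    "val a ((1 - u) *\<^sub>R x + u *\<^sub>R y) = (1 - u) * val a x + u * val a y"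
proof -
  show "mean (a ((1 - u) *\<^sub>R x + u *\<^sub>R y)) = ereal ((1 - u) * val a x + u * val a y)"
    unfolding mean_mix[OF assms(1-5)] mean_eq_val[OF assms(1,2,6)] mean_eq_val[OF assms(1,3,7)] by simp
  then show "val a ((1 - u) *\<^sub>R x + u *\<^sub>R y) = (1 - u) * val a x + u * val a y"
    by (simp add: val_def)
qed

text \<open>The finite mean at \<open>y\<close> is a mixture with positive weight on the mean at
  \<open>x\<close>, and no mean is \<infinity> that could compensate for -\<infinity>.\<close>

lemma optimal_finite:
  assumes "optimal_for A y a" "y \<in> S" "x \<in> S" "inface S y x"
  shows "mean (a x) \<noteq> -\<infinity>"
proof -
  obtain \<delta> z where z: "0 < \<delta>" "\<delta> < 1" "z \<in> S" "y = (1 - \<delta>) *\<^sub>R z + \<delta> *\<^sub>R x"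
    using assms(4) by (auto simp: inface_def)
  then show ?thesis
    using mix_finite(2)[OF optimalD(1)[OF assms(1)] z(3) assms(3) z(1,2)] optimalD(2)[OF assms(1,2)] by simp
qed

lemma mean_finite_inface:
  assumes a: "a \<in> A" and y: "y \<in> S" and fin: "mean (a y) \<noteq> -\<infinity>" and x: "x \<in> S" and f: "inface S y x"
  shows "mean (a x) \<noteq> -\<infinity>"
proof -
  obtain \<delta> z where z: "0 < \<delta>" "\<delta> < 1" "z \<in> S" "y = (1 - \<delta>) *\<^sub>R z + \<delta> *\<^sub>R x"
    using f by (auto simp: inface_def)
  then show ?thesis using mix_finite(2)[OF a z(3) x z(1,2)] fin by simp
qed

text \<open>An action optimal at the mixture is affine and stays below \<open>F\<close> at both
  ends.\<close>

lemma F_convex: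
  assumes "x \<in> S" "y \<in> S" "0 \<le> u" "u \<le> 1"
  shows "F ((1 - u) *\<^sub>R x + u *\<^sub>R y) \<le> (1 - u) * F x + u * F y"
proof -
  consider "u = 0" | "u = 1" | "0 < u" "u < 1" using assms by linarith
  then show ?thesis
  proof cases
    case 3
    let ?z = "(1 - u) *\<^sub>R x + u *\<^sub>R y"
    have z: "?z \<in> S" by (rule mixture_in[OF assms])
    then obtain a where a: "optimal_for A ?z a" using optimal_exists by blast
    have "mean (a ?z) \<noteq> -\<infinity>" using optimalD(2)[OF a z] by simp
    note f = mix_finite[OF optimalD(1)[OF a] assms(1,2) 3 this]
    have "F ?z = (1 - u) * val a x + u * val a y"
      using val_mix(2)[OF optimalD(1)[OF a] assms f] optimal_val[OF a z] by simp
    also have "\<dots> \<le> (1 - u) * F x + u * F y"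
      using val_le[OF optimalD(1)[OF a] assms(1) f(1)] val_le[OF optimalD(1)[OF a] assms(2) f(2)] assms
      by (intro add_mono mult_left_mono) auto
    finally show ?thesis .
  qed auto
qed

lemma regret_le:
  "optimal_for A y a \<Longrightarrow> x \<in> S \<Longrightarrow> regret A x y \<le> ereal (F x) - mean (a x)"
  unfolding regret_def action_regret_def by (rule INF_lower2[of a]) (auto simp: payoff_eq)

lemma regret_ge:
  assumes "x \<in> S" "\<And>a. optimal_for A y a \<Longrightarrow> b \<le> ereal (F x) - mean (a x)"
  shows "b \<le> regret A x y"
  unfolding regret_def action_regret_def using assms by (intro INF_greatest) (auto simp: payoff_eq)

lemma regret_nonneg:
  assumes "x \<in> S" shows "0 \<le> regret A x y"
proof (rule regret_ge[OF assms])
  fix a assume "optimal_for A y a"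
  then show "0 \<le> ereal (F x) - mean (a x)"
    using mean_le[OF optimalD(1) assms] by (simp add: ereal_diff_positive)
qed

text \<open>Every action optimal at \<open>y\<close> is affine on the segment and starts at
  \<open>F y\<close>, so only its value at \<open>x\<close> matters. \<open>m\<close> is the
  supremum of these values, and one \<open>m\<close> serves all \<open>u\<close>.\<close>

lemma regret_ray:
  assumes y: "y \<in> S" and x: "x \<in> S" and f: "inface S y x"
  shows "\<exists>m. \<forall>u\<in>{0..1}. regret A ((1 - u) *\<^sub>R y + u *\<^sub>R x) y =
            ereal (F ((1 - u) *\<^sub>R y + u *\<^sub>R x) - (1 - u) * F y - u * m)"
proof -
  define R where "R = {val a x | a. optimal_for A y a}"
  have bdd: "bdd_above R"
    using val_le optimalD(1) optimal_finite[OF _ y x f] x unfolding R_def bdd_above_def by blast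
  have ne: "R \<noteq> {}" using optimal_exists[OF y] by (auto simp: R_def)
  have "regret A ((1 - u) *\<^sub>R y + u *\<^sub>R x) y = ereal (F ((1 - u) *\<^sub>R y + u *\<^sub>R x) - (1 - u) * F y - u * Sup R)"
    if u: "0 \<le> u" "u \<le> 1" for u
  proof -
    let ?z = "(1 - u) *\<^sub>R y + u *\<^sub>R x"
    have z: "?z \<in> S" by (rule mixture_in[OF y x u])
    have eq: "ereal (F ?z) - mean (a ?z) = ereal (F ?z - (1 - u) * F y - u * val a x)" if a: "optimal_for A y a" for a
      using val_mix(1)[OF optimalD(1)[OF a] y x u _ optimal_finite[OF a y x f]] optimalD(2)[OF a y] optimal_val[OF a y]
      by (simp add: algebra_simps)
    show ?thesis
    proof (rule antisym)
      show "ereal (F ?z - (1 - u) * F y - u * Sup R) \<le> regret A ?z y"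
      proof (rule regret_ge[OF z])
        fix a assume a: "optimal_for A y a"
        then have "val a x \<le> Sup R" by (intro cSup_upper bdd) (auto simp: R_def)
        then have "u * val a x \<le> u * Sup R" using u by (intro mult_left_mono)
        then show "ereal (F ?z - (1 - u) * F y - u * Sup R) \<le> ereal (F ?z) - mean (a ?z)"
          unfolding eq[OF a] by simp
      qed
      have up: "regret A ?z y \<le> ereal (F ?z - (1 - u) * F y - u * r)" if "r \<in> R" for r
        using that regret_le[OF _ z] eq unfolding R_def by force
      obtain r0 where r0: "r0 \<in> R" using ne by blast
      obtain d where d: "regret A ?z y = ereal d"
        using up[OF r0] regret_nonneg[OF z, of y] by (cases "regret A ?z y") auto
      have "u * Sup R \<le> F ?z - (1 - u) * F y - d"
      proof (cases "u = 0")
        case True then show ?thesis using up[OF r0] d by simp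
      next
        case False
        then have "r \<le> (F ?z - (1 - u) * F y - d) / u" if "r \<in> R" for r
          using up[OF that] d u by (simp add: field_simps)
        then have "Sup R \<le> (F ?z - (1 - u) * F y - d) / u" by (rule cSup_least[OF ne])
        then show ?thesis using False u by (simp add: field_simps)
      qed
      then show "regret A ?z y \<le> ereal (F ?z - (1 - u) * F y - u * Sup R)" by (simp add: d)
    qed
  qed
  then show ?thesis by (intro exI[of _ "Sup R"]) auto
qed

text \<open>
  On a segment, regret towards an interior point \<open>q\<close> determines the payoff up to an affine function
  on either side of \<open>q\<close>; comparing two points \<open>q\<close> makes the two affine functions agree.
\<close>

lemma payoff_segment_unique:
  fixes s t s' t' :: 'a
  assumes S: "s \<in> S" "t \<in> S" "s' \<in> S" "t' \<in> S"
    and eq: "\<And>p q. 0 \<le> p \<Longrightarrow> p \<le> 1 \<Longrightarrow> 0 \<le> q \<Longrightarrow> q \<le> 1 \<Longrightarrow>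
        regret A ((1 - p) *\<^sub>R s + p *\<^sub>R t) ((1 - q) *\<^sub>R s + q *\<^sub>R t) =
        regret A ((1 - p) *\<^sub>R s' + p *\<^sub>R t') ((1 - q) *\<^sub>R s' + q *\<^sub>R t')"
    and p: "0 \<le> p" "p \<le> 1"
  shows "F ((1 - p) *\<^sub>R s + p *\<^sub>R t) - F ((1 - p) *\<^sub>R s' + p *\<^sub>R t') = (1 - p) * (F s - F s') + p * (F t - F t')"
proof -
  define \<gamma> \<gamma>' where "\<gamma> p = (1 - p) *\<^sub>R s + p *\<^sub>R t" and "\<gamma>' p = (1 - p) *\<^sub>R s' + p *\<^sub>R t'" for p
  define d where "d p = F (\<gamma> p) - F (\<gamma>' p)" for p
  have in1: "\<gamma> p \<in> S" "\<gamma>' p \<in> S" if "0 \<le> p" "p \<le> 1" for p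
    unfolding \<gamma>_def \<gamma>'_def by (rule mixture_in; use S that in simp)+
  have face: "inface S (\<gamma> q) s" "inface S (\<gamma> q) t" "inface S (\<gamma>' q) s'" "inface S (\<gamma>' q) t'" if "0 < q" "q < 1" for q
    unfolding inface_def \<gamma>_def \<gamma>'_def
       apply (rule exI[of _ "1 - q"], rule exI[of _ t], use that S in \<open>simp add: add.commute\<close>)
      apply (rule exI[of _ q], rule exI[of _ s], use that S in simp)
     apply (rule exI[of _ "1 - q"], rule exI[of _ t'], use that S in \<open>simp add: add.commute\<close>)
    apply (rule exI[of _ q], rule exI[of _ s'], use that S in simp)
    done
  have up: "d ((1 - u) * q + u) = (1 - u) * d q + u * d 1" if q: "0 < q" "q < 1" and u: "0 \<le> u" "u \<le> 1" for q u
  proof -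
    have g: "(1 - v) *\<^sub>R \<gamma> q + v *\<^sub>R t = \<gamma> ((1 - v) * q + v)" "(1 - v) *\<^sub>R \<gamma>' q + v *\<^sub>R t' = \<gamma>' ((1 - v) * q + v)" for v
      unfolding \<gamma>_def \<gamma>'_def by (simp_all add: algebra_simps)
    obtain m where m: "\<And>v. 0 \<le> v \<Longrightarrow> v \<le> 1 \<Longrightarrow> regret A (\<gamma> ((1 - v) * q + v)) (\<gamma> q) = ereal (F (\<gamma> ((1 - v) * q + v)) - (1 - v) * F (\<gamma> q) - v * m)"
      using regret_ray[OF in1(1) S(2) face(2)[OF q]] q unfolding g by force
    obtain m' where m': "\<And>v. 0 \<le> v \<Longrightarrow> v \<le> 1 \<Longrightarrow> regret A (\<gamma>' ((1 - v) * q + v)) (\<gamma>' q) = ereal (F (\<gamma>' ((1 - v) * q + v)) - (1 - v) * F (\<gamma>' q) - v * m')"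
      using regret_ray[OF in1(2) S(4) face(4)[OF q]] q unfolding g by force
    have D: "d ((1 - v) * q + v) = (1 - v) * d q + v * (m - m')" if v: "0 \<le> v" "v \<le> 1" for v
    proof -
      have "0 \<le> (1 - v) * q + v" "(1 - v) * q + v \<le> 1"
        using v q by (auto simp: convex_bound_le intro: add_nonneg_nonneg) (use convex_bound_le[of q 1 1 "1 - v" v] in simp)
      then have "regret A (\<gamma> ((1 - v) * q + v)) (\<gamma> q) = regret A (\<gamma>' ((1 - v) * q + v)) (\<gamma>' q)"
        unfolding \<gamma>_def \<gamma>'_def using q by (intro eq) auto
      then show ?thesis using m[OF v] m'[OF v] by (simp add: d_def algebra_simps)
    qed
    \<comment> \<open>The unknown slopes enter only through their difference, which v = 1
      identifies.\<close>
    have "m - m' = d 1" using D[of 1] by simp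
    then show ?thesis using D[OF u] by simp
  qed
  have down: "d (u * q) = (1 - u) * d 0 + u * d q" if q: "0 < q" "q < 1" and u: "0 \<le> u" "u \<le> 1" for q u
  proof -
    have g: "(1 - v) *\<^sub>R \<gamma> q + v *\<^sub>R s = \<gamma> ((1 - v) * q)" "(1 - v) *\<^sub>R \<gamma>' q + v *\<^sub>R s' = \<gamma>' ((1 - v) * q)" for v
      unfolding \<gamma>_def \<gamma>'_def by (simp_all add: algebra_simps)
    obtain m where m: "\<And>v. 0 \<le> v \<Longrightarrow> v \<le> 1 \<Longrightarrow> regret A (\<gamma> ((1 - v) * q)) (\<gamma> q) = ereal (F (\<gamma> ((1 - v) * q)) - (1 - v) * F (\<gamma> q) - v * m)"
      using regret_ray[OF in1(1) S(1) face(1)[OF q]] q unfolding g by force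
    obtain m' where m': "\<And>v. 0 \<le> v \<Longrightarrow> v \<le> 1 \<Longrightarrow> regret A (\<gamma>' ((1 - v) * q)) (\<gamma>' q) = ereal (F (\<gamma>' ((1 - v) * q)) - (1 - v) * F (\<gamma>' q) - v * m')"
      using regret_ray[OF in1(2) S(3) face(3)[OF q]] q unfolding g by force
    have D: "d ((1 - v) * q) = (1 - v) * d q + v * (m - m')" if v: "0 \<le> v" "v \<le> 1" for v
    proof -
      have "0 \<le> (1 - v) * q" "(1 - v) * q \<le> 1" using v q by (auto intro: mult_le_one)
      then have "regret A (\<gamma> ((1 - v) * q)) (\<gamma> q) = regret A (\<gamma>' ((1 - v) * q)) (\<gamma>' q)"
        unfolding \<gamma>_def \<gamma>'_def using q by (intro eq) auto
      then show ?thesis using m[OF v] m'[OF v] by (simp add: d_def algebra_simps)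
    qed
    have "m - m' = d 0" using D[of 1] by simp
    then show ?thesis using D[of "1 - u"] u by simp
  qed
  have "d p = (1 - p) * d 0 + p * d 1"
  proof -
    consider "p = 0" | "p = 1" | "0 < p" "p < 1" using p by linarith
    then show ?thesis
    proof cases
      case 3
      \<comment> \<open>\<open>q\<close> is reached from \<open>p\<close> by an upward step of
        weight \<open>p\<close>, and \<open>p\<close> from \<open>q\<close> by a downward step of
        weight p / q; the two relations together determine \<open>d p\<close>.\<close>
      define q where "q = (1 - p) * p + p"
      have q: "p < q" "q < 1" "0 < q"
      proof -
        have "0 < (1 - p) * p" "0 < (1 - p) * (1 - p)" using 3 by auto
        then show "p < q" "q < 1" "0 < q" using 3 by (auto simp: q_def algebra_simps)
      qed
      have 1: "d q = (1 - p) * d p + p * d 1" using up[OF 3, of p] 3 by (simp add: q_def)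
      have "(p / q) * q = p" using q by simp
      then have "d p = (1 - p / q) * d 0 + (p / q) * d q" using down[OF q(3,2), of "p / q"] q 3 by simp
      then have "q * d p = (q - p) * d 0 + p * d q" using q by (simp add: field_simps)
      then have "q * d p = (1 - p) * p * d 0 + p * ((1 - p) * d p + p * d 1)" using 1 by (simp add: q_def)
      then have "p * d p = p * ((1 - p) * d 0 + p * d 1)" by (simp add: q_def algebra_simps)
      then show ?thesis using 3 by simp
    qed auto
  qed
  then show ?thesis by (simp add: d_def \<gamma>_def \<gamma>'_def)
qed

end

section \<open>Consequences of iso-sufficiency\<close>

locale iso_decision = state_kernel S c b N \<phi> + decision S A
  for S :: "'a::euclidean_space set" and c b N \<phi> A +
  assumes iso: "iso_sufficiency S A"
begin

lemma regret_isomixture: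
  assumes "isomixture S \<Phi>" "affine_map_on S \<Phi>" "\<Phi> ` S \<subseteq> S" "affine_map_on S \<Psi>" "\<Psi> ` S \<subseteq> S"
    "x \<in> S" "y \<in> S" "\<Psi> (\<Phi> x) = x" "\<Psi> (\<Phi> y) = y"
  shows "regret A (\<Phi> x) (\<Phi> y) = regret A x y"
  using iso assms unfolding iso_sufficiency_def sufficient_for_def by blast

text \<open>A single isometry is an isomixture, and its inverse witnesses sufficiency.\<close>

lemma regret_isometry:
  assumes "isometry_of S g" "x \<in> S" "y \<in> S"
  shows "regret A (g x) (g y) = regret A x y"
proof -
  obtain h where h: "isometry_of S h" "\<forall>x\<in>S. h (g x) = x \<and> g (h x) = x"
    using isometry_of_inverse[OF convex_S assms(1)] by blast
  have "isomixture S g"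
    unfolding isomixture_def
    by (rule exI[of _ "1::nat"], rule exI[of _ "\<lambda>_. 1"], rule exI[of _ "\<lambda>_. g"]) (use assms(1) in auto)
  then show ?thesis
    using assms h isometry_of_mem[OF assms(1)] isometry_of_mem[OF h(1)]
    by (intro regret_isomixture[where \<Psi>=h]) (auto simp: isometry_of_def)
qed

lemma isometry_affine:
  "isometry_of S g \<Longrightarrow> x \<in> S \<Longrightarrow> y \<in> S \<Longrightarrow> 0 \<le> u \<Longrightarrow> u \<le> 1 \<Longrightarrow>
     g ((1 - u) *\<^sub>R x + u *\<^sub>R y) = (1 - u) *\<^sub>R g x + u *\<^sub>R g y"
  using affine_map_onD[of S g x y u] by (simp add: isometry_of_def)

text \<open>
  If \<open>\<phi> s m = 0\<close>, then a mixture of isometries fixing \<open>s\<close> carries a pure state \<open>u\<close> orthogonal to \<open>s\<close>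
  to \<open>m\<close>, and the functional \<open>\<phi> s\<close> serves to undo it.
\<close>

lemma regret_segment_mixture:
  assumes s: "pure_state S s" and u: "pure_state S u" and su: "\<phi> s u = 0"
    and m: "m \<in> S" "\<phi> s m = 0"
    and pq: "0 \<le> p" "p \<le> 1" "0 \<le> q" "q \<le> 1"
  shows "regret A ((1 - p) *\<^sub>R s + p *\<^sub>R m) ((1 - q) *\<^sub>R s + q *\<^sub>R m) =
         regret A ((1 - p) *\<^sub>R s + p *\<^sub>R u) ((1 - q) *\<^sub>R s + q *\<^sub>R u)"
proof -
  obtain k w t where d: "\<forall>i<k. 0 \<le> w i \<and> pure_state S (t i)" "(\<Sum>i<k. w i) = 1" "m = (\<Sum>i<k::nat. w i *\<^sub>R t i)"
    using spectral[OF m(1)] by blast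
  have "(\<Sum>i<k. w i * \<phi> s (t i)) = 0" using m(2) d(3) kernel_sum[OF d(2)] by simp
  moreover have "0 \<le> w i * \<phi> s (t i)" if "i < k" for i
    using d(1) kernel_range[OF s pure_in] that by simp
  ultimately have z: "w i * \<phi> s (t i) = 0" if "i < k" for i
    using sum_nonneg_eq_0_iff[of "{..<k}" "\<lambda>i. w i * \<phi> s (t i)"] that by auto
  \<comment> \<open>Only components of positive weight are known to be orthogonal to
    \<open>s\<close>; for the others any isometry will do.\<close>
  have "\<exists>g. isometry_of S g \<and> (w i \<noteq> 0 \<longrightarrow> g u = t i \<and> g s = s)" if i: "i < k" for i
  proof (cases "w i = 0")
    case True then show ?thesis using isometry_of_id by blast
  next
    case False
    then have "\<phi> s (t i) = 0" using z[OF i] by simp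
    then have "orthogonal_states S (t i) s" "orthogonal_states S u s"
      using orthogonal_iff s u su d(1) i kernel_sym by auto
    then show ?thesis using transitive_orthogonal[OF u _ s, of "t i"] d(1) i by blast
  qed
  then obtain g where g: "\<And>i. i < k \<Longrightarrow> isometry_of S (g i)" "\<And>i. i < k \<Longrightarrow> w i \<noteq> 0 \<Longrightarrow> g i u = t i \<and> g i s = s"
    by metis
  define \<Phi> where "\<Phi> z = (\<Sum>i<k. w i *\<^sub>R g i z)" for z
  have iso\<Phi>: "isomixture S \<Phi>"
    unfolding isomixture_def \<Phi>_def
    by (rule exI[of _ k], rule exI[of _ w], rule exI[of _ g]) (use d g in auto)
  have \<Phi>S: "\<Phi> ` S \<subseteq> S"
  proof
    fix y assume "y \<in> \<Phi> ` S"
    then obtain z where z: "z \<in> S" "y = \<Phi> z" by blast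
    show "y \<in> S" unfolding z(2) \<Phi>_def
      by (rule convex_sum[OF _ convex_S d(2)]) (use d(1) isometry_of_mem[OF g(1) z(1)] in auto)
  qed
  have aff\<Phi>: "affine_map_on S \<Phi>"
    unfolding affine_map_on_def
  proof (intro ballI)
    fix x y and v :: real assume H: "x \<in> S" "y \<in> S" "v \<in> {0..1}"
    have "\<Phi> ((1 - v) *\<^sub>R x + v *\<^sub>R y) = (\<Sum>i<k. w i *\<^sub>R ((1 - v) *\<^sub>R g i x + v *\<^sub>R g i y))"
      unfolding \<Phi>_def using isometry_affine[OF g(1) H(1,2)] H(3) by (intro sum.cong) auto
    then show "\<Phi> ((1 - v) *\<^sub>R x + v *\<^sub>R y) = (1 - v) *\<^sub>R \<Phi> x + v *\<^sub>R \<Phi> y"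
      by (simp add: \<Phi>_def scaleR_add_right sum.distrib scaleR_sum_right mult.commute)
  qed
  have sS: "s \<in> S" and uS: "u \<in> S" using pure_in s u by auto
  define \<Psi> where "\<Psi> z = \<phi> s z *\<^sub>R s + (1 - \<phi> s z) *\<^sub>R u" for z
  have \<Psi>S: "\<Psi> ` S \<subseteq> S"
    using kernel_range[OF s] convexD[OF convex_S sS uS] by (auto simp: \<Psi>_def)
  have aff\<Psi>: "affine_map_on S \<Psi>"
    unfolding affine_map_on_def \<Psi>_def kernel_mix by (simp add: algebra_simps)
  have "\<Phi> s = (\<Sum>i<k. w i *\<^sub>R s)" unfolding \<Phi>_def by (rule sum.cong) (use g in auto)
  then have \<Phi>s: "\<Phi> s = s" using d(2) by (simp add: scaleR_left.sum[symmetric])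
  have \<Phi>u: "\<Phi> u = m" unfolding \<Phi>_def d(3) by (rule sum.cong) (use g in auto)
  have \<Phi>p: "\<Phi> ((1 - r) *\<^sub>R s + r *\<^sub>R u) = (1 - r) *\<^sub>R s + r *\<^sub>R m" if "0 \<le> r" "r \<le> 1" for r
    using affine_map_onD[OF aff\<Phi> sS uS that] \<Phi>s \<Phi>u by simp
  have \<Psi>p: "\<Psi> ((1 - r) *\<^sub>R s + r *\<^sub>R m) = (1 - r) *\<^sub>R s + r *\<^sub>R u" for r
    unfolding \<Psi>_def kernel_mix using m(2) kernel_pure[OF s] by simp
  have "regret A (\<Phi> ((1 - p) *\<^sub>R s + p *\<^sub>R u)) (\<Phi> ((1 - q) *\<^sub>R s + q *\<^sub>R u)) =
      regret A ((1 - p) *\<^sub>R s + p *\<^sub>R u) ((1 - q) *\<^sub>R s + q *\<^sub>R u)"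
    by (rule regret_isomixture[OF iso\<Phi> aff\<Phi> \<Phi>S aff\<Psi> \<Psi>S])
      (use \<Phi>p \<Psi>p pq mixture_in[OF sS uS] in auto)
  then show ?thesis using \<Phi>p pq by simp
qed

text \<open>Any two orthogonal pairs of pure states are related by an isometry: \<open>t\<close> is
  moved to \<open>t'\<close> first, then the other member is adjusted while \<open>t'\<close> stays
  fixed.\<close>

lemma regret_segment_pure:
  assumes st: "pure_state S s" "pure_state S t" "\<phi> s t = 0"
    and st': "pure_state S s'" "pure_state S t'" "\<phi> s' t' = 0"
    and pq: "0 \<le> p" "p \<le> 1" "0 \<le> q" "q \<le> 1"
  shows "regret A ((1 - p) *\<^sub>R s + p *\<^sub>R t) ((1 - q) *\<^sub>R s + q *\<^sub>R t) =
         regret A ((1 - p) *\<^sub>R s' + p *\<^sub>R t') ((1 - q) *\<^sub>R s' + q *\<^sub>R t')"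
proof -
  have o: "orthogonal_states S s t" "orthogonal_states S s' t'" using orthogonal_iff st st' by auto
  obtain g where g: "isometry_of S g" "g t = t'" using transitive_pure[OF st(2) st'(2)] by blast
  have "orthogonal_states S (g s) t'" using orthogonal_states_isometry[OF convex_S g(1) o(1)] g(2) by simp
  then obtain h where h: "isometry_of S h" "h (g s) = s'" "h t' = t'"
    using transitive_orthogonal[OF pure_state_isometry[OF convex_S g(1) st(1)] st'(1,2) _ o(2)] by blast
  define f where "f x = h (g x)" for x
  have f: "isometry_of S f" "f s = s'" "f t = t'"
    using isometry_of_comp[OF h(1) g(1)] h g by (auto simp: f_def[abs_def])
  have sS: "s \<in> S" "t \<in> S" using pure_in st by auto
  show ?thesis
    using regret_isometry[OF f(1) mixture_in[OF sS pq(1,2)] mixture_in[OF sS pq(3,4)]]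
    unfolding isometry_affine[OF f(1) sS pq(1,2)] isometry_affine[OF f(1) sS pq(3,4)] f(2,3) by simp
qed

text \<open>The deviation of \<open>F\<close> from linear interpolation between orthogonal pure
  states. That one function serves all pairs is the content of \<open>F_pair\<close>; its values
  outside [0,1] are arbitrary.\<close>

definition h :: "real \<Rightarrow> real" where
  "h = (SOME h. \<forall>s t p. pure_state S s \<longrightarrow> pure_state S t \<longrightarrow> \<phi> s t = 0 \<longrightarrow> 0 \<le> p \<longrightarrow> p \<le> 1 \<longrightarrow>
          F ((1 - p) *\<^sub>R s + p *\<^sub>R t) = (1 - p) * F s + p * F t + h p)"

lemma orthogonal_triple:
  "\<exists>r s t. pure_state S r \<and> pure_state S s \<and> pure_state S t \<and> \<phi> r s = 0 \<and> \<phi> r t = 0 \<and> \<phi> s t = 0"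
  using three_orthogonal kernel_orthogonal by metis

lemma F_pair:
  assumes "pure_state S s" "pure_state S t" "\<phi> s t = 0" "0 \<le> p" "p \<le> 1"
  shows "F ((1 - p) *\<^sub>R s + p *\<^sub>R t) = (1 - p) * F s + p * F t + h p"
proof -
  obtain s0 t0 where st0: "pure_state S s0" "pure_state S t0" "\<phi> s0 t0 = 0"
    using orthogonal_triple by blast
  define h0 where "h0 p = F ((1 - p) *\<^sub>R s0 + p *\<^sub>R t0) - (1 - p) * F s0 - p * F t0" for p
  have "F ((1 - p) *\<^sub>R s + p *\<^sub>R t) = (1 - p) * F s + p * F t + h0 p"
    if st: "pure_state S s" "pure_state S t" "\<phi> s t = 0" and p: "0 \<le> p" "p \<le> 1" for s t p
  proof -
    have "F ((1 - p) *\<^sub>R s + p *\<^sub>R t) - F ((1 - p) *\<^sub>R s0 + p *\<^sub>R t0) = (1 - p) * (F s - F s0) + p * (F t - F t0)"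
      by (rule payoff_segment_unique[OF _ _ _ _ regret_segment_pure[OF st st0] p]) (use pure_in st st0 in auto)
    then show ?thesis by (simp add: h0_def algebra_simps)
  qed
  then have "\<exists>h. \<forall>s t p. pure_state S s \<longrightarrow> pure_state S t \<longrightarrow> \<phi> s t = 0 \<longrightarrow> 0 \<le> p \<longrightarrow> p \<le> 1 \<longrightarrow>
          F ((1 - p) *\<^sub>R s + p *\<^sub>R t) = (1 - p) * F s + p * F t + h p" by blast
  from someI_ex[OF this] show ?thesis using assms unfolding h_def by blast
qed

text \<open>The same \<open>h\<close> governs segments towards a mixed state:
  \<open>regret_segment_mixture\<close> matches their regrets with those on a segment to a pure
  state, and \<open>payoff_segment_unique\<close> transfers this to \<open>F\<close>.\<close>

lemma F_mix:
  assumes s: "pure_state S s" and m: "m \<in> S" "\<phi> s m = 0" and p: "0 \<le> p" "p \<le> 1"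
  shows "F ((1 - p) *\<^sub>R s + p *\<^sub>R m) = (1 - p) * F s + p * F m + h p"
proof -
  obtain s0 t0 where st0: "pure_state S s0" "pure_state S t0" "\<phi> s0 t0 = 0"
    using orthogonal_triple by blast
  obtain g where g: "isometry_of S g" "g s0 = s" using transitive_pure[OF st0(1) s] by blast
  define u where "u = g t0"
  have u: "pure_state S u" "\<phi> s u = 0"
    using pure_state_isometry[OF convex_S g(1) st0(2)] orthogonal_states_isometry[OF convex_S g(1)]
      kernel_orthogonal[OF s] orthogonal_iff[OF st0(1,2)] st0(3) g(2) by (auto simp: u_def)
  have "F ((1 - p) *\<^sub>R s + p *\<^sub>R m) - F ((1 - p) *\<^sub>R s + p *\<^sub>R u) = (1 - p) * (F s - F s) + p * (F m - F u)"
    by (rule payoff_segment_unique[OF _ _ _ _ regret_segment_mixture[OF s u m] p]) (use pure_in s u m in auto)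
  then show ?thesis using F_pair[OF s u p] by (simp add: algebra_simps)
qed

lemma h_0: "h 0 = 0"
  using orthogonal_triple F_pair[where p=0] by auto

lemma h_sym: "0 \<le> p \<Longrightarrow> p \<le> 1 \<Longrightarrow> h (1 - p) = h p"
proof -
  assume p: "0 \<le> p" "p \<le> 1"
  obtain s t where st: "pure_state S s" "pure_state S t" "\<phi> s t = 0" using orthogonal_triple by blast
  then have "\<phi> t s = 0" using kernel_sym by simp
  then show "h (1 - p) = h p"
    using F_pair[OF st p] F_pair[OF st(2,1), of "1 - p"] p by (simp add: add.commute)
qed

lemma h_convex: "convex_on {0<..<1} h"
proof (rule convex_onI)
  fix u x y :: real assume u: "0 < u" "u < 1" and xy: "x \<in> {0<..<1}" "y \<in> {0<..<1}"
  obtain s t where st: "pure_state S s" "pure_state S t" "\<phi> s t = 0" using orthogonal_triple by blast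
  have sS: "s \<in> S" "t \<in> S" using pure_in st by auto
  define z where "z = (1 - u) * x + u * y"
  have z: "0 < z" "z < 1"
    using xy u convex_bound_lt[of x 1 y "1 - u" u] by (auto simp: z_def add_pos_pos)
  have "(1 - u) *\<^sub>R ((1 - x) *\<^sub>R s + x *\<^sub>R t) + u *\<^sub>R ((1 - y) *\<^sub>R s + y *\<^sub>R t) = (1 - z) *\<^sub>R s + z *\<^sub>R t"
    by (simp add: z_def algebra_simps)
  then have "F ((1 - z) *\<^sub>R s + z *\<^sub>R t) \<le> (1 - u) * F ((1 - x) *\<^sub>R s + x *\<^sub>R t) + u * F ((1 - y) *\<^sub>R s + y *\<^sub>R t)"
    using F_convex[OF mixture_in[OF sS, of x] mixture_in[OF sS, of y], of u] u xy by simp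
  then have "(1 - z) * F s + z * F t + h z \<le>
      (1 - u) * ((1 - x) * F s + x * F t + h x) + u * ((1 - y) * F s + y * F t + h y)"
    using F_pair[OF st] z xy by simp
  then have "h z \<le> (1 - u) * h x + u * h y" by (simp add: z_def algebra_simps)
  then show "h ((1 - u) *\<^sub>R x + u *\<^sub>R y) \<le> (1 - u) * h x + u * h y" by (simp add: z_def)
qed simp

text \<open>One mixture of three orthogonal states is evaluated in two ways, splitting off either
  \<open>s\<close> or \<open>t\<close> first.\<close>

lemma h_grouping:
  assumes "0 < x" "0 < y" "x + y < 1"
  shows "h x + (1 - x) * h (y / (1 - x)) = h y + (1 - y) * h (x / (1 - y))"
proof -
  obtain r s t where o: "pure_state S r" "pure_state S s" "pure_state S t" "\<phi> r s = 0" "\<phi> r t = 0" "\<phi> s t = 0"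
    using orthogonal_triple by blast
  have G: "F ((1 - x - y) *\<^sub>R r + x *\<^sub>R s + y *\<^sub>R t) =
        (1 - x - y) * F r + x * F s + y * F t + (h x + (1 - x) * h (y / (1 - x)))"
    if o: "pure_state S s" "pure_state S t" "\<phi> r t = 0" "\<phi> s t = 0" "\<phi> r s = 0"
      and xy: "0 < x" "0 < y" "x + y < 1" for s t x y
  proof -
    define m where "m = (1 - y / (1 - x)) *\<^sub>R r + (y / (1 - x)) *\<^sub>R t"
    have y: "0 \<le> y / (1 - x)" "y / (1 - x) \<le> 1" "(1 - x) * (y / (1 - x)) = y" using xy by (auto simp: field_simps)
    have m: "m \<in> S" "\<phi> s m = 0" unfolding m_def kernel_mix
      using mixture_in[OF pure_in pure_in y(1,2)] \<open>pure_state S r\<close> o kernel_sym by auto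
    have "(1 - x - y) *\<^sub>R r + x *\<^sub>R s + y *\<^sub>R t = (1 - (1 - x)) *\<^sub>R s + (1 - x) *\<^sub>R m"
    proof -
      have "(1 - x) *\<^sub>R m = (1 - x - (1 - x) * (y / (1 - x))) *\<^sub>R r + ((1 - x) * (y / (1 - x))) *\<^sub>R t"
        by (simp only: m_def scaleR_add_right scaleR_scaleR right_diff_distrib mult_1_right)
      then show ?thesis unfolding y(3) by (simp add: algebra_simps)
    qed
    then have "F ((1 - x - y) *\<^sub>R r + x *\<^sub>R s + y *\<^sub>R t) = x * F s + (1 - x) * F m + h (1 - x)"
      using F_mix[OF o(1) m, of "1 - x"] xy by (simp only:) simp
    also have "F m = (1 - y / (1 - x)) * F r + (y / (1 - x)) * F t + h (y / (1 - x))"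
      unfolding m_def using F_pair[OF \<open>pure_state S r\<close> o(2,3) y(1,2)] .
    also have "(1 - x) * \<dots> = (1 - x - y) * F r + y * F t + (1 - x) * h (y / (1 - x))"
    proof -
      have "(1 - x) * ((1 - y / (1 - x)) * F r + (y / (1 - x)) * F t + h (y / (1 - x))) =
          ((1 - x) - (1 - x) * (y / (1 - x))) * F r + ((1 - x) * (y / (1 - x))) * F t + (1 - x) * h (y / (1 - x))"
        by (simp only: algebra_simps)
      then show ?thesis unfolding y(3) .
    qed
    also have "h (1 - x) = h x" using h_sym xy by simp
    finally show ?thesis by simp
  qed
  have c: "1 - y - x = 1 - x - y" by simp
  have e: "(1 - x - y) *\<^sub>R r + y *\<^sub>R t + x *\<^sub>R s = (1 - x - y) *\<^sub>R r + x *\<^sub>R s + y *\<^sub>R t"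
    by (simp add: add.assoc add.commute)
  show ?thesis
    using G[of s t x y] G[of t s y x, unfolded c e] o kernel_sym[of t s] assms by simp
qed

text \<open>Normalised at 1/2, where the entropy expression equals - ln 2.\<close>

definition C :: real where "C = - h (1/2) / ln 2"

lemma
  shows C_nonneg: "0 \<le> C"
    and h_entropy: "0 \<le> p \<Longrightarrow> p \<le> 1 \<Longrightarrow> h p = C * (p * ln p + (1 - p) * ln (1 - p))"
proof -
  obtain C' where C': "0 \<le> C'" "\<And>p. 0 < p \<Longrightarrow> p < 1 \<Longrightarrow> h p = C' * (p * ln p + (1 - p) * ln (1 - p))"
    using fundamental_equation_of_information[OF h_convex h_sym h_grouping] by auto
  have "h (1/2) = C' * ln (1/2)" using C'(2)[of "1/2"] by simp
  then have "C = C'" by (simp add: C_def ln_div)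
  then show "0 \<le> C" using C' by simp
  show "h p = C * (p * ln p + (1 - p) * ln (1 - p))" if "0 \<le> p" "p \<le> 1"
  proof -
    have "h 1 = 0" using h_sym[of 0] h_0 by simp
    then show ?thesis using C'(2)[of p] that h_0 \<open>C = C'\<close> by (cases "p = 0 \<or> p = 1") auto
  qed
qed

text \<open>Induction splits off one state by \<open>F_mix\<close>, and the chain rule of entropy
  combines \<open>h r\<close> with the entropy of the renormalised rest. The case w s = 1 is
  separate because nothing is left to renormalise.\<close>

lemma F_orthoset:
  assumes "orthoset T" "\<And>t. t \<in> T \<Longrightarrow> 0 \<le> w t" "sum w T = 1"
  shows "F (\<Sum>t\<in>T. w t *\<^sub>R t) = (\<Sum>t\<in>T. w t * F t) + C * (\<Sum>t\<in>T. w t * ln (w t))"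
  using orthosetD(1)[OF assms(1)] assms
proof (induction T arbitrary: w rule: finite_induct)
  case empty then show ?case by simp
next
  case (insert s T)
  have oT: "orthoset T" and s: "pure_state S s"
    using insert.prems(1) by (auto simp: orthoset_def)
  have w: "w s + sum w T = 1" using insert by simp
  have w0: "0 \<le> w s" "\<And>t. t \<in> T \<Longrightarrow> 0 \<le> w t" using insert.prems(2) by auto
  show ?case
  proof (cases "w s = 1")
    case True
    then have "sum w T = 0" using w by simp
    then have z: "w t = 0" if "t \<in> T" for t
      using sum_nonneg_eq_0_iff[OF insert.hyps(1) w0(2)] that by simp
    have "(\<Sum>t\<in>T. w t *\<^sub>R t) = 0" "(\<Sum>t\<in>T. w t * F t) = 0" "(\<Sum>t\<in>T. w t * ln (w t)) = 0"
      using z by (auto intro!: sum.neutral)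
    then show ?thesis using insert.hyps True by simp
  next
    case False
    define r where "r = 1 - w s"
    have r: "0 < r" "r \<le> 1" "sum w T = r" using w w0(1) False sum_nonneg[of T w, OF w0(2)] by (auto simp: r_def)
    define m where "m = (\<Sum>t\<in>T. (w t / r) *\<^sub>R t)"
    have v: "(\<Sum>t\<in>T. w t / r) = 1" using r by (simp add: sum_divide_distrib[symmetric])
    have mS: "m \<in> S" unfolding m_def
      by (rule convex_sum[OF insert.hyps(1) convex_S v]) (use w0 r orthosetD(3)[OF oT] in auto)
    have "\<phi> s m = (\<Sum>t\<in>T. (w t / r) * \<phi> s t)" unfolding m_def by (rule kernel_sum[OF v])
    also have "\<dots> = 0"
      using insert.hyps insert.prems(1) by (intro sum.neutral) (auto simp: orthoset_def)
    finally have sm: "\<phi> s m = 0" .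
    have "(\<Sum>t\<in>insert s T. w t *\<^sub>R t) = (1 - r) *\<^sub>R s + r *\<^sub>R m"
      using insert.hyps r by (simp add: m_def scaleR_sum_right r_def)
    then have "F (\<Sum>t\<in>insert s T. w t *\<^sub>R t) = w s * F s + r * F m + h r"
      using F_mix[OF s mS sm, of r] r by (simp add: r_def)
    also have "F m = (\<Sum>t\<in>T. w t / r * F t) + C * (\<Sum>t\<in>T. w t / r * ln (w t / r))"
      unfolding m_def by (rule insert.IH[OF oT _ v]) (use w0 r in auto)
    also have "r * \<dots> = (\<Sum>t\<in>T. w t * F t) + C * (\<Sum>t\<in>T. w t * ln (w t / r))"
    proof -
      have "r * (\<Sum>t\<in>T. w t / r * F t) = (\<Sum>t\<in>T. w t * F t)"
        "r * (\<Sum>t\<in>T. w t / r * ln (w t / r)) = (\<Sum>t\<in>T. w t * ln (w t / r))"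
        using r by (simp_all add: sum_distrib_left)
      then show ?thesis by (simp add: distrib_left mult.left_commute)
    qed
    also have "(\<Sum>t\<in>T. w t * ln (w t / r)) = (\<Sum>t\<in>T. w t * ln (w t) - w t * ln r)"
    proof (rule sum.cong)
      fix t assume "t \<in> T"
      then show "w t * ln (w t / r) = w t * ln (w t) - w t * ln r"
        using w0(2)[of t] r by (cases "w t = 0") (auto simp: ln_div algebra_simps)
    qed simp
    also have "\<dots> = (\<Sum>t\<in>T. w t * ln (w t)) - r * ln r"
      using r(3) by (simp add: sum_subtractf sum_distrib_right[symmetric])
    also have "h r = C * (r * ln r + w s * ln (w s))" using h_entropy[of r] r by (simp add: r_def)
    finally show ?thesis using insert.hyps by (simp add: algebra_simps)
  qed
qed

end

section \<open>Relative entropy and faces\<close>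

context state_kernel
begin

text \<open>Dividing the sum by 1 - \<delta> gives the required state, so it suffices to exhibit
  nonnegative weights with the right total.\<close>

lemma infaceI_sum:
  assumes "finite V" "\<And>v. v \<in> V \<Longrightarrow> v \<in> S" "\<And>v. v \<in> V \<Longrightarrow> 0 \<le> w v" "0 < \<delta>" "\<delta> < 1" "sum w V = 1 - \<delta>"
    and "y = \<delta> *\<^sub>R x + (\<Sum>v\<in>V. w v *\<^sub>R v)"
  shows "inface S y x"
proof -
  define z where "z = (\<Sum>v\<in>V. (w v / (1 - \<delta>)) *\<^sub>R v)"
  have "(\<Sum>v\<in>V. w v / (1 - \<delta>)) = 1" using assms by (simp add: sum_divide_distrib[symmetric])
  then have "z \<in> S" unfolding z_def
    by (intro convex_sum[OF assms(1) convex_S]) (use assms in auto)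
  moreover have "(1 - \<delta>) *\<^sub>R z = (\<Sum>v\<in>V. w v *\<^sub>R v)" using assms by (simp add: z_def scaleR_sum_right)
  ultimately show ?thesis using assms unfolding inface_def by (metis add.commute)
qed

text \<open>The kernel at a pure state is nonnegative and affine, so its zeros in \<open>S\<close>
  form a face.\<close>

lemma kernel_inface:
  assumes "inface S y x" "x \<in> S" "pure_state S t" "\<phi> t y = 0"
  shows "\<phi> t x = 0"
proof -
  obtain \<delta> z where z: "0 < \<delta>" "\<delta> < 1" "z \<in> S" "y = (1 - \<delta>) *\<^sub>R z + \<delta> *\<^sub>R x"
    using assms(1) by (auto simp: inface_def)
  have "(1 - \<delta>) * \<phi> t z + \<delta> * \<phi> t x = 0" using assms(4) z(4) kernel_mix by simp
  moreover have "0 \<le> (1 - \<delta>) * \<phi> t z" "0 \<le> \<delta> * \<phi> t x"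
    using kernel_range[OF assms(3)] z assms(2) by simp_all
  ultimately show ?thesis using z by (smt (verit) mult_pos_pos mult_eq_0_iff)
qed

text \<open>For N = 1 every state would equal \<open>c\<close>, but orthogonal pure states differ.
  This makes 1 / N a proper mixing weight.\<close>

lemma two_le_N: "2 \<le> N"
proof (rule ccontr)
  assume "\<not> ?thesis"
  then have N: "N = 1" using N_pos by simp
  have "x = c" if "x \<in> S" for x
  proof -
    obtain T where T: "frame T" "x = (\<Sum>t\<in>T. \<phi> t x *\<^sub>R t)" using frame_decomposition[OF \<open>x \<in> S\<close>] by blast
    then obtain t where "T = {t}" using frameD(2)[OF T(1)] N card_1_singletonE by metis
    then show ?thesis using T frame_kernel_sum[OF T(1), of x] frame_sum[OF T(1)] N by simp
  qed
  then have "s = t" if "pure_state S s" "pure_state S t" for s t using pure_in that by metis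
  then show False using three_orthogonal kernel_orthogonal kernel_pure by (metis zero_neq_one)
qed

text \<open>In a frame adapted to \<open>x\<close>, \<open>z\<close> is the normalised complement,
  with weights proportional to 1 - \<phi> t x; the frame sums to N times \<open>c\<close>.\<close>

lemma center_decomposition:
  assumes "x \<in> S" shows "\<exists>z\<in>S. c = (1 - 1 / real N) *\<^sub>R z + (1 / real N) *\<^sub>R x"
proof -
  obtain T where T: "frame T" "x = (\<Sum>t\<in>T. \<phi> t x *\<^sub>R t)" using frame_decomposition[OF assms] by blast
  note o = orthosetD[OF frameD(1)[OF T(1)]]
  have N1: "real N - 1 > 0" using two_le_N by simp
  define w where "w t = (1 - \<phi> t x) / (real N - 1)" for t
  define z where "z = (\<Sum>t\<in>T. w t *\<^sub>R t)"
  have w0: "0 \<le> w t" if "t \<in> T" for t using kernel_range[OF o(2)[OF that] assms] N1 by (simp add: w_def)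
  have "(\<Sum>t\<in>T. w t) = 1"
    using frame_kernel_sum[OF T(1), of x] frameD(2)[OF T(1)] N1
    by (simp add: w_def sum_divide_distrib[symmetric] sum_subtractf)
  then have zS: "z \<in> S" unfolding z_def
    by (intro convex_sum[OF o(1) convex_S]) (use w0 o in auto)
  have "(real N - 1) *\<^sub>R z = (\<Sum>t\<in>T. (1 - \<phi> t x) *\<^sub>R t)"
    using N1 by (simp add: z_def w_def scaleR_sum_right)
  also have "\<dots> = real N *\<^sub>R c - x"
    using frame_sum[OF T(1)] T(2) by (simp add: scaleR_left.diff sum_subtractf)
  finally have "real N *\<^sub>R c = (real N - 1) *\<^sub>R z + x" by simp
  then have "(1 / real N) *\<^sub>R (real N *\<^sub>R c) = (1 / real N) *\<^sub>R ((real N - 1) *\<^sub>R z + x)" by simp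
  moreover have "(1 / real N) * (real N - 1) = 1 - 1 / real N" using N_pos by (simp add: field_simps)
  ultimately show ?thesis using zS N_pos by (auto simp: scaleR_add_right)
qed

text \<open>Combined with \<open>optimal_finite\<close>, this makes an action optimal at
  \<open>c\<close> finite on all of \<open>S\<close>.\<close>

lemma inface_center:
  assumes "x \<in> S" shows "inface S c x"
  using center_decomposition[OF assms] two_le_N unfolding inface_def
  by (intro exI[of _ "1 / real N"]) auto

lemma kernel_expand:
  assumes "frame U" "z = (\<Sum>u\<in>U. \<phi> u z *\<^sub>R u)"
  shows "\<phi> x z = (\<Sum>u\<in>U. \<phi> u z * \<phi> x u)"
  using kernel_sum[OF frame_kernel_sum[OF assms(1)], of x z "\<lambda>u. u"] assms(2) by simp

text \<open>The relative entropy is bounded by a \<open>\<chi>\<^sup>2\<close>-divergence, which is quadratic in \<open>z - y\<close>.\<close>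

lemma entropy_chi_square:
  assumes T: "frame T" "y = (\<Sum>t\<in>T. \<phi> t y *\<^sub>R t)" and U: "frame U" "z = (\<Sum>u\<in>U. \<phi> u z *\<^sub>R u)"
    and zS: "z \<in> S" and yS: "y \<in> S"
    and sub: "\<And>t. t \<in> T \<Longrightarrow> \<phi> t y = 0 \<Longrightarrow> \<phi> t z = 0"
    and \<mu>: "0 < \<mu>" "\<And>t. t \<in> T \<Longrightarrow> \<phi> t y \<noteq> 0 \<Longrightarrow> \<mu> \<le> \<phi> t y"
  shows "(\<Sum>u\<in>U. \<phi> u z * ln (\<phi> u z)) - (\<Sum>t\<in>T. \<phi> t z * ln (\<phi> t y)) \<le> b (z - y) (z - y) / \<mu>"
proof -
  note oT = orthosetD[OF frameD(1)[OF T(1)]] and oU = orthosetD[OF frameD(1)[OF U(1)]]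
  define p q where "p t = \<phi> t y" and "q u = \<phi> u z" for t u
  define I where "I = {t\<in>T. p t \<noteq> 0}"
  have I: "finite I" "I \<subseteq> T" using oT(1) by (auto simp: I_def)
  have p0: "0 \<le> p t" if "t \<in> T" for t using kernel_range[OF oT(2)[OF that] yS] by (simp add: p_def)
  have pI: "\<mu> \<le> p t" if "t \<in> I" for t using \<mu>(2)[of t] that by (auto simp: I_def p_def)
  have q0: "0 \<le> q u" if "u \<in> U" for u using kernel_range[OF oU(2)[OF that] zS] by (simp add: q_def)
  have M0: "0 \<le> \<phi> t u" if "t \<in> T" "u \<in> U" for t u using kernel_range[OF oT(2)[OF that(1)] oU(3)[OF that(2)]] by simp
  have \<phi>z: "\<phi> t z = (\<Sum>u\<in>U. q u * \<phi> t u)" for t unfolding q_def by (rule kernel_expand[OF U])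
  have off: "q u * \<phi> t u = 0" if t: "t \<in> T - I" and u: "u \<in> U" for t u
  proof -
    have "(\<Sum>u\<in>U. q u * \<phi> t u) = 0" using sub[of t] t \<phi>z[of t] by (auto simp: I_def p_def)
    then show ?thesis
      using sum_nonneg_eq_0_iff[OF oU(1), of "\<lambda>u. q u * \<phi> t u"] q0 M0 t u by auto
  qed
  have rowsum: "(\<Sum>t\<in>I. q u * \<phi> t u) = q u" if u: "u \<in> U" for u
  proof -
    have "(\<Sum>t\<in>I. q u * \<phi> t u) = (\<Sum>t\<in>T. q u * \<phi> t u)"
      by (rule sum.mono_neutral_left[OF oT(1) I(2)]) (use off u in auto)
    then show ?thesis using frame_kernel_sum[OF T(1), of u] by (simp add: sum_distrib_left[symmetric])
  qed
  have colsum: "(\<Sum>u\<in>U. \<phi> t u) = 1" for t using frame_kernel_sum[OF U(1), of t] by (simp add: kernel_sym)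
  have "(\<Sum>t\<in>T. \<phi> t z * ln (\<phi> t y)) = (\<Sum>t\<in>I. \<phi> t z * ln (p t))"
    unfolding p_def by (rule sum.mono_neutral_right[OF oT(1) I(2)]) (auto simp: I_def p_def)
  also have "\<dots> = (\<Sum>t\<in>I. \<Sum>u\<in>U. q u * \<phi> t u * ln (p t))"
    unfolding \<phi>z by (simp add: sum_distrib_right)
  finally have 1: "(\<Sum>t\<in>T. \<phi> t z * ln (\<phi> t y)) = (\<Sum>t\<in>I. \<Sum>u\<in>U. q u * \<phi> t u * ln (p t))" .
  \<comment> \<open>Both logarithmic sums are written against the joint weights q u * \<phi> t u,
    which are concentrated on the support \<open>I\<close> of \<open>y\<close>.\<close>
  have "(\<Sum>u\<in>U. q u * ln (q u)) = (\<Sum>u\<in>U. (\<Sum>t\<in>I. q u * \<phi> t u) * ln (q u))"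
    using rowsum by (intro sum.cong) auto
  also have "\<dots> = (\<Sum>t\<in>I. \<Sum>u\<in>U. q u * \<phi> t u * ln (q u))"
    unfolding sum_distrib_right by (rule sum.swap)
  finally have "(\<Sum>u\<in>U. q u * ln (q u)) - (\<Sum>t\<in>T. \<phi> t z * ln (\<phi> t y)) =
      (\<Sum>t\<in>I. \<Sum>u\<in>U. q u * \<phi> t u * (ln (q u) - ln (p t)))"
    unfolding 1 by (simp add: sum_subtractf right_diff_distrib)
  also have "\<dots> \<le> (\<Sum>t\<in>I. \<Sum>u\<in>U. q u * \<phi> t u * (q u / p t - 1))"
  proof (intro sum_mono)
    fix t u assume t: "t \<in> I" and u: "u \<in> U"
    show "q u * \<phi> t u * (ln (q u) - ln (p t)) \<le> q u * \<phi> t u * (q u / p t - 1)"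
    proof (cases "q u = 0")
      case False
      then have "0 < q u" "0 < p t" using q0[OF u] pI[OF t] \<mu> by auto
      then have "ln (q u) - ln (p t) \<le> q u / p t - 1" using ln_le_minus_one[of "q u / p t"] by (simp add: ln_div)
      then show ?thesis using q0[OF u] M0[of t u] t I u by (intro mult_left_mono) auto
    qed simp
  qed
  \<comment> \<open>Completing the square costs the totals of q u * \<phi> t u and of \<phi> t u * p
    t; both are 1 and cancel.\<close>
  also have "\<dots> = (\<Sum>t\<in>I. \<Sum>u\<in>U. \<phi> t u * (q u - p t)\<^sup>2 / p t)"
  proof -
    have e: "q u * \<phi> t u * (q u / p t - 1) = \<phi> t u * (q u - p t)\<^sup>2 / p t + q u * \<phi> t u - \<phi> t u * p t"
      if "t \<in> I" for t u
      using pI[OF that] \<mu> by (simp add: field_simps power2_eq_square)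
    have "(\<Sum>t\<in>I. \<Sum>u\<in>U. q u * \<phi> t u * (q u / p t - 1)) =
       (\<Sum>t\<in>I. \<Sum>u\<in>U. \<phi> t u * (q u - p t)\<^sup>2 / p t + q u * \<phi> t u - \<phi> t u * p t)"
      using e by (intro sum.cong) auto
    also have "\<dots> = (\<Sum>t\<in>I. \<Sum>u\<in>U. \<phi> t u * (q u - p t)\<^sup>2 / p t) + (\<Sum>t\<in>I. \<Sum>u\<in>U. q u * \<phi> t u) -
       (\<Sum>t\<in>I. \<Sum>u\<in>U. \<phi> t u * p t)"
      by (simp add: sum.distrib sum_subtractf)
    also have "(\<Sum>t\<in>I. \<Sum>u\<in>U. q u * \<phi> t u) = 1"
    proof -
      have "(\<Sum>t\<in>I. \<Sum>u\<in>U. q u * \<phi> t u) = (\<Sum>u\<in>U. \<Sum>t\<in>I. q u * \<phi> t u)" by (rule sum.swap)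
      also have "\<dots> = (\<Sum>u\<in>U. q u)" using rowsum by (intro sum.cong) auto
      finally show ?thesis using frame_kernel_sum[OF U(1), of z] by (simp add: q_def)
    qed
    also have "(\<Sum>t\<in>I. \<Sum>u\<in>U. \<phi> t u * p t) = 1"
    proof -
      have "(\<Sum>t\<in>I. \<Sum>u\<in>U. \<phi> t u * p t) = (\<Sum>t\<in>I. p t)" using colsum by (simp add: sum_distrib_right[symmetric])
      also have "\<dots> = (\<Sum>t\<in>T. p t)" by (rule sum.mono_neutral_left[OF oT(1) I(2)]) (auto simp: I_def)
      finally show ?thesis using frame_kernel_sum[OF T(1), of y] by (simp add: p_def)
    qed
    finally show ?thesis by simp
  qed
  also have "\<dots> \<le> (\<Sum>t\<in>I. \<Sum>u\<in>U. \<phi> t u * (q u - p t)\<^sup>2 / \<mu>)"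
    using pI \<mu> M0 I by (intro sum_mono divide_left_mono) (auto intro!: mult_pos_pos dest: less_le_trans)
  also have "\<dots> \<le> (\<Sum>t\<in>T. \<Sum>u\<in>U. \<phi> t u * (q u - p t)\<^sup>2 / \<mu>)"
    by (rule sum_mono2[OF oT(1) I(2)]) (use M0 \<mu> in \<open>auto intro!: sum_nonneg\<close>)
  also have "\<dots> = (\<Sum>t\<in>T. \<Sum>u\<in>U. \<phi> t u * (q u - p t)\<^sup>2) / \<mu>" by (simp add: sum_divide_distrib)
  \<comment> \<open>Row and column sums 1 reduce the square terms to \<phi> z z and \<phi> y y; the
    mixed term is \<phi> z y.\<close>
  also have "(\<Sum>t\<in>T. \<Sum>u\<in>U. \<phi> t u * (q u - p t)\<^sup>2) = b (z - y) (z - y)"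
  proof -
    have "(\<Sum>t\<in>T. \<Sum>u\<in>U. \<phi> t u * (q u - p t)\<^sup>2) =
        (\<Sum>t\<in>T. \<Sum>u\<in>U. \<phi> t u * (q u * q u) + \<phi> t u * (p t * p t) - 2 * (p t * (q u * \<phi> t u)))"
      by (intro sum.cong) (simp_all add: power2_eq_square algebra_simps)
    also have "\<dots> = (\<Sum>t\<in>T. \<Sum>u\<in>U. \<phi> t u * (q u * q u)) + (\<Sum>t\<in>T. \<Sum>u\<in>U. \<phi> t u * (p t * p t))
         - 2 * (\<Sum>t\<in>T. \<Sum>u\<in>U. p t * (q u * \<phi> t u))"
      by (simp add: sum.distrib sum_subtractf sum_distrib_left)
    also have "(\<Sum>t\<in>T. \<Sum>u\<in>U. \<phi> t u * (q u * q u)) = \<phi> z z"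
    proof -
      have "(\<Sum>t\<in>T. \<Sum>u\<in>U. \<phi> t u * (q u * q u)) = (\<Sum>u\<in>U. (\<Sum>t\<in>T. \<phi> t u) * (q u * q u))"
        unfolding sum_distrib_right by (rule sum.swap)
      also have "\<dots> = (\<Sum>u\<in>U. q u * q u)" using frame_kernel_sum[OF T(1)] by simp
      also have "\<dots> = \<phi> z z" using kernel_expand[OF U, of z] kernel_sym by (simp add: q_def)
      finally show ?thesis .
    qed
    also have "(\<Sum>t\<in>T. \<Sum>u\<in>U. \<phi> t u * (p t * p t)) = \<phi> y y"
      using colsum kernel_expand[OF T, of y] kernel_sym by (simp add: p_def sum_distrib_right[symmetric])
    also have "(\<Sum>t\<in>T. \<Sum>u\<in>U. p t * (q u * \<phi> t u)) = \<phi> z y"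
    proof -
      have "(\<Sum>t\<in>T. \<Sum>u\<in>U. p t * (q u * \<phi> t u)) = (\<Sum>t\<in>T. p t * \<phi> t z)"
        unfolding \<phi>z by (simp add: sum_distrib_left)
      then show ?thesis using kernel_expand[OF T, of z] kernel_sym by (simp add: p_def)
    qed
    finally show ?thesis using kernel_dist[of z y] by simp
  qed
  finally show ?thesis by (simp add: q_def)
qed

section \<open>The candidate divergence and states outside a face\<close>

definition frame_of :: "'a \<Rightarrow> 'a set" where
  "frame_of x = (SOME T. frame T \<and> x = (\<Sum>t\<in>T. \<phi> t x *\<^sub>R t))"

lemma frame_of:
  assumes "x \<in> S" shows "frame (frame_of x)" "x = (\<Sum>t\<in>frame_of x. \<phi> t x *\<^sub>R t)"
  using someI_ex[OF frame_decomposition[OF assms]] unfolding frame_of_def by auto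

text \<open>
  Inside the face of \<open>y\<close>, \<open>\<phi> t y = 0\<close> implies \<open>\<phi> t x = 0\<close>, so the junk value \<open>ln 0 = 0\<close> is harmless. The
  relative entropy is nonnegative anyway; \<open>max\<close> only saves the proof of this.
\<close>

definition D0 :: "'a \<Rightarrow> 'a \<Rightarrow> ereal" where
  "D0 x y = (if inface S y x
     then ereal (max 0 ((\<Sum>u\<in>frame_of x. \<phi> u x * ln (\<phi> u x)) - (\<Sum>t\<in>frame_of y. \<phi> t x * ln (\<phi> t y))))
     else \<infinity>)"

lemma D0_nonneg: "0 \<le> D0 x y"
  by (simp add: D0_def zero_ereal_def)

text \<open>
  If \<open>x\<close> is outside the face of \<open>y\<close>, then the face of their midpoint contains a pure state \<open>v\<close>
  orthogonal to \<open>y\<close>. Otherwise all weights of \<open>y\<close> in a frame of that face would be positive.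
\<close>

lemma not_inface_pure:
  assumes x: "x \<in> S" and y: "y \<in> S" and n: "\<not> inface S y x"
  shows "\<exists>v. pure_state S v \<and> inface S ((1 - 1/2) *\<^sub>R x + (1/2) *\<^sub>R y) v \<and> \<phi> v y = 0"
proof -
  define w where "w = (1 - 1/2) *\<^sub>R x + (1/2::real) *\<^sub>R y"
  have wS: "w \<in> S" unfolding w_def by (rule convexD[OF convex_S x y]) auto
  obtain T where T: "frame T" "w = (\<Sum>t\<in>T. \<phi> t w *\<^sub>R t)" using frame_decomposition[OF wS] by blast
  note oT = orthosetD[OF frameD(1)[OF T(1)]]
  \<comment> \<open>The pure states in \<open>I\<close> carry the face of the midpoint.
    \<open>V\<close> and \<open>X\<close> below are orthogonal families in that face, adapted to
    \<open>y\<close> and \<open>x\<close>, with the same sum as \<open>I\<close>.\<close>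
  define I where "I = {t\<in>T. \<phi> t w \<noteq> 0}"
  have I: "I \<subseteq> T" "finite I" using oT(1) by (auto simp: I_def)
  have off: "\<phi> t x = 0" "\<phi> t y = 0" if "t \<in> T - I" for t
  proof -
    have "\<phi> t w = 0" using that by (auto simp: I_def)
    then have "\<phi> t x + \<phi> t y = 0" unfolding w_def kernel_mix by simp
    moreover have "0 \<le> \<phi> t x" "0 \<le> \<phi> t y" using kernel_range[OF oT(2)] x y that by auto
    ultimately show "\<phi> t x = 0" "\<phi> t y = 0" by auto
  qed
  obtain V where V: "orthoset V" "\<And>v t. v \<in> V \<Longrightarrow> t \<in> T - I \<Longrightarrow> \<phi> t v = 0" "\<Sum>V = \<Sum>I" "card V = card I" "y = (\<Sum>v\<in>V. \<phi> v y *\<^sub>R v)"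
    using face_frame[OF T(1) I(1) y off(2)] by blast
  obtain X where X: "orthoset X" "\<Sum>X = \<Sum>I" "card X = card I" "x = (\<Sum>v\<in>X. \<phi> v x *\<^sub>R v)"
    using face_frame[OF T(1) I(1) x off(1)] by blast
  note oV = orthosetD[OF V(1)] and oX = orthosetD[OF X(1)]
  have sumI: "(\<Sum>t\<in>I. \<phi> t z) = 1" if "\<And>t. t \<in> T - I \<Longrightarrow> \<phi> t z = 0" for z
  proof -
    have "(\<Sum>t\<in>T. \<phi> t z) = (\<Sum>t\<in>I. \<phi> t z)"
      by (rule sum.mono_neutral_right[OF oT(1) I(1)]) (use that in auto)
    then show ?thesis using frame_kernel_sum[OF T(1)] by simp
  qed
  have "I \<noteq> {}" using sumI[OF off(1)] by auto
  have kernel_total: "(\<Sum>v\<in>Z. \<phi> v z) = 1"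
    if Z: "orthoset Z" "\<Sum>Z = \<Sum>I" "card Z = card I" and z: "\<And>t. t \<in> T - I \<Longrightarrow> \<phi> t z = 0" for Z z
  proof -
    have fin: "finite Z" using orthosetD(1)[OF Z(1)] .
    define k where "k = real (card I)"
    have k: "0 < k" using \<open>I \<noteq> {}\<close> I by (simp add: k_def card_gt_0_iff)
    have "(\<Sum>v\<in>Z. 1 / k) = 1" "(\<Sum>v\<in>I. 1 / k) = 1" using k Z(3) by (auto simp: k_def)
    from kernel_sum[OF this(1), of z "\<lambda>v. v"] kernel_sum[OF this(2), of z "\<lambda>v. v"]
    have "(\<Sum>v\<in>Z. (1 / k) * \<phi> z v) = (\<Sum>v\<in>I. (1 / k) * \<phi> z v)"
      using Z(2) by (simp add: scaleR_sum_right[symmetric] del: times_divide_eq_left)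
    then have "(\<Sum>v\<in>Z. \<phi> z v) = (\<Sum>v\<in>I. \<phi> z v)" using k by (simp add: sum_divide_distrib[symmetric])
    then show ?thesis using sumI[OF z] by (simp add: kernel_sym)
  qed
  have Xx: "(\<Sum>v\<in>X. \<phi> v x) = 1" and Vy: "(\<Sum>v\<in>V. \<phi> v y) = 1"
    using kernel_total[OF X(1-3) off(1)] kernel_total[OF V(1,3,4) off(2)] by auto
  have y0: "0 \<le> \<phi> v y" if "v \<in> V" for v using kernel_range[OF oV(2)[OF that] y] by simp
  have x1: "0 \<le> \<phi> v x" "\<phi> v x \<le> 1" if "v \<in> X" for v using kernel_range[OF oX(2)[OF that] x] by auto
  have "V \<noteq> {}" using Vy by auto
  have "\<exists>v\<in>V. \<phi> v y = 0"
  proof (rule ccontr)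
    assume "\<not> ?thesis"
    then have pos: "0 < \<phi> v y" if "v \<in> V" for v using y0[OF that] that by force
    \<comment> \<open>Below every weight of \<open>y\<close>, so y - \<mu> x has nonnegative weights
      once \<mu> times the sum of \<open>V\<close> is traded for \<mu> times the equal sum of
      \<open>X\<close>. The bound 1/2 keeps \<open>\<mu>\<close> below 1.\<close>
    define \<mu> where "\<mu> = min (1/2) (Min ((\<lambda>v. \<phi> v y) ` V))"
    have \<mu>: "0 < \<mu>" "\<mu> < 1" "\<And>v. v \<in> V \<Longrightarrow> \<mu> \<le> \<phi> v y"
      using pos oV(1) \<open>V \<noteq> {}\<close> by (auto simp: \<mu>_def min_le_iff_disj)
    have "inface S y x"
    proof (rule infaceI_sum[where V="V \<union> X" and \<delta>=\<mu> and
          w="\<lambda>v. (if v \<in> V then \<phi> v y - \<mu> else 0) + (if v \<in> X then \<mu> * (1 - \<phi> v x) else 0)"])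
      let ?f = "\<lambda>v. if v \<in> V then \<phi> v y - \<mu> else 0" and ?g = "\<lambda>v. if v \<in> X then \<mu> * (1 - \<phi> v x) else 0"
      show "0 \<le> ?f v + ?g v" if "v \<in> V \<union> X" for v
        using \<mu> x1 by (intro add_nonneg_nonneg) auto
      have s: "(\<Sum>v\<in>V \<union> X. ?f v + ?g v) = (\<Sum>v\<in>V. \<phi> v y - \<mu>) + (\<Sum>v\<in>X. \<mu> * (1 - \<phi> v x))"
        using oV(1) oX(1) by (simp add: sum.distrib sum.If_cases Int_absorb1 Int_absorb2)
      also have "\<dots> = 1 - \<mu>"
        using Xx Vy V(4) X(3) by (simp add: sum_subtractf right_diff_distrib sum_distrib_left[symmetric])
      finally show "(\<Sum>v\<in>V \<union> X. ?f v + ?g v) = 1 - \<mu>" .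
      have "(\<Sum>v\<in>V \<union> X. (?f v + ?g v) *\<^sub>R v) = (\<Sum>v\<in>V \<union> X. ?f v *\<^sub>R v) + (\<Sum>v\<in>V \<union> X. ?g v *\<^sub>R v)"
        by (simp add: scaleR_left.add sum.distrib)
      also have "(\<Sum>v\<in>V \<union> X. ?f v *\<^sub>R v) = (\<Sum>v\<in>V. (\<phi> v y - \<mu>) *\<^sub>R v)"
        using oV(1) oX(1) by (intro sum.mono_neutral_cong_right) auto
      also have "\<dots> = y - \<mu> *\<^sub>R \<Sum>I"
        using V(3,5) by (simp add: scaleR_left.diff sum_subtractf scaleR_sum_right[symmetric])
      also have "(\<Sum>v\<in>V \<union> X. ?g v *\<^sub>R v) = (\<Sum>v\<in>X. (\<mu> * (1 - \<phi> v x)) *\<^sub>R v)"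
        using oV(1) oX(1) by (intro sum.mono_neutral_cong_right) auto
      also have "\<dots> = \<mu> *\<^sub>R (\<Sum>I - x)"
        using X(2,4) by (simp add: scaleR_left.diff sum_subtractf scaleR_sum_right[symmetric] scaleR_scaleR[symmetric] del: scaleR_scaleR)
      finally show "y = \<mu> *\<^sub>R x + (\<Sum>v\<in>V \<union> X. (?f v + ?g v) *\<^sub>R v)" by (simp add: algebra_simps)
    qed (use \<mu> oV oX in auto)
    then show False using n by blast
  qed
  then obtain v where v: "v \<in> V" "\<phi> v y = 0" by blast
  have "inface S w v"
  proof -
    have w0: "0 < \<phi> t w" if "t \<in> I" for t
      using kernel_range[OF oT(2) wS, of t] that by (auto simp: I_def less_le)
    \<comment> \<open>The same exchange at \<open>w\<close>: \<mu> times the sum of \<open>I\<close>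
      is traded for \<mu> times the sum of \<open>V\<close>, from which \<open>v\<close> can be
      taken out.\<close>
    define \<mu> where "\<mu> = min (1/2) (Min ((\<lambda>t. \<phi> t w) ` I))"
    have \<mu>: "0 < \<mu>" "\<mu> < 1" "\<And>t. t \<in> I \<Longrightarrow> \<mu> \<le> \<phi> t w"
      using w0 I \<open>I \<noteq> {}\<close> by (auto simp: \<mu>_def min_le_iff_disj)
    have wI: "w = (\<Sum>t\<in>I. \<phi> t w *\<^sub>R t)"
      by (subst T(2), rule sum.mono_neutral_right[OF oT(1) I(1)]) (auto simp: I_def)
    have Iw: "(\<Sum>t\<in>I. \<phi> t w) = 1" by (rule sumI) (auto simp: I_def)
    show ?thesis
    proof (rule infaceI_sum[where V="I \<union> V" and \<delta>=\<mu> and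
          w="\<lambda>u. (if u \<in> I then \<phi> u w - \<mu> else 0) + (if u \<in> V then (if u = v then 0 else \<mu>) else 0)"])
      let ?f = "\<lambda>u. if u \<in> I then \<phi> u w - \<mu> else 0" and ?g = "\<lambda>u. if u \<in> V then (if u = v then 0 else \<mu>) else 0"
      show "0 \<le> ?f u + ?g u" if "u \<in> I \<union> V" for u
        using \<mu> by (intro add_nonneg_nonneg) auto
      have g: "(\<Sum>u\<in>I \<union> V. ?g u) = (\<Sum>u\<in>V - {v}. \<mu>)"
        using oV(1) I(2) by (intro sum.mono_neutral_cong_right) auto
      have f: "(\<Sum>u\<in>I \<union> V. ?f u) = (\<Sum>u\<in>I. \<phi> u w - \<mu>)"
        using oV(1) I(2) by (intro sum.mono_neutral_cong_right) auto
      have "real (card (V - {v})) = real (card I) - 1"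
        using v(1) oV(1) V(4) by (metis card.remove add_diff_cancel_left' of_nat_Suc)
      then show "(\<Sum>u\<in>I \<union> V. ?f u + ?g u) = 1 - \<mu>"
      proof -
        assume card: "real (card (V - {v})) = real (card I) - 1"
        have "(\<Sum>u\<in>I \<union> V. ?f u) = 1 - real (card I) * \<mu>" unfolding f using Iw by (simp add: sum_subtractf)
        moreover have "(\<Sum>u\<in>I \<union> V. ?g u) = (real (card I) - 1) * \<mu>" unfolding g card[symmetric] by simp
        ultimately show ?thesis unfolding sum.distrib by (simp add: algebra_simps)
      qed
      have "(\<Sum>u\<in>I \<union> V. (?f u + ?g u) *\<^sub>R u) = (\<Sum>u\<in>I \<union> V. ?f u *\<^sub>R u) + (\<Sum>u\<in>I \<union> V. ?g u *\<^sub>R u)"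
        by (simp add: scaleR_left.add sum.distrib)
      also have "(\<Sum>u\<in>I \<union> V. ?f u *\<^sub>R u) = (\<Sum>u\<in>I. (\<phi> u w - \<mu>) *\<^sub>R u)"
        using oV(1) I(2) by (intro sum.mono_neutral_cong_right) auto
      also have "\<dots> = w - \<mu> *\<^sub>R \<Sum>I"
        using wI by (simp add: scaleR_left.diff sum_subtractf scaleR_sum_right[symmetric])
      also have "(\<Sum>u\<in>I \<union> V. ?g u *\<^sub>R u) = (\<Sum>u\<in>V - {v}. \<mu> *\<^sub>R u)"
        using oV(1) I(2) by (intro sum.mono_neutral_cong_right) auto
      also have "\<dots> = \<mu> *\<^sub>R (\<Sum>I - v)"
      proof -
        have "\<Sum>(V - {v}) = \<Sum>I - v"
          using V(3) sum.remove[OF oV(1) v(1), of "\<lambda>u. u"] by (simp add: algebra_simps)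
        then show ?thesis by (simp add: scaleR_sum_right[symmetric])
      qed
      finally show "w = \<mu> *\<^sub>R v + (\<Sum>u\<in>I \<union> V. (?f u + ?g u) *\<^sub>R u)" by (simp add: algebra_simps)
    qed (use \<mu> oV orthosetD(3)[OF frameD(1)[OF T(1)]] I in auto)
  qed
  then show ?thesis using v oV(2)[OF v(1)] by (auto simp: w_def)
qed

end

section \<open>Uniqueness of the regret\<close>

context iso_decision
begin

text \<open>On the segment from \<open>t\<close> through \<open>c\<close> to the complementary state
  \<open>m\<close>, the nonnegative function F - val a has an interior zero at \<open>c\<close>. Its
  value and derivative both vanish there, which determines it at \<open>t\<close>; since 1 - r0 = 1
  / N, the result is the same for every \<open>t\<close>.\<close>

lemma central_action:
  assumes a: "optimal_for A c a" and t: "pure_state S t"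
  shows "F t = val a t + C * ln (real N)"
proof -
  note tS = pure_in[OF t]
  obtain m where m: "m \<in> S" "c = (1 - 1 / real N) *\<^sub>R m + (1 / real N) *\<^sub>R t"
    using center_decomposition[OF tS] by blast
  have fin: "mean (a x) \<noteq> -\<infinity>" if "x \<in> S" for x
    by (rule optimal_finite[OF a center that inface_center[OF that]])
  have N: "2 \<le> real N" using two_le_N by simp
  have "(1 - 1 / real N) * \<phi> t m = 0"
    using kernel_center[of t] kernel_pure[OF t] kernel_mix[of t "1 / real N" m t] m(2) by simp
  then have tm: "\<phi> t m = 0" using N by simp
  define r0 where "r0 = 1 - 1 / real N"
  have r0: "0 < r0" "r0 < 1" using N by (auto simp: r0_def)
  define g where "g r = (1 - r) * (F t - val a t) + r * (F m - val a m) + C * (r * ln r + (1 - r) * ln (1 - r))" for r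
  have g: "g r = F ((1 - r) *\<^sub>R t + r *\<^sub>R m) - val a ((1 - r) *\<^sub>R t + r *\<^sub>R m)" if "0 < r" "r < 1" for r
    using F_mix[OF t m(1) tm, of r] val_mix(2)[OF optimalD(1)[OF a] tS m(1), of r] fin tS m(1) h_entropy[of r] that
    by (simp add: g_def algebra_simps)
  have g_ge: "0 \<le> g r" if "0 < r" "r < 1" for r
  proof -
    have "(1 - r) *\<^sub>R t + r *\<^sub>R m \<in> S" using mixture_in[OF tS m(1)] that by simp
    then show ?thesis using g[OF that] val_le[OF optimalD(1)[OF a] _ fin] by simp
  qed
  have "(1 - r0) *\<^sub>R t + r0 *\<^sub>R m = c" using m(2) by (simp add: r0_def add.commute)
  then have g0: "g r0 = 0" using g[OF r0] optimal_val[OF a center] by simp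
  define l where "l = - (F t - val a t) + (F m - val a m) + C * (ln r0 - ln (1 - r0))"
  have "(g has_real_derivative l) (at r0)"
  proof -
    have "((\<lambda>p. p * ln p) has_real_derivative ln r0 + 1) (at r0)"
      using r0 by (auto intro!: derivative_eq_intros)
    moreover have "((\<lambda>p. (1 - p) * ln (1 - p)) has_real_derivative - ln (1 - r0) - 1) (at r0)"
      using r0 by (auto intro!: derivative_eq_intros)
    moreover have "((\<lambda>p. (1 - p) * (F t - val a t)) has_real_derivative - (F t - val a t)) (at r0)"
      "((\<lambda>p. p * (F m - val a m)) has_real_derivative F m - val a m) (at r0)"
      by (auto intro!: derivative_eq_intros)
    ultimately have "(g has_real_derivative - (F t - val a t) + (F m - val a m) +
        C * ((ln r0 + 1) + (- ln (1 - r0) - 1))) (at r0)"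
      unfolding g_def[abs_def] by (intro DERIV_add DERIV_cmult)
    then show ?thesis by (simp add: l_def)
  qed
  moreover have "0 < min r0 (1 - r0)" using r0 by simp
  moreover have "\<forall>y. \<bar>r0 - y\<bar> < min r0 (1 - r0) \<longrightarrow> g r0 \<le> g y"
    using g_ge g0 by (auto simp: abs_less_iff)
  ultimately have "l = 0" by (rule DERIV_local_min)
  then have 1: "F m - val a m = (F t - val a t) - C * (ln r0 - ln (1 - r0))" by (simp add: l_def)
  have "F t - val a t = - C * ln (1 - r0)"
    using g0 unfolding g_def 1 by (simp add: algebra_simps)
  also have "1 - r0 = 1 / real N" by (simp add: r0_def)
  finally show ?thesis using N by (simp add: ln_div)
qed

lemma regret_determined:
  assumes x: "x \<in> S" and y: "y \<in> S"
  shows "regret A x y = ereal C * D0 x y"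
proof -
  obtain a0 where a0: "optimal_for A c a0" using optimal_exists[OF center] by blast
  have fin0: "mean (a0 x) \<noteq> -\<infinity>" if "x \<in> S" for x
    by (rule optimal_finite[OF a0 center that inface_center[OF that]])
  \<comment> \<open>By \<open>central_action\<close> this affine function agrees with
    \<open>F\<close> on the pure states.\<close>
  define l where "l x = val a0 x + C * ln (real N)" for x
  have l_mix: "l ((1 - u) *\<^sub>R x + u *\<^sub>R y) = (1 - u) * l x + u * l y" if "x \<in> S" "y \<in> S" "0 \<le> u" "u \<le> 1" for x y u
    using val_mix(2)[OF optimalD(1)[OF a0] that fin0[OF that(1)] fin0[OF that(2)]]
    by (simp add: l_def algebra_simps)
  have "affine_map_on S l" unfolding affine_map_on_def using l_mix by simp
  note l_sum = affine_map_on_sum[OF convex_S this]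
  \<comment> \<open>Valid for every frame adapted to \<open>x\<close>, so the arbitrary choice in
    \<open>frame_of\<close> does no harm.\<close>
  have F_frame: "F x = l x + C * (\<Sum>u\<in>U. \<phi> u x * ln (\<phi> u x))"
    if x: "x \<in> S" and U: "frame U" "x = (\<Sum>u\<in>U. \<phi> u x *\<^sub>R u)" for x U
  proof -
    note o = orthosetD[OF frameD(1)[OF U(1)]]
    have w: "0 \<le> \<phi> u x" if "u \<in> U" for u using kernel_range[OF o(2)[OF that] x] by simp
    have "F x = (\<Sum>u\<in>U. \<phi> u x * F u) + C * (\<Sum>u\<in>U. \<phi> u x * ln (\<phi> u x))"
      using F_orthoset[OF frameD(1)[OF U(1)] w frame_kernel_sum[OF U(1)]] U(2) by simp
    also have "(\<Sum>u\<in>U. \<phi> u x * F u) = (\<Sum>u\<in>U. \<phi> u x * l u)"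
      using central_action[OF a0 o(2)] by (intro sum.cong) (auto simp: l_def)
    also have "\<dots> = l x"
      using l_sum[OF o(1) w o(3) frame_kernel_sum[OF U(1)], of "\<lambda>u. u"] U(2) by simp
    finally show ?thesis .
  qed
  define T where "T = frame_of y"
  note T = frame_of[OF y, folded T_def] and oT = orthosetD[OF frameD(1)[OF frame_of(1)[OF y]], folded T_def]
  \<comment> \<open>The candidate tangent of \<open>F\<close> at \<open>y\<close>.\<close>
  define R where "R z = l z + C * (\<Sum>t\<in>T. \<phi> t z * ln (\<phi> t y))" for z
  have R_mix: "R ((1 - u) *\<^sub>R z + u *\<^sub>R z') = (1 - u) * R z + u * R z'" if "z \<in> S" "z' \<in> S" "0 \<le> u" "u \<le> 1" for z z' u
    unfolding R_def l_mix[OF that] kernel_mix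
    by (simp add: algebra_simps sum.distrib sum_distrib_left sum_subtractf)
  have Ry: "R y = F y" using F_frame[OF y T] by (simp add: R_def)
  \<comment> \<open>An optimal action stays below \<open>F\<close>, and at (1 - e) y + e z the
    payoff exceeds \<open>R\<close> by at most e * e * K. Dividing by \<open>e\<close> and letting
    it tend to 0 leaves \<open>R\<close>.\<close>
  have upper: "val a z \<le> R z" if a: "optimal_for A y a" and z: "z \<in> S" and f: "inface S y z" for a z
  proof -
    define \<mu> where "\<mu> = Min (insert 1 ((\<lambda>t. \<phi> t y) ` {t\<in>T. \<phi> t y \<noteq> 0}))"
    have "0 < \<phi> t y" if "t \<in> T" "\<phi> t y \<noteq> 0" for t using kernel_range[OF oT(2)[OF that(1)] y] that by simp
    then have \<mu>: "0 < \<mu>" "\<And>t. t \<in> T \<Longrightarrow> \<phi> t y \<noteq> 0 \<Longrightarrow> \<mu> \<le> \<phi> t y"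
      using oT(1) by (auto simp: \<mu>_def)
    define K where "K = C * (b (z - y) (z - y) / \<mu>)"
    have b0: "0 \<le> b (z - y) (z - y)"
      using b_pos[of "z - y"] bilinear_lzero[OF bilinear_b, of 0] by (cases "z - y = 0") auto
    have K0: "0 \<le> K" using C_nonneg \<mu> b0 by (simp add: K_def)
    have "val a z \<le> R z + e * K" if e: "0 < e" "e < 1" for e
    proof -
      define p where "p = (1 - e) *\<^sub>R y + e *\<^sub>R z"
      have pS: "p \<in> S" unfolding p_def by (rule mixture_in[OF y z]) (use e in auto)
      obtain U where U: "frame U" "p = (\<Sum>u\<in>U. \<phi> u p *\<^sub>R u)" using frame_decomposition[OF pS] by blast
      have "p - y = e *\<^sub>R (z - y)" by (simp add: p_def algebra_simps)
      then have bp: "b (p - y) (p - y) = e * e * b (z - y) (z - y)"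
        by (simp add: bilinear_lmul[OF bilinear_b] bilinear_rmul[OF bilinear_b])
      have sub: "\<phi> t p = 0" if "t \<in> T" "\<phi> t y = 0" for t
        using kernel_inface[OF f z oT(2)[OF that(1)] that(2)] that(2) by (simp add: p_def kernel_mix)
      have "(\<Sum>u\<in>U. \<phi> u p * ln (\<phi> u p)) - (\<Sum>t\<in>T. \<phi> t p * ln (\<phi> t y)) \<le> b (p - y) (p - y) / \<mu>"
        by (rule entropy_chi_square[OF T U pS y sub \<mu>])
      then have "C * ((\<Sum>u\<in>U. \<phi> u p * ln (\<phi> u p)) - (\<Sum>t\<in>T. \<phi> t p * ln (\<phi> t y))) \<le> C * (b (p - y) (p - y) / \<mu>)"
        using C_nonneg by (rule mult_left_mono)
      then have "F p \<le> R p + e * e * K"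
        using F_frame[OF pS U] by (simp add: R_def K_def bp algebra_simps)
      moreover have "mean (a y) \<noteq> -\<infinity>" using optimalD(2)[OF a y] by simp
      from val_mix[OF optimalD(1)[OF a] y z _ _ this optimal_finite[OF a y z f], of e] val_le[OF optimalD(1)[OF a] pS]
      have "(1 - e) * F y + e * val a z \<le> F p"
        using e optimal_val[OF a y] by (simp add: p_def)
      moreover have "R p = (1 - e) * F y + e * R z" using R_mix[OF y z, of e] e Ry by (simp add: p_def)
      ultimately have "e * val a z \<le> e * (R z + e * K)" by (simp add: algebra_simps)
      then show ?thesis using e by simp
    qed
    then have lim: "val a z \<le> R z + e" if "0 < e" for e
    proof -
      define d where "d = min (1/2) (e / (K + 1))"
      have "0 < d" "d < 1" "d * K \<le> e"
      proof -
        have "d * K \<le> e / (K + 1) * K" using K0 by (intro mult_right_mono) (auto simp: d_def)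
        also have "\<dots> \<le> e" using K0 that by (simp add: field_simps)
        finally show "d * K \<le> e" .
      qed (use K0 that in \<open>auto simp: d_def\<close>)
      then show ?thesis using \<open>\<And>e. 0 < e \<Longrightarrow> e < 1 \<Longrightarrow> val a z \<le> R z + e * K\<close>[of d] by simp
    qed
    show ?thesis by (rule field_le_epsilon[OF lim])
  qed
  \<comment> \<open>\<open>y\<close> is a proper mixture of \<open>x\<close> and some
    \<open>z\<close> in its face, and the action agrees with \<open>R\<close> at \<open>y\<close>;
    as it exceeds \<open>R\<close> at neither end, it equals \<open>R\<close> at both.\<close>
  have exact: "val a x = R x" if a: "optimal_for A y a" and f: "inface S y x" for a
  proof -
    obtain \<delta> z where z: "0 < \<delta>" "\<delta> < 1" "z \<in> S" "y = (1 - \<delta>) *\<^sub>R z + \<delta> *\<^sub>R x"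
      using f by (auto simp: inface_def)
    have fz: "inface S y z" unfolding inface_def
      by (rule exI[of _ "1 - \<delta>"], rule exI[of _ x]) (use z x in \<open>auto simp: add.commute\<close>)
    have "F y = (1 - \<delta>) * val a z + \<delta> * val a x"
      using val_mix(2)[OF optimalD(1)[OF a] z(3) x _ _ optimal_finite[OF a y z(3) fz] optimal_finite[OF a y x f], of \<delta>]
        z optimal_val[OF a y] by simp
    moreover have "F y = (1 - \<delta>) * R z + \<delta> * R x" using R_mix[OF z(3) x, of \<delta>] z Ry by simp
    moreover have "(1 - \<delta>) * val a z \<le> (1 - \<delta>) * R z" using upper[OF a z(3) fz] z by (intro mult_left_mono) auto
    ultimately have "\<delta> * R x \<le> \<delta> * val a x" by linarith
    then show ?thesis using upper[OF a x f] z by simp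
  qed
  have outside: "mean (a x) = -\<infinity>" if a: "optimal_for A y a" and f: "\<not> inface S y x" and C: "0 < C" for a
  proof (rule ccontr)
    assume nx: "mean (a x) \<noteq> -\<infinity>"
    obtain v where v: "pure_state S v" "inface S ((1 - 1/2) *\<^sub>R x + (1/2) *\<^sub>R y) v" "\<phi> v y = 0"
      using not_inface_pure[OF x y f] by blast
    have ny: "mean (a y) \<noteq> -\<infinity>" using optimalD(2)[OF a y] by simp
    have "mean (a ((1 - 1/2) *\<^sub>R x + (1/2) *\<^sub>R y)) \<noteq> -\<infinity>"
      using val_mix(1)[OF optimalD(1)[OF a] x y _ _ nx ny, of "1/2"] by simp
    then have nv: "mean (a v) \<noteq> -\<infinity>"
      by (intro mean_finite_inface[OF optimalD(1)[OF a] mixture_in[OF x y] _ pure_in[OF v(1)] v(2)]) auto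
    \<comment> \<open>Chosen so that C * K exceeds F v - val a v by 1. Mixing \<open>v\<close> into
      \<open>y\<close> with weight r = exp (- K) lowers \<open>F\<close> by at least r * C * K below
      linear interpolation, which would put the action above \<open>F\<close>.\<close>
    define K where "K = (F v - val a v + 1) / C"
    have "0 < K" using val_le[OF optimalD(1)[OF a] pure_in[OF v(1)] nv] C by (simp add: K_def)
    define r where "r = exp (- K)"
    have r: "0 < r" "r < 1" "ln r = - K" using \<open>0 < K\<close> by (auto simp: r_def)
    let ?z = "(1 - (1 - r)) *\<^sub>R v + (1 - r) *\<^sub>R y"
    have zS: "?z \<in> S" by (rule mixture_in[OF pure_in[OF v(1)] y]) (use r in auto)
    have vm: "mean (a ?z) = ereal (r * val a v + (1 - r) * F y)" "val a ?z = r * val a v + (1 - r) * F y"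
      using val_mix[OF optimalD(1)[OF a] pure_in[OF v(1)] y _ _ nv ny, of "1 - r"] r optimal_val[OF a y] by auto
    have "mean (a ?z) \<noteq> -\<infinity>" unfolding vm(1) by simp
    then have "val a ?z \<le> F ?z" by (rule val_le[OF optimalD(1)[OF a] zS])
    then have "r * val a v + (1 - r) * F y \<le> r * F v + (1 - r) * F y + h (1 - r)"
      unfolding vm(2) using F_mix[OF v(1) y v(3), of "1 - r"] r by simp
    also have "h (1 - r) = C * ((1 - r) * ln (1 - r) + r * ln r)" using h_entropy[of "1 - r"] r by simp
    finally have "r * val a v \<le> r * F v + C * ((1 - r) * ln (1 - r)) - r * (C * K)"
      by (simp add: r(3) algebra_simps)
    moreover have "C * ((1 - r) * ln (1 - r)) \<le> 0"
      using C r by (intro mult_nonneg_nonpos) auto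
    ultimately have "r * val a v \<le> r * (F v - C * K)" by (simp add: algebra_simps)
    then have "val a v \<le> F v - C * K" using r by simp
    then show False using C by (simp add: K_def)
  qed
  show ?thesis
  proof (cases "C = 0")
    \<comment> \<open>\<open>F\<close> is then affine and \<open>a0\<close> optimal everywhere, so
      the regret vanishes even outside the face, in accordance with 0 * \<infinity> = 0.\<close>
    case True
    have "val a0 z = F z" if z: "z \<in> S" for z
      using F_frame[OF z frame_of[OF z]] True by (simp add: l_def)
    then have m0: "mean (a0 z) = ereal (F z)" if "z \<in> S" for z
      using mean_eq_val[OF optimalD(1)[OF a0] that fin0[OF that]] that by simp
    then have "optimal_for A y a0" using optimalD(1)[OF a0] payoff_eq y by (simp add: optimal_for_def)
    then have "regret A x y \<le> 0" using regret_le[of y a0 x] x m0[OF x] by simp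
    then show ?thesis using regret_nonneg[OF x, of y] True by (simp add: zero_ereal_def[symmetric])
  next
    case False
    then have C: "0 < C" using C_nonneg by simp
    obtain a where a: "optimal_for A y a" using optimal_exists[OF y] by blast
    show ?thesis
    proof (cases "inface S y x")
      case True
      have eq: "ereal (F x) - mean (a x) = ereal (F x - R x)" if "optimal_for A y a" for a
        using mean_eq_val[OF optimalD(1)[OF that] x optimal_finite[OF that y x True]] exact[OF that True] by simp
      have r: "regret A x y = ereal (F x - R x)"
      proof (rule antisym)
        show "regret A x y \<le> ereal (F x - R x)" using regret_le[OF a x] unfolding eq[OF a] .
        show "ereal (F x - R x) \<le> regret A x y" by (rule regret_ge[OF x], subst eq) auto
      qed
      then have "0 \<le> F x - R x" using regret_nonneg[OF x, of y] by simp
      moreover have FR: "F x - R x = C * ((\<Sum>u\<in>frame_of x. \<phi> u x * ln (\<phi> u x)) - (\<Sum>t\<in>T. \<phi> t x * ln (\<phi> t y)))"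
        using F_frame[OF x frame_of[OF x]] by (simp add: R_def algebra_simps)
      ultimately have "0 \<le> (\<Sum>u\<in>frame_of x. \<phi> u x * ln (\<phi> u x)) - (\<Sum>t\<in>T. \<phi> t x * ln (\<phi> t y))"
        using C by (simp add: zero_le_mult_iff)
      then show ?thesis using True r FR by (simp add: D0_def T_def max_absorb2)
    next
      case False
      have "\<infinity> \<le> regret A x y"
        by (rule regret_ge[OF x]) (use outside[OF _ False C] in simp)
      then show ?thesis using False C by (simp add: D0_def)
    qed
  qed
qed

end

theorem theorem8:
  fixes S :: "'a::euclidean_space set"
  assumes "state_space S"
    and transitive_pure: "\<And>s\<^sub>1 s\<^sub>2. pure_state S s\<^sub>1 \<Longrightarrow> pure_state S s\<^sub>2 \<Longrightarrow>
          \<exists>\<Phi>. isometry_of S \<Phi> \<and> \<Phi> s\<^sub>1 = s\<^sub>2"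
    and transitive_orthogonal: "\<And>s\<^sub>1 s\<^sub>2 s\<^sub>3. pure_state S s\<^sub>1 \<Longrightarrow> pure_state S s\<^sub>2 \<Longrightarrow> pure_state S s\<^sub>3 \<Longrightarrow>
          orthogonal_states S s\<^sub>1 s\<^sub>3 \<Longrightarrow> orthogonal_states S s\<^sub>2 s\<^sub>3 \<Longrightarrow>
          \<exists>\<Phi>. isometry_of S \<Phi> \<and> \<Phi> s\<^sub>1 = s\<^sub>2 \<and> \<Phi> s\<^sub>3 = s\<^sub>3"
    and three_orthogonal: "\<exists>s\<^sub>1 s\<^sub>2 s\<^sub>3. pure_state S s\<^sub>1 \<and> pure_state S s\<^sub>2 \<and> pure_state S s\<^sub>3 \<and>
          orthogonal_states S s\<^sub>1 s\<^sub>2 \<and> orthogonal_states S s\<^sub>1 s\<^sub>3 \<and> orthogonal_states S s\<^sub>2 s\<^sub>3"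
    and spectral: "\<And>s. s \<in> S \<Longrightarrow>
          \<exists>(k::nat) (p :: nat \<Rightarrow> real) (t :: nat \<Rightarrow> 'a).
            (\<forall>i<k. 0 \<le> p i \<and> pure_state S (t i)) \<and> (\<Sum>i<k. p i) = 1 \<and>
            (\<forall>i<k. \<forall>j<k. i \<noteq> j \<longrightarrow> orthogonal_states S (t i) (t j)) \<and>
            s = (\<Sum>i<k. p i *\<^sub>R t i)"
  shows "\<exists>D\<^sub>0 :: 'a \<Rightarrow> 'a \<Rightarrow> ereal.
           (\<forall>s\<^sub>1\<in>S. \<forall>s\<^sub>2\<in>S. 0 \<le> D\<^sub>0 s\<^sub>1 s\<^sub>2) \<and>
           (\<forall>A. decision_problem S A \<and> iso_sufficiency S A \<longrightarrow>
              (\<exists>c::real. 0 \<le> c \<and> (\<forall>s\<^sub>1\<in>S. \<forall>s\<^sub>2\<in>S. regret A s\<^sub>1 s\<^sub>2 = ereal c * D\<^sub>0 s\<^sub>1 s\<^sub>2)))"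
proof -
  obtain c b N \<phi> where k: "state_kernel S c b N \<phi>"
    using state_kernel_exists[OF assms] by blast
  interpret state_kernel S c b N \<phi> by (fact k)
  show ?thesis
  \<comment> \<open>The witness is built from the kernel of \<open>S\<close> and fixed before
    \<open>A\<close>; only the factor \<open>C\<close> depends on \<open>A\<close>.\<close>
  proof (intro exI[of _ D0] conjI ballI allI impI)
    show "0 \<le> D0 s\<^sub>1 s\<^sub>2" for s\<^sub>1 s\<^sub>2 by (rule D0_nonneg)
    fix A assume A: "decision_problem S A \<and> iso_sufficiency S A"
    interpret iso_decision S c b N \<phi> A
      by unfold_locales (use A convex_S in auto)
    show "\<exists>c::real. 0 \<le> c \<and> (\<forall>s\<^sub>1\<in>S. \<forall>s\<^sub>2\<in>S. regret A s\<^sub>1 s\<^sub>2 = ereal c * D0 s\<^sub>1 s\<^sub>2)"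
      using C_nonneg regret_determined by blast
  qed
qed

end
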